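(* Let $K$ be a field of characteristic $p>0$, $k_1,\ldots,k_n\ge1$ and $m\ge0$ integers, $T=T_{k_1,\ldots,k_n}\otimes_KP_m$, $s=n+m$. For any $\sigma\in\operatorname{Aut}_K(T)$ and $a\in T$, $$\sigma^{-1}(a)=\sum_{\alpha,\beta\in\mathcal{N},\,\gamma\in\mathbb{N}^s}(-1)^{|\alpha|}\phi_{Z,\sigma}\Big({\partial'}^{[\gamma]}\big(\phi_\sigma({\delta'}^\beta(a)\,{\partial'}^{[\alpha]})\big)\Big)\,\partial^{[\beta]}x^\alpha X^\gamma$$ $$=\sum_{\alpha,\beta\in\mathcal{N},\,\gamma\in\mathbb{N}^s}\phi_{Z,\sigma}\Big({\partial'}^{[\gamma]}\big(\psi_\sigma({\partial'}^{[\alpha]}\,{\delta'}^\beta(a))\big)\Big)\,x^\alpha\partial^{[\beta]}X^\gamma ,$$ where the outer ${\partial'}^{[\gamma]}:=\prod_{i=1}^s{\partial'}_i^{[\gamma_i]}$ is a product of higher derivations of $Z$ with respect to $X_1',\ldots,X_s'$, ${\delta'}^\beta:=\prod_{j=1}^n(-\operatorname{ad}x_j')^{\beta_j}$, and the remaining notation is as in the context.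
   Context: $\mathbb{N}=\{0,1,\ldots\}$, $|\alpha|=\sum\alpha_i$, $(\operatorname{ad}r)(s)=rs-sr$. Let $P_n=K[x_1,\ldots,x_n]$. The ring of differential operators $\mathcal{D}(P_n)$ is the $K$-algebra generated by the $x_i$ and higher derivations $\partial_i^{[k]}$ ($1\le i\le n$, $k\ge1$) with defining relations $[x_i,x_j]=[\partial_i^{[k]},\partial_j^{[l]}]=0$, $\partial_i^{[k]}\partial_i^{[l]}=\binom{k+l}{k}\partial_i^{[k+l]}$, $[\partial_i^{[k]},x_j]=\delta_{ij}\partial_i^{[k-1]}$ ($\delta_{ij}$ Kronecker, $\partial_i^{[0]}:=1$). $T_{k_1,\ldots,k_n}$ is the subalgebra generated by $P_n$ and $\partial_i^{[p^j]}$, $1\le i\le n$, $0\le j<k_i$; it contains $\partial_i^{[j]}$ for $0\le j<p^{k_i}$. $P_m=K[x_{n+1},\ldots,x_{n+m}]$. $\mathcal{N}:=\{\alpha\in\mathbb{N}^n:\alpha_i<p^{k_i}\text{ for all }i\}$. For $\alpha,\beta\in\mathcal{N}$: $x^\alpha=\prod_{i=1}^nx_i^{\alpha_i}$, $\partial^{[\beta]}=\prod_{i=1}^n\partial_i^{[\beta_i]}$. Put $X_i:=x_i^{p^{k_i}}$ for $i\le n$, $X_i:=x_i$ for $n<i\le s$, $X^\gamma=\prod_{i=1}^sX_i^{\gamma_i}$. The centre of $T$ is $Z=K[X_1,\ldots,X_s]$, and $T=\bigoplus_{\alpha,\beta\in\mathcal{N}}Zx^\alpha\partial^{[\beta]}=\bigoplus_{\alpha,\beta\in\mathcal{N}}Z\partial^{[\beta]}x^\alpha$.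 Given $\sigma$, put $x_i':=\sigma(x_i)$ ($1\le i\le s$), ${\partial_i'}^{[j]}:=\sigma(\partial_i^{[j]})$ ($1\le i\le n$, $0\le j<p^{k_i}$), ${\partial'}^{[\alpha]}:=\prod_{i=1}^n{\partial_i'}^{[\alpha_i]}\in T$ for $\alpha\in\mathcal{N}$, $X_j':=\sigma(X_j)$; so $Z=K[X_1',\ldots,X_s']$. For $1\le i\le n$ let $\phi_i':=\sum_{k=0}^{p^{k_i}-1}{\partial_i'}^{[k]}(\operatorname{ad}x_i')^k$, $\psi_i':=\sum_{k=0}^{p^{k_i}-1}(\operatorname{ad}x_i')^k(\cdot)\,{\partial_i'}^{[k]}$ as maps $T\to T$; the products $\phi_n'\cdots\phi_1'$ and $\psi_n'\cdots\psi_1'$ have image $P_s':=K[x_1',\ldots,x_s']$. For $1\le i\le n$ let $\phi_{n+i}':=\phi_{n+i,k_i-1}'\cdots\phi_{n+i,1}'\phi_{n+i,0}':P_s'\to P_s'$ where $\phi_{n+i,k}':=\sum_{j=0}^{p-1}(-1)^j\frac{{x_i'}^{p^kj}}{j!}(\operatorname{ad}{\partial_i'}^{[p^k]})^j$ acts on elements of $P_s'$ that involve $x_i'$ only through ${x_i'}^{p^k}$ (mapping them to elements involving $x_i'$ only through ${x_i'}^{p^{k+1}}$). Put $\phi_\sigma:=\phi_{2n}'\cdots\phi_{n+1}'\phi_n'\cdots\phi_1'$ and $\psi_\sigma:=\phi_{2n}'\cdots\phi_{n+1}'\psi_n'\cdots\psi_1'$, maps $T\to Z$. Higher derivations of $Z$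 with respect to $X_1',\ldots,X_s'$: ${\partial'}_i^{[j]}:Z\to Z$ (distinct from the elements ${\partial_i'}^{[j]}$ of $T$) is the $K$-linear map ${X'}^\epsilon\mapsto\binom{\epsilon_i}{j}{X_1'}^{\epsilon_1}\cdots{X_i'}^{\epsilon_i-j}\cdots{X_s'}^{\epsilon_s}$ ($0$ if $\epsilon_i<j$). For $1\le i\le s$, $k\ge0$ put $\theta_{i,k}:=\sum_{j=0}^{p-1}(-1)^j\frac{{X_i'}^{p^kj}}{j!}({\partial'}_i^{[p^k]})^j$ (higher derivations of $Z$) and $\theta_i:=\cdots\theta_{i,1}\theta_{i,0}:Z\to Z$ (if $u$ has degree $<p^{k+1}$ in $X_i'$ then $\theta_i(u)=\theta_{i,k}\cdots\theta_{i,0}(u)$, further factors acting as the identity). The $\theta_i$ commute and $\phi_{Z,\sigma}:=\prod_{i=1}^s\theta_i$. In the formulas, $\partial'$ with superscript $[\gamma]$, $\gamma\in\mathbb{N}^s$, acts on $Z$; ${\partial'}^{[\alpha]}$ with $\alpha\in\mathcal{N}$ is an element of $T$, multiplied in $T$. *)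

theory Defs
  imports Complex_Main "HOL-Library.Poly_Mapping" "HOL-Library.FuncSet"
begin

section \<open>The ring of differential operators, by generators and relations\<close>

text \<open>
  \<open>Gen_d i k\<close> stands for the higher derivation \<open>\<partial>\<^sub>i\<close> of order \<open>k + 1\<close>; the one of order \<open>0\<close> is not a
  generator but is by convention \<open>1\<close> (see \<open>free_d\<close>).  The indices \<open>1, \<dots>, n\<close> are the elements of
  a finite linearly ordered type \<open>'n\<close>.
\<close>

datatype 'n gen = Gen_x 'n | Gen_d 'n nat

datatype 'a free_monoid = FM (letters: "'a list")

instantiation free_monoid :: (type) monoid_add
begin

definition "0 = FM []"
definition "u + v = FM (letters u @ letters v)"

instance
  by standard (simp_all add: zero_free_monoid_def plus_free_monoid_def)

end

type_synonym ('n, 'k) free_alg = "'n gen free_monoid \<Rightarrow>\<^sub>0 'k"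

definition free_x :: "'n \<Rightarrow> ('n, 'k::field) free_alg" where
  "free_x i = Poly_Mapping.single (FM [Gen_x i]) 1"

fun free_d :: "'n \<Rightarrow> nat \<Rightarrow> ('n, 'k::field) free_alg" where
  "free_d i 0 = 1"
| "free_d i (Suc k) = Poly_Mapping.single (FM [Gen_d i k]) 1"

inductive_set diffop_rels :: "('n, 'k::field) free_alg set" where
  "free_x i * free_x j - free_x j * free_x i \<in> diffop_rels"
| "k \<ge> 1 \<Longrightarrow> l \<ge> 1 \<Longrightarrow> free_d i k * free_d j l - free_d j l * free_d i k \<in> diffop_rels"
| "k \<ge> 1 \<Longrightarrow> l \<ge> 1 \<Longrightarrow>
     free_d i k * free_d i l - of_nat ((k + l) choose k) * free_d i (k + l) \<in> diffop_rels"
| "k \<ge> 1 \<Longrightarrow>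
     free_d i k * free_x j - free_x j * free_d i k - (if i = j then free_d i (k - 1) else 0)
       \<in> diffop_rels"

inductive_set two_sided_ideal :: "'a::ring_1 set \<Rightarrow> 'a set" for S where
  gen: "r \<in> S \<Longrightarrow> r \<in> two_sided_ideal S"
| zero: "0 \<in> two_sided_ideal S"
| add: "a \<in> two_sided_ideal S \<Longrightarrow> b \<in> two_sided_ideal S \<Longrightarrow> a + b \<in> two_sided_ideal S"
| left: "a \<in> two_sided_ideal S \<Longrightarrow> r * a \<in> two_sided_ideal S"
| right: "a \<in> two_sided_ideal S \<Longrightarrow> a * r \<in> two_sided_ideal S"

lemma two_sided_ideal_uminus: "a \<in> two_sided_ideal S \<Longrightarrow> - a \<in> two_sided_ideal S"
  using two_sided_ideal.left[of a S "-1"] by simp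

lemma two_sided_ideal_diff:
  "a \<in> two_sided_ideal S \<Longrightarrow> b \<in> two_sided_ideal S \<Longrightarrow> a - b \<in> two_sided_ideal S"
  using two_sided_ideal.add[OF _ two_sided_ideal_uminus, of a S b] by simp

subsection \<open>The ideal of relations is proper\<close>

text \<open>
  The free algebra acts on formal power series, given by their coefficient functions, and this
  action annihilates the relations.  This is needed only to see that \<open>0 \<noteq> 1\<close> in the quotient.
\<close>

fun gen_act :: "'n gen \<Rightarrow> (('n \<Rightarrow> nat) \<Rightarrow> 'k::field) \<Rightarrow> (('n \<Rightarrow> nat) \<Rightarrow> 'k)" where
  "gen_act (Gen_x i) v = (\<lambda>a. if a i = 0 then 0 else v (a(i := a i - 1)))"
| "gen_act (Gen_d i k) v = (\<lambda>a. of_nat ((a i + Suc k) choose Suc k) * v (a(i := a i + Suc k)))"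

definition word_act ::
  "'n gen free_monoid \<Rightarrow> (('n \<Rightarrow> nat) \<Rightarrow> 'k::field) \<Rightarrow> (('n \<Rightarrow> nat) \<Rightarrow> 'k)" where
  "word_act w = foldr gen_act (letters w)"

definition alg_act ::
  "('n, 'k) free_alg \<Rightarrow> (('n \<Rightarrow> nat) \<Rightarrow> 'k::field) \<Rightarrow> (('n \<Rightarrow> nat) \<Rightarrow> 'k)" where
  "alg_act f v a = (\<Sum>w\<in>Poly_Mapping.keys f. Poly_Mapping.lookup f w * word_act w v a)"

lemma alg_act_superset:
  assumes "finite A" "Poly_Mapping.keys f \<subseteq> A"
  shows "alg_act f v a = (\<Sum>w\<in>A. Poly_Mapping.lookup f w * word_act w v a)"
  unfolding alg_act_def using assms
  by (intro sum.mono_neutral_left) (auto simp: in_keys_iff)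

lemma alg_act_add: "alg_act (f + g) v a = alg_act f v a + alg_act g v a"
proof -
  define A where "A = Poly_Mapping.keys f \<union> Poly_Mapping.keys g"
  have *: "finite A" "Poly_Mapping.keys f \<subseteq> A" "Poly_Mapping.keys g \<subseteq> A"
    "Poly_Mapping.keys (f + g) \<subseteq> A"
    using keys_add[of f g] by (auto simp: A_def)
  show ?thesis
    by (simp add: alg_act_superset[OF *(1)] * lookup_add distrib_right sum.distrib)
qed

lemma alg_act_uminus: "alg_act (- f) v a = - alg_act f v a"
  by (subst alg_act_superset[of "Poly_Mapping.keys f"])
     (auto simp: alg_act_def sum_negf in_keys_iff)

lemma alg_act_diff: "alg_act (f - g) v a = alg_act f v a - alg_act g v a"
  using alg_act_add[of f "- g" v a] by (simp add: alg_act_uminus)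

lemma alg_act_sum: "alg_act (sum F A) v a = (\<Sum>i\<in>A. alg_act (F i) v a)"
proof (induction A rule: infinite_finite_induct)
  case (infinite A)
  then show ?case by (simp add: alg_act_def)
next
  case empty
  then show ?case by (simp add: alg_act_def)
next
  case (insert x A)
  then show ?case by (simp add: alg_act_add)
qed

lemma alg_act_single: "alg_act (Poly_Mapping.single w c) v a = c * word_act w v a"
  by (subst alg_act_superset[of "{w}"]) (auto simp: )

lemma gen_act_add: "gen_act g (\<lambda>a. u a + v a) = (\<lambda>a. gen_act g u a + gen_act g v a)"
  by (cases g) (auto simp: fun_eq_iff algebra_simps)

lemma gen_act_cmul: "gen_act g (\<lambda>a. c * u a) = (\<lambda>a. c * gen_act g u a)"
  by (cases g) (auto simp: fun_eq_iff algebra_simps)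

lemma word_act_add: "word_act w (\<lambda>a. u a + v a) = (\<lambda>a. word_act w u a + word_act w v a)"
proof -
  have "foldr gen_act xs (\<lambda>a. u a + v a) = (\<lambda>a. foldr gen_act xs u a + foldr gen_act xs v a)" for xs
    by (induction xs) (simp_all add: gen_act_add)
  then show ?thesis by (simp add: word_act_def)
qed

lemma word_act_cmul: "word_act w (\<lambda>a. c * u a) = (\<lambda>a. c * word_act w u a)"
proof -
  have "foldr gen_act xs (\<lambda>a. c * u a) = (\<lambda>a. c * foldr gen_act xs u a)" for xs
    by (induction xs) (simp_all add: gen_act_cmul)
  then show ?thesis by (simp add: word_act_def)
qed

lemma word_act_sum:
  "finite A \<Longrightarrow> word_act w (\<lambda>a. \<Sum>i\<in>A. F i a) = (\<lambda>a. \<Sum>i\<in>A. word_act w (F i) a)"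
proof (induction A rule: finite_induct)
  case empty
  show ?case using word_act_cmul[of w 0 "\<lambda>_. 0"] by simp
next
  case (insert x A)
  then show ?case by (simp add: word_act_add)
qed

lemma word_act_plus: "word_act (u + w) v = word_act u (word_act w v)"
  by (simp add: word_act_def plus_free_monoid_def)

lemma poly_mapping_sum_single:
  "f = (\<Sum>w\<in>Poly_Mapping.keys f. Poly_Mapping.single w (Poly_Mapping.lookup f w))"
  by (rule poly_mapping_eqI) (auto simp: lookup_sum lookup_single when_def in_keys_iff)

lemma alg_act_mult: "alg_act (f * g) v = alg_act f (alg_act g v)"
proof
  fix a
  let ?F = "Poly_Mapping.lookup f" and ?G = "Poly_Mapping.lookup g"
  have "f * g = (\<Sum>w\<in>Poly_Mapping.keys f. \<Sum>u\<in>Poly_Mapping.keys g.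
      Poly_Mapping.single (w + u) (?F w * ?G u))"
    by (subst poly_mapping_sum_single[of f], subst poly_mapping_sum_single[of g])
       (simp add: sum_product mult_single)
  then have "alg_act (f * g) v a = (\<Sum>w\<in>Poly_Mapping.keys f. \<Sum>u\<in>Poly_Mapping.keys g.
      ?F w * ?G u * word_act w (word_act u v) a)"
    by (simp add: alg_act_sum alg_act_single word_act_plus)
  also have "\<dots> = alg_act f (alg_act g v) a"
    unfolding alg_act_def
    by (simp add: word_act_sum word_act_cmul sum_distrib_left mult.assoc)
  finally show "alg_act (f * g) v a = alg_act f (alg_act g v) a" .
qed

lemma alg_act_one: "alg_act 1 v = v"
proof
  fix a show "alg_act 1 v a = v a"
    using alg_act_single[of 0 1 v a] by (simp add: word_act_def zero_free_monoid_def[symmetric])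
       (simp add: zero_free_monoid_def)
qed

lemma alg_act_x: "alg_act (free_x i) v a = (if a i = 0 then 0 else v (a(i := a i - 1)))"
  by (simp add: free_x_def alg_act_single word_act_def)

lemma alg_act_d: "alg_act (free_d i k) v a = of_nat ((a i + k) choose k) * v (a(i := a i + k))"
  by (cases k) (simp_all add: alg_act_one alg_act_single word_act_def)

lemma alg_act_of_nat: "alg_act (of_nat c) v a = of_nat c * v a"
  using alg_act_single[of 0 "of_nat c" v a]
  by (simp add: word_act_def zero_free_monoid_def flip: single_of_nat)

lemma choose_mult_aux:
  "((a + k) choose k) * ((a + k + l) choose l) = ((k + l) choose k) * ((a + (k + l)) choose (k + l))"
proof -
  let ?n = "a + (k + l)"
  have "(?n choose (k + l)) * ((k + l) choose k) = (?n choose k) * ((a + l) choose l)"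
    using choose_mult[of k "k + l" ?n] by simp
  moreover have "(?n choose (a + k)) * ((a + k) choose k) = (?n choose k) * ((a + l) choose a)"
    using choose_mult[of k "a + k" ?n] by simp
  moreover have "?n choose (a + k) = (?n choose l)"
    using binomial_symmetric[of "a + k" ?n] by simp
  moreover have "(a + l) choose a = ((a + l) choose l)"
    using binomial_symmetric[of a "a + l"] by simp
  ultimately show ?thesis by (simp add: add.assoc mult.commute)
qed

lemma alg_act_rels: "r \<in> diffop_rels \<Longrightarrow> alg_act r v a = 0"
proof (induction rule: diffop_rels.induct)
  case (1 i j)
  then show ?case
    by (cases "i = j")
       (auto simp: alg_act_diff alg_act_mult alg_act_x fun_upd_twist, simp add: alg_act_def)
next
  case (2 k l i j)
  show ?case
  proof (cases "i = j")
    case True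
    have "of_nat ((a j + k) choose k) * (of_nat ((a j + k + l) choose l) :: 'b)
        = of_nat ((a j + l) choose l) * of_nat ((a j + l + k) choose k)"
      using choose_mult_aux[of "a j" k l] choose_mult_aux[of "a j" l k]
        binomial_symmetric[of k "k + l"]
      by (simp add: add.commute flip: of_nat_mult)
    then show ?thesis using True
      by (simp add: alg_act_diff alg_act_mult alg_act_d add.assoc add.commute[of k l]
          flip: mult.assoc)
  next
    case False
    then show ?thesis
      by (simp add: alg_act_diff alg_act_mult alg_act_d fun_upd_twist)
  qed
next
  case (3 k l i)
  have "of_nat ((a i + k) choose k) * (of_nat ((a i + k + l) choose l) :: 'b)
      = of_nat ((k + l) choose k) * of_nat ((a i + (k + l)) choose (k + l))"
    using choose_mult_aux[of "a i" k l] by (simp flip: of_nat_mult)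
  then show ?case
    by (simp add: alg_act_diff alg_act_mult alg_act_of_nat alg_act_d add.assoc flip: mult.assoc)
next
  case (4 k i j)
  show ?case
  proof (cases "i = j")
    case True
    obtain k' where k: "k = Suc k'" using 4 by (cases k) auto
    have *: "(of_nat ((b + k) choose k) :: 'b)
        = of_nat ((b + k') choose k) + of_nat ((b + k') choose k')" for b
      by (simp add: k add.commute flip: of_nat_add)
    show ?thesis
    proof (cases "a i")
      case 0
      then show ?thesis using True
        by (simp add: alg_act_diff alg_act_mult alg_act_x alg_act_d k del: free_d.simps(2))
    next
      case (Suc b)
      have "a(i := Suc b) = a" using Suc by auto
      then show ?thesis using True Suc *[of "Suc b"]
        by (simp add: alg_act_diff alg_act_mult alg_act_x alg_act_d k distrib_right
            del: binomial_Suc_Suc free_d.simps)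
    qed
  next
    case False
    then show ?thesis
      by (simp add: alg_act_diff alg_act_mult alg_act_x alg_act_d fun_upd_twist alg_act_def[of 0])
  qed
qed

lemma alg_act_ideal: "r \<in> two_sided_ideal diffop_rels \<Longrightarrow> alg_act r v = (\<lambda>a. 0)"
proof (induction arbitrary: v rule: two_sided_ideal.induct)
  case (gen r)
  then show ?case by (simp add: fun_eq_iff alg_act_rels)
next
  case zero
  show ?case by (simp add: fun_eq_iff alg_act_def)
next
  case (add a b)
  then show ?case by (simp add: fun_eq_iff alg_act_add)
next
  case (left a r)
  have "alg_act r (\<lambda>a. 0) b = 0" for b
    by (simp add: alg_act_def word_act_cmul[of _ 0 "\<lambda>_. 0", simplified])
  then show ?case by (simp add: left.IH fun_eq_iff alg_act_mult)
next
  case (right a r)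
  then show ?case by (simp add: fun_eq_iff alg_act_mult)
qed

lemma one_notin_diffop_ideal:
  "(1 :: ('n, 'k::field) free_alg) \<notin> two_sided_ideal diffop_rels"
proof
  assume "(1 :: ('n, 'k) free_alg) \<in> two_sided_ideal diffop_rels"
  from fun_cong[OF alg_act_ideal[OF this], of "\<lambda>_. 1" "\<lambda>_. 0"]
  show False by (simp add: alg_act_one)
qed

subsection \<open>The quotient\<close>

quotient_type (overloaded) ('n, 'k) diffop = "('n, 'k::field) free_alg" /
  "\<lambda>a b. a - b \<in> two_sided_ideal diffop_rels"
proof (rule equivpI)
  show "reflp (\<lambda>a b :: ('n, 'k) free_alg. a - b \<in> two_sided_ideal diffop_rels)"
    by (rule reflpI) (simp add: two_sided_ideal.zero)
  show "symp (\<lambda>a b :: ('n, 'k) free_alg. a - b \<in> two_sided_ideal diffop_rels)"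
    by (rule sympI) (metis two_sided_ideal_uminus minus_diff_eq)
  show "transp (\<lambda>a b :: ('n, 'k) free_alg. a - b \<in> two_sided_ideal diffop_rels)"
  proof (rule transpI)
    fix a b c :: "('n, 'k) free_alg"
    assume "a - b \<in> two_sided_ideal diffop_rels" "b - c \<in> two_sided_ideal diffop_rels"
    from two_sided_ideal.add[OF this] show "a - c \<in> two_sided_ideal diffop_rels" by simp
  qed
qed

instantiation diffop :: (type, field) ring_1
begin

lift_definition zero_diffop :: "('a, 'b) diffop" is 0 .
lift_definition one_diffop :: "('a, 'b) diffop" is 1 .
lift_definition plus_diffop :: "('a, 'b) diffop \<Rightarrow> ('a, 'b) diffop \<Rightarrow> ('a, 'b) diffop" is "(+)"
proof -
  fix a b c d :: "('a, 'b) free_alg"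
  assume "a - b \<in> two_sided_ideal diffop_rels" "c - d \<in> two_sided_ideal diffop_rels"
  from two_sided_ideal.add[OF this]
  show "a + c - (b + d) \<in> two_sided_ideal diffop_rels" by (simp add: algebra_simps)
qed
lift_definition uminus_diffop :: "('a, 'b) diffop \<Rightarrow> ('a, 'b) diffop" is uminus
proof -
  fix a b :: "('a, 'b) free_alg"
  assume "a - b \<in> two_sided_ideal diffop_rels"
  from two_sided_ideal_uminus[OF this]
  show "- a - - b \<in> two_sided_ideal diffop_rels" by simp
qed
lift_definition minus_diffop :: "('a, 'b) diffop \<Rightarrow> ('a, 'b) diffop \<Rightarrow> ('a, 'b) diffop" is "(-)"
proof -
  fix a b c d :: "('a, 'b) free_alg"
  assume "a - b \<in> two_sided_ideal diffop_rels" "c - d \<in> two_sided_ideal diffop_rels"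
  from two_sided_ideal_diff[OF this]
  show "a - c - (b - d) \<in> two_sided_ideal diffop_rels" by (simp add: algebra_simps)
qed
lift_definition times_diffop :: "('a, 'b) diffop \<Rightarrow> ('a, 'b) diffop \<Rightarrow> ('a, 'b) diffop" is "(*)"
proof -
  fix a b c d :: "('a, 'b) free_alg"
  assume "a - b \<in> two_sided_ideal diffop_rels" "c - d \<in> two_sided_ideal diffop_rels"
  then have "(a - b) * c + b * (c - d) \<in> two_sided_ideal diffop_rels"
    by (intro two_sided_ideal.add two_sided_ideal.left two_sided_ideal.right)
  then show "a * c - b * d \<in> two_sided_ideal diffop_rels" by (simp add: algebra_simps)
qed

instance
proof
  show "(0 :: ('a, 'b) diffop) \<noteq> 1"
    by transfer (use one_notin_diffop_ideal two_sided_ideal_uminus in fastforce)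
qed (transfer; simp add: algebra_simps two_sided_ideal.zero; fail)+

end

lift_definition diffop_const :: "'k::field \<Rightarrow> ('n, 'k) diffop" is "Poly_Mapping.single 0" .
lift_definition diffop_x :: "'n \<Rightarrow> ('n, 'k::field) diffop" is free_x .
lift_definition diffop_d :: "'n \<Rightarrow> nat \<Rightarrow> ('n, 'k::field) diffop" is free_d .


section \<open>The algebra \<open>T\<close>\<close>

inductive_set subalgebra :: "('n, 'k::field) diffop set \<Rightarrow> ('n, 'k) diffop set" for S where
  const: "diffop_const c \<in> subalgebra S"
| gen: "a \<in> S \<Longrightarrow> a \<in> subalgebra S"
| add: "a \<in> subalgebra S \<Longrightarrow> b \<in> subalgebra S \<Longrightarrow> a + b \<in> subalgebra S"
| mult: "a \<in> subalgebra S \<Longrightarrow> b \<in> subalgebra S \<Longrightarrow> a * b \<in> subalgebra S"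

definition polys_n :: "('n, 'k::field) diffop set" where
  "polys_n = subalgebra (range diffop_x)"

definition T_sub :: "('n \<Rightarrow> nat) \<Rightarrow> ('n, 'k::field) diffop set" where
  "T_sub k = subalgebra (polys_n \<union> {diffop_d i (CHAR('k) ^ j) | i j. j < k i})"

text \<open>
  The tensor product \<open>A \<otimes>\<^sub>K P\<^sub>m\<close> is the algebra of polynomials with coefficients in \<open>A\<close> in the
  central variables \<open>x\<^bsub>n+1\<^esub>, \<dots>, x\<^bsub>n+m\<^esub>\<close>, here numbered \<open>0, \<dots>, m - 1\<close>; lemmas
  \<open>pure_mult\<close>, \<open>tensor_universal\<close> and \<open>tensor_unique\<close> below give its universal property.
\<close>

type_synonym ('n, 'k) talg = "(nat \<Rightarrow>\<^sub>0 nat) \<Rightarrow>\<^sub>0 ('n, 'k) diffop"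

definition T_alg :: "('n \<Rightarrow> nat) \<Rightarrow> nat \<Rightarrow> ('n, 'k::field) talg set" where
  "T_alg k m = {f. \<forall>\<mu>\<in>Poly_Mapping.keys f.
      Poly_Mapping.keys \<mu> \<subseteq> {..<m} \<and> Poly_Mapping.lookup f \<mu> \<in> T_sub k}"

definition scaleK :: "'k::field \<Rightarrow> ('n, 'k) talg \<Rightarrow> ('n, 'k) talg" where
  "scaleK c a = Poly_Mapping.single 0 (diffop_const c) * a"

subsection \<open>Universal property of the tensor product\<close>

definition polys_m :: "nat \<Rightarrow> ((nat \<Rightarrow>\<^sub>0 nat) \<Rightarrow>\<^sub>0 'k::field) set" where
  "polys_m m = {f. \<forall>\<mu>\<in>Poly_Mapping.keys f. Poly_Mapping.keys \<mu> \<subseteq> {..<m}}"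

definition pure :: "('n, 'k::field) diffop \<Rightarrow> ((nat \<Rightarrow>\<^sub>0 nat) \<Rightarrow>\<^sub>0 'k) \<Rightarrow> ('n, 'k) talg" where
  "pure a f = (\<Sum>\<mu>\<in>Poly_Mapping.keys f.
     Poly_Mapping.single \<mu> (diffop_const (Poly_Mapping.lookup f \<mu>) * a))"

lemma diffop_const_0 [simp]: "diffop_const 0 = 0"
  by transfer (simp add: two_sided_ideal.zero)

lemma diffop_const_1 [simp]: "diffop_const 1 = 1"
  by transfer (simp add: two_sided_ideal.zero)

lemma diffop_const_add: "diffop_const (a + b) = diffop_const a + diffop_const b"
  by transfer (simp add: two_sided_ideal.zero single_add)

lemma diffop_const_mult: "diffop_const (a * b) = diffop_const a * diffop_const b"
  by transfer (simp add: two_sided_ideal.zero mult_single)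

lemma diffop_const_commute: "diffop_const c * a = a * diffop_const c"
proof transfer
  fix c :: 'b and a :: "('a, 'b) free_alg"
  have "Poly_Mapping.single 0 c * a = a * Poly_Mapping.single 0 c"
    by (subst (1 2) poly_mapping_sum_single[of a])
       (simp add: sum_distrib_left sum_distrib_right mult_single mult.commute)
  then show "Poly_Mapping.single 0 c * a - a * Poly_Mapping.single 0 c
      \<in> two_sided_ideal diffop_rels"
    by (simp add: two_sided_ideal.zero)
qed

lemma lookup_pure:
  "Poly_Mapping.lookup (pure a f) \<mu> = diffop_const (Poly_Mapping.lookup f \<mu>) * a"
  by (auto simp: pure_def lookup_sum lookup_single when_def in_keys_iff)

lemma lookup_scaleK: "Poly_Mapping.lookup (scaleK c a) \<mu> = diffop_const c * Poly_Mapping.lookup a \<mu>"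
proof -
  have "scaleK c a = (\<Sum>w\<in>Poly_Mapping.keys a.
      Poly_Mapping.single w (diffop_const c * Poly_Mapping.lookup a w))"
    unfolding scaleK_def by (subst poly_mapping_sum_single[of a])
      (simp add: sum_distrib_left mult_single)
  then show ?thesis by (auto simp: lookup_sum lookup_single when_def in_keys_iff)
qed

lemma T_sub_0: "0 \<in> T_sub k"
  using subalgebra.const[of 0] by (simp add: T_sub_def)

lemma T_sub_const_mult: "a \<in> T_sub k \<Longrightarrow> diffop_const c * a \<in> T_sub k"
  by (simp add: T_sub_def subalgebra.const subalgebra.mult)

lemma T_alg_iff: "f \<in> T_alg k m \<longleftrightarrow>
   (\<forall>\<mu>\<in>Poly_Mapping.keys f. Poly_Mapping.keys \<mu> \<subseteq> {..<m}) \<and> (\<forall>\<mu>. Poly_Mapping.lookup f \<mu> \<in> T_sub k)"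
proof
  assume f: "f \<in> T_alg k m"
  then have "Poly_Mapping.lookup f \<mu> \<in> T_sub k" for \<mu>
    by (cases "\<mu> \<in> Poly_Mapping.keys f") (auto simp: T_alg_def in_keys_iff T_sub_0)
  with f show "(\<forall>\<mu>\<in>Poly_Mapping.keys f. Poly_Mapping.keys \<mu> \<subseteq> {..<m}) \<and>
      (\<forall>\<mu>. Poly_Mapping.lookup f \<mu> \<in> T_sub k)"
    by (auto simp: T_alg_def)
qed (auto simp: T_alg_def)

lemma pure_in_T_alg: "a \<in> T_sub k \<Longrightarrow> f \<in> polys_m m \<Longrightarrow> pure a f \<in> T_alg k m"
  by (auto simp: T_alg_iff polys_m_def lookup_pure in_keys_iff T_sub_const_mult)

lemma pure_mult: "pure a f * pure b g = pure (a * b) (f * g)"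
proof -
  let ?F = "Poly_Mapping.lookup f" and ?G = "Poly_Mapping.lookup g"
  have pure_single: "pure a (Poly_Mapping.single \<mu> c) = Poly_Mapping.single \<mu> (diffop_const c * a)"
    for \<mu> c and a :: "('a, 'b) diffop"
    by (rule poly_mapping_eqI) (auto simp: lookup_pure lookup_single when_def)
  have pure_add: "pure a (u + v) = pure a u + pure a v"
    for u v and a :: "('a, 'b) diffop"
    by (rule poly_mapping_eqI) (simp add: lookup_pure lookup_add diffop_const_add distrib_right)
  have pure_sum: "pure a (sum h A) = (\<Sum>i\<in>A. pure a (h i))" if "finite A"
    for h A and a :: "('a, 'b) diffop"
    using that by (induction A) (simp_all add: pure_add, simp add: pure_def)
  have *: "diffop_const c * a * (diffop_const d * b) = diffop_const (c * d) * (a * b)" for c d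
    by (simp add: diffop_const_mult mult.assoc) (metis diffop_const_commute mult.assoc)
  have "f * g = (\<Sum>w\<in>Poly_Mapping.keys f. \<Sum>u\<in>Poly_Mapping.keys g.
      Poly_Mapping.single (w + u) (?F w * ?G u))"
    by (subst poly_mapping_sum_single[of f], subst poly_mapping_sum_single[of g])
       (simp add: sum_product mult_single)
  then have "pure (a * b) (f * g) = (\<Sum>w\<in>Poly_Mapping.keys f. \<Sum>u\<in>Poly_Mapping.keys g.
      Poly_Mapping.single (w + u) (diffop_const (?F w * ?G u) * (a * b)))"
    by (simp add: pure_sum pure_single)
  also have "\<dots> = pure a f * pure b g"
    unfolding pure_def by (simp add: sum_product mult_single *)
  finally show ?thesis ..
qed

lemma tensor_universal:
  fixes g :: "('n, 'k::field) diffop \<Rightarrow> ((nat \<Rightarrow>\<^sub>0 nat) \<Rightarrow>\<^sub>0 'k) \<Rightarrow> 'v::ab_group_add"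
  assumes "vector_space sc"
    and g_add1: "\<And>a b f. a \<in> T_sub k \<Longrightarrow> b \<in> T_sub k \<Longrightarrow> f \<in> polys_m m \<Longrightarrow> g (a + b) f = g a f + g b f"
    and g_sc1: "\<And>c a f. a \<in> T_sub k \<Longrightarrow> f \<in> polys_m m \<Longrightarrow> g (diffop_const c * a) f = sc c (g a f)"
    and g_add2: "\<And>a f f'. a \<in> T_sub k \<Longrightarrow> f \<in> polys_m m \<Longrightarrow> f' \<in> polys_m m \<Longrightarrow>
        g a (f + f') = g a f + g a f'"
    and g_sc2: "\<And>c a f. a \<in> T_sub k \<Longrightarrow> f \<in> polys_m m \<Longrightarrow>
        g a (Poly_Mapping.single 0 c * f) = sc c (g a f)"
  shows "\<exists>h. (\<forall>u\<in>T_alg k m. \<forall>v\<in>T_alg k m. h (u + v) = h u + h v) \<and>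
             (\<forall>c. \<forall>u\<in>T_alg k m. h (scaleK c u) = sc c (h u)) \<and>
             (\<forall>a\<in>T_sub k. \<forall>f\<in>polys_m m. h (pure a f) = g a f)"
proof -
  interpret vector_space sc by fact
  define h where "h F = (\<Sum>\<mu>\<in>Poly_Mapping.keys F.
      g (Poly_Mapping.lookup F \<mu>) (Poly_Mapping.single \<mu> 1))" for F
  have mon: "Poly_Mapping.single \<mu> c \<in> polys_m m" if "Poly_Mapping.keys \<mu> \<subseteq> {..<m}" for \<mu> and c :: 'k
    using that by (auto simp: polys_m_def)
  have g0: "g 0 f = 0" if "f \<in> polys_m m" for f
    using g_sc1[OF T_sub_0 that, of 0] by simp
  have h_super: "h F = (\<Sum>\<mu>\<in>A. g (Poly_Mapping.lookup F \<mu>) (Poly_Mapping.single \<mu> 1))"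
    if "finite A" "Poly_Mapping.keys F \<subseteq> A" "\<And>\<mu>. \<mu> \<in> A \<Longrightarrow> Poly_Mapping.keys \<mu> \<subseteq> {..<m}" for F A
    unfolding h_def using that
    by (intro sum.mono_neutral_left) (auto simp: in_keys_iff g0 mon)
  have "h (u + v) = h u + h v" if "u \<in> T_alg k m" "v \<in> T_alg k m" for u v
  proof -
    note uv = that
    define A where "A = Poly_Mapping.keys u \<union> Poly_Mapping.keys v"
    have A: "finite A" "Poly_Mapping.keys u \<subseteq> A" "Poly_Mapping.keys v \<subseteq> A"
      "Poly_Mapping.keys (u + v) \<subseteq> A" "\<And>\<mu>. \<mu> \<in> A \<Longrightarrow> Poly_Mapping.keys \<mu> \<subseteq> {..<m}"
      using keys_add[of u v] that by (auto simp: A_def T_alg_def)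
    have "h (u + v) = (\<Sum>\<mu>\<in>A. g (Poly_Mapping.lookup u \<mu>) (Poly_Mapping.single \<mu> 1)
        + g (Poly_Mapping.lookup v \<mu>) (Poly_Mapping.single \<mu> 1))"
      unfolding h_super[OF A(1,4,5), simplified]
      by (rule sum.cong) (use uv in \<open>auto simp: lookup_add T_alg_iff g_add1 A(5) mon\<close>)
    also have "\<dots> = h u + h v"
      using h_super[OF A(1,2,5)] h_super[OF A(1,3,5)] by (simp add: sum.distrib)
    finally show ?thesis .
  qed
  moreover have "h (scaleK c u) = sc c (h u)" if "u \<in> T_alg k m" for c u
  proof -
    have A: "finite (Poly_Mapping.keys u)" "Poly_Mapping.keys (scaleK c u) \<subseteq> Poly_Mapping.keys u"
      "\<And>\<mu>. \<mu> \<in> Poly_Mapping.keys u \<Longrightarrow> Poly_Mapping.keys \<mu> \<subseteq> {..<m}"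
      using that by (auto simp: in_keys_iff lookup_scaleK T_alg_def)
    have "h (scaleK c u) = (\<Sum>\<mu>\<in>Poly_Mapping.keys u.
        sc c (g (Poly_Mapping.lookup u \<mu>) (Poly_Mapping.single \<mu> 1)))"
      by (subst h_super[OF A], assumption, rule sum.cong)
         (use that in \<open>auto simp: lookup_scaleK T_alg_iff g_sc1 A(3) mon\<close>)
    then show ?thesis by (simp add: h_def scale_sum_right)
  qed
  moreover have "h (pure a f) = g a f" if a: "a \<in> T_sub k" and f: "f \<in> polys_m m" for a f
  proof -
    have A: "finite (Poly_Mapping.keys f)" "Poly_Mapping.keys (pure a f) \<subseteq> Poly_Mapping.keys f"
      "\<And>\<mu>. \<mu> \<in> Poly_Mapping.keys f \<Longrightarrow> Poly_Mapping.keys \<mu> \<subseteq> {..<m}"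
      using f by (auto simp: in_keys_iff lookup_pure polys_m_def)
    have g_sum: "(\<Sum>i\<in>A. F i) \<in> polys_m m \<and> g a (\<Sum>i\<in>A. F i) = (\<Sum>i\<in>A. g a (F i))"
      if "finite A" "\<And>i. i \<in> A \<Longrightarrow> F i \<in> polys_m m" for A and F :: "(nat \<Rightarrow>\<^sub>0 nat) \<Rightarrow> _"
      using that
    proof (induction A)
      case empty
      have "(0 :: (nat \<Rightarrow>\<^sub>0 nat) \<Rightarrow>\<^sub>0 'k) \<in> polys_m m" by (simp add: polys_m_def)
      then show ?case using g_sc2[OF a, of 0 0] by simp
    next
      case (insert x A)
      have "u + v \<in> polys_m m" if "u \<in> polys_m m" "v \<in> polys_m m" for u v :: "(nat \<Rightarrow>\<^sub>0 nat) \<Rightarrow>\<^sub>0 'k"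
        using that keys_add[of u v] by (auto simp: polys_m_def)
      with insert show ?case by (simp add: g_add2 a)
    qed
    have "h (pure a f) = (\<Sum>\<mu>\<in>Poly_Mapping.keys f. g a (Poly_Mapping.single \<mu> (Poly_Mapping.lookup f \<mu>)))"
    proof (subst h_super[OF A], assumption, rule sum.cong[OF refl])
      fix \<mu> assume "\<mu> \<in> Poly_Mapping.keys f"
      from mon[OF A(3)[OF this]]
      show "g (Poly_Mapping.lookup (pure a f) \<mu>) (Poly_Mapping.single \<mu> 1)
          = g a (Poly_Mapping.single \<mu> (Poly_Mapping.lookup f \<mu>))"
        using g_sc2[OF a, of "Poly_Mapping.single \<mu> 1" "Poly_Mapping.lookup f \<mu>"]
        by (simp add: lookup_pure g_sc1 a mult_single)
    qed
    also have "\<dots> = g a f"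
      using g_sum[OF A(1), of "\<lambda>\<mu>. Poly_Mapping.single \<mu> (Poly_Mapping.lookup f \<mu>)"]
        poly_mapping_sum_single[of f] mon A(3) by simp
    finally show ?thesis .
  qed
  ultimately show ?thesis by blast
qed

lemma tensor_unique:
  assumes "\<And>u v. u \<in> T_alg k m \<Longrightarrow> v \<in> T_alg k m \<Longrightarrow> h (u + v) = h u + h v"
    and "\<And>u v. u \<in> T_alg k m \<Longrightarrow> v \<in> T_alg k m \<Longrightarrow> h' (u + v) = h' u + h' v"
    and eq: "\<And>a f. a \<in> T_sub k \<Longrightarrow> f \<in> polys_m m \<Longrightarrow> h (pure a f) = h' (pure a f)"
    and "u \<in> T_alg k m"
  shows "h u = (h' u :: 'v::ab_group_add)"
proof -
  have *: "(\<Sum>\<mu>\<in>A. pure (F \<mu>) (Poly_Mapping.single \<mu> 1)) \<in> T_alg k m \<and>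
      h (\<Sum>\<mu>\<in>A. pure (F \<mu>) (Poly_Mapping.single \<mu> 1)) = h' (\<Sum>\<mu>\<in>A. pure (F \<mu>) (Poly_Mapping.single \<mu> 1))"
    if "finite A" "\<And>\<mu>. \<mu> \<in> A \<Longrightarrow> F \<mu> \<in> T_sub k" "\<And>\<mu>. \<mu> \<in> A \<Longrightarrow> Poly_Mapping.keys \<mu> \<subseteq> {..<m}" for A F
    using that
  proof (induction A)
    case empty
    have "(0 :: ('a, 'b) talg) \<in> T_alg k m" by (simp add: T_alg_def)
    moreover from this have "h 0 = 0" "h' 0 = 0"
      using assms(1)[of 0 0] assms(2)[of 0 0] by auto
    ultimately show ?case by simp
  next
    case (insert \<mu> A)
    have m: "Poly_Mapping.single \<mu> (1::'b) \<in> polys_m m"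
      using insert.prems by (auto simp: polys_m_def)
    have p: "pure (F \<mu>) (Poly_Mapping.single \<mu> 1) \<in> T_alg k m"
      using insert.prems m by (intro pure_in_T_alg) auto
    have "u + v \<in> T_alg k m" if "u \<in> T_alg k m" "v \<in> T_alg k m" for u v :: "('a, 'b) talg"
    proof -
      have "\<forall>\<mu>\<in>Poly_Mapping.keys (u + v). Poly_Mapping.keys \<mu> \<subseteq> {..<m}"
        using that keys_add[of u v] unfolding T_alg_def by blast
      moreover have "\<forall>\<mu>. Poly_Mapping.lookup (u + v) \<mu> \<in> T_sub k"
        using that by (auto simp: T_alg_iff lookup_add T_sub_def intro: subalgebra.add)
      ultimately show ?thesis by (simp add: T_alg_iff)
    qed
    with insert p m show ?case by (simp add: assms(1,2) eq)
  qed
  have "u = (\<Sum>\<mu>\<in>Poly_Mapping.keys u. pure (Poly_Mapping.lookup u \<mu>) (Poly_Mapping.single \<mu> 1))"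
  proof (rule poly_mapping_eqI)
    fix \<nu>
    have "Poly_Mapping.lookup (pure c (Poly_Mapping.single \<mu> 1)) \<nu> = (if \<mu> = \<nu> then c else 0)"
      for c :: "('a, 'b) diffop" and \<mu>
      by (simp add: lookup_pure lookup_single when_def)
    then show "Poly_Mapping.lookup u \<nu> = Poly_Mapping.lookup (\<Sum>\<mu>\<in>Poly_Mapping.keys u.
        pure (Poly_Mapping.lookup u \<mu>) (Poly_Mapping.single \<mu> 1)) \<nu>"
      by (simp add: lookup_sum in_keys_iff)
  qed
  then show ?thesis
    using *[of "Poly_Mapping.keys u" "Poly_Mapping.lookup u"] assms(4) by (auto simp: T_alg_def)
qed


section \<open>Elements of \<open>T\<close>, its centre and its automorphisms\<close>

text \<open>
  The indices \<open>1, \<dots>, s\<close> are \<open>Inl i\<close> for \<open>i\<close> in \<open>'n\<close>, followed by \<open>Inr j\<close> for \<open>j < m\<close>.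
\<close>

definition ad :: "'a::ring \<Rightarrow> 'a \<Rightarrow> 'a" where
  "ad r s = r * s - s * r"

definition idx_n :: "'n::{finite, linorder} list" where
  "idx_n = sorted_list_of_set UNIV"

definition idx_s :: "nat \<Rightarrow> ('n::{finite, linorder} + nat) list" where
  "idx_s m = map Inl idx_n @ map Inr [0..<m]"

definition exps_s :: "nat \<Rightarrow> ('n + nat \<Rightarrow> nat) set" where
  "exps_s m = {\<gamma>. \<forall>j\<ge>m. \<gamma> (Inr j) = 0}"

definition exps_N :: "'k::field itself \<Rightarrow> ('n \<Rightarrow> nat) \<Rightarrow> ('n \<Rightarrow> nat) set" where
  "exps_N _ k = {\<alpha>. \<forall>i. \<alpha> i < CHAR('k) ^ k i}"

fun T_x :: "'n + nat \<Rightarrow> ('n, 'k::field) talg" where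
  "T_x (Inl i) = Poly_Mapping.single 0 (diffop_x i)"
| "T_x (Inr j) = Poly_Mapping.single (Poly_Mapping.single j 1) 1"

definition T_d :: "'n \<Rightarrow> nat \<Rightarrow> ('n, 'k::field) talg" where
  "T_d i j = Poly_Mapping.single 0 (diffop_d i j)"

definition x_mon :: "('n::{finite, linorder} \<Rightarrow> nat) \<Rightarrow> ('n, 'k::field) talg" where
  "x_mon \<alpha> = prod_list (map (\<lambda>i. T_x (Inl i) ^ \<alpha> i) idx_n)"

definition d_mon :: "('n::{finite, linorder} \<Rightarrow> nat) \<Rightarrow> ('n, 'k::field) talg" where
  "d_mon \<beta> = prod_list (map (\<lambda>i. T_d i (\<beta> i)) idx_n)"

fun T_X :: "('n \<Rightarrow> nat) \<Rightarrow> 'n + nat \<Rightarrow> ('n, 'k::field) talg" where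
  "T_X k (Inl i) = T_x (Inl i) ^ (CHAR('k) ^ k i)"
| "T_X k (Inr j) = T_x (Inr j)"

definition X_mon ::
  "('n::{finite, linorder} \<Rightarrow> nat) \<Rightarrow> nat \<Rightarrow> ('n + nat \<Rightarrow> nat) \<Rightarrow> ('n, 'k::field) talg" where
  "X_mon k m \<gamma> = prod_list (map (\<lambda>i. T_X k i ^ \<gamma> i) (idx_s m))"

definition T_centre :: "('n \<Rightarrow> nat) \<Rightarrow> nat \<Rightarrow> ('n, 'k::field) talg set" where
  "T_centre k m = {z \<in> T_alg k m. \<forall>t\<in>T_alg k m. z * t = t * z}"

definition linear_on :: "('n, 'k::field) talg set \<Rightarrow> (('n, 'k) talg \<Rightarrow> ('n, 'k) talg) \<Rightarrow> bool" where
  "linear_on A f \<longleftrightarrow> (\<forall>u\<in>A. \<forall>v\<in>A. f (u + v) = f u + f v) \<and>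
                    (\<forall>c. \<forall>u\<in>A. f (scaleK c u) = scaleK c (f u))"

definition Aut_T :: "('n \<Rightarrow> nat) \<Rightarrow> nat \<Rightarrow> (('n, 'k::field) talg \<Rightarrow> ('n, 'k) talg) set" where
  "Aut_T k m = {\<sigma>. bij_betw \<sigma> (T_alg k m) (T_alg k m) \<and> linear_on (T_alg k m) \<sigma> \<and>
      \<sigma> 1 = 1 \<and> (\<forall>u\<in>T_alg k m. \<forall>v\<in>T_alg k m. \<sigma> (u * v) = \<sigma> u * \<sigma> v)}"


section \<open>The maps attached to an automorphism\<close>

definition d_mon' ::
  "(('n::{finite, linorder}, 'k::field) talg \<Rightarrow> ('n, 'k) talg) \<Rightarrow> ('n \<Rightarrow> nat) \<Rightarrow> ('n, 'k) talg" where
  "d_mon' \<sigma> \<alpha> = prod_list (map (\<lambda>i. \<sigma> (T_d i (\<alpha> i))) idx_n)"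

definition X_mon' ::
  "('n::{finite, linorder} \<Rightarrow> nat) \<Rightarrow> nat \<Rightarrow> (('n, 'k::field) talg \<Rightarrow> ('n, 'k) talg)
     \<Rightarrow> ('n + nat \<Rightarrow> nat) \<Rightarrow> ('n, 'k) talg" where
  "X_mon' k m \<sigma> \<gamma> = prod_list (map (\<lambda>i. \<sigma> (T_X k i) ^ \<gamma> i) (idx_s m))"

definition delta' ::
  "(('n::{finite, linorder}, 'k::field) talg \<Rightarrow> ('n, 'k) talg) \<Rightarrow> ('n \<Rightarrow> nat)
     \<Rightarrow> ('n, 'k) talg \<Rightarrow> ('n, 'k) talg" where
  "delta' \<sigma> \<beta> = fold (\<lambda>j. (\<lambda>a. - ad (\<sigma> (T_x (Inl j))) a) ^^ \<beta> j) idx_n"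

subsection \<open>The projections \<open>\<phi>\<^sub>\<sigma>\<close> and \<open>\<psi>\<^sub>\<sigma>\<close> onto the centre\<close>

definition phi_d ::
  "('n \<Rightarrow> nat) \<Rightarrow> (('n, 'k::field) talg \<Rightarrow> ('n, 'k) talg) \<Rightarrow> 'n \<Rightarrow> ('n, 'k) talg \<Rightarrow> ('n, 'k) talg" where
  "phi_d k \<sigma> i a = (\<Sum>j<CHAR('k) ^ k i. \<sigma> (T_d i j) * (ad (\<sigma> (T_x (Inl i))) ^^ j) a)"

definition psi_d ::
  "('n \<Rightarrow> nat) \<Rightarrow> (('n, 'k::field) talg \<Rightarrow> ('n, 'k) talg) \<Rightarrow> 'n \<Rightarrow> ('n, 'k) talg \<Rightarrow> ('n, 'k) talg" where
  "psi_d k \<sigma> i a = (\<Sum>j<CHAR('k) ^ k i. (ad (\<sigma> (T_x (Inl i))) ^^ j) a * \<sigma> (T_d i j))"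

text \<open>
  \<open>phi_x_step\<close> and \<open>phi_x\<close> (the maps with index \<open>n + i\<close>) are written for all of \<open>T\<close>; only their
  values on the image of the products of the maps above matter.
\<close>

definition phi_x_step ::
  "(('n, 'k::field) talg \<Rightarrow> ('n, 'k) talg) \<Rightarrow> 'n \<Rightarrow> nat \<Rightarrow> ('n, 'k) talg \<Rightarrow> ('n, 'k) talg" where
  "phi_x_step \<sigma> i l a = (\<Sum>j<CHAR('k). scaleK ((-1) ^ j / of_nat (fact j))
      (\<sigma> (T_x (Inl i)) ^ (CHAR('k) ^ l * j) * (ad (\<sigma> (T_d i (CHAR('k) ^ l))) ^^ j) a))"

definition phi_x ::
  "('n \<Rightarrow> nat) \<Rightarrow> (('n, 'k::field) talg \<Rightarrow> ('n, 'k) talg) \<Rightarrow> 'n \<Rightarrow> ('n, 'k) talg \<Rightarrow> ('n, 'k) talg" where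
  "phi_x k \<sigma> i = fold (phi_x_step \<sigma> i) [0..<k i]"

definition phi ::
  "('n::{finite, linorder} \<Rightarrow> nat) \<Rightarrow> (('n, 'k::field) talg \<Rightarrow> ('n, 'k) talg)
     \<Rightarrow> ('n, 'k) talg \<Rightarrow> ('n, 'k) talg" where
  "phi k \<sigma> = fold (phi_x k \<sigma>) idx_n \<circ> fold (phi_d k \<sigma>) idx_n"

definition psi ::
  "('n::{finite, linorder} \<Rightarrow> nat) \<Rightarrow> (('n, 'k::field) talg \<Rightarrow> ('n, 'k) talg)
     \<Rightarrow> ('n, 'k) talg \<Rightarrow> ('n, 'k) talg" where
  "psi k \<sigma> = fold (phi_x k \<sigma>) idx_n \<circ> fold (psi_d k \<sigma>) idx_n"

subsection \<open>Higher derivations of the centre and the projection onto \<open>K\<close>\<close>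

text \<open>
  If \<open>\<epsilon> i < j\<close> then the binomial coefficient vanishes, so the truncated subtraction is harmless.
\<close>

definition Z_der ::
  "('n::{finite, linorder} \<Rightarrow> nat) \<Rightarrow> nat \<Rightarrow> (('n, 'k::field) talg \<Rightarrow> ('n, 'k) talg)
     \<Rightarrow> 'n + nat \<Rightarrow> nat \<Rightarrow> ('n, 'k) talg \<Rightarrow> ('n, 'k) talg" where
  "Z_der k m \<sigma> i j = (THE f. f \<in> T_centre k m \<rightarrow>\<^sub>E T_centre k m \<and> linear_on (T_centre k m) f \<and>
      (\<forall>\<epsilon>\<in>exps_s m. f (X_mon' k m \<sigma> \<epsilon>) =
          scaleK (of_nat (\<epsilon> i choose j)) (X_mon' k m \<sigma> (\<epsilon>(i := \<epsilon> i - j)))))"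

definition Z_der_multi ::
  "('n::{finite, linorder} \<Rightarrow> nat) \<Rightarrow> nat \<Rightarrow> (('n, 'k::field) talg \<Rightarrow> ('n, 'k) talg)
     \<Rightarrow> ('n + nat \<Rightarrow> nat) \<Rightarrow> ('n, 'k) talg \<Rightarrow> ('n, 'k) talg" where
  "Z_der_multi k m \<sigma> \<gamma> = fold (\<lambda>i. Z_der k m \<sigma> i (\<gamma> i)) (idx_s m)"

definition theta_step ::
  "('n::{finite, linorder} \<Rightarrow> nat) \<Rightarrow> nat \<Rightarrow> (('n, 'k::field) talg \<Rightarrow> ('n, 'k) talg)
     \<Rightarrow> 'n + nat \<Rightarrow> nat \<Rightarrow> ('n, 'k) talg \<Rightarrow> ('n, 'k) talg" where
  "theta_step k m \<sigma> i l u = (\<Sum>j<CHAR('k). scaleK ((-1) ^ j / of_nat (fact j))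
      (\<sigma> (T_X k i) ^ (CHAR('k) ^ l * j) * (Z_der k m \<sigma> i (CHAR('k) ^ l) ^^ j) u))"

text \<open>The infinite product of the \<open>theta_step\<close>s: its partial products are eventually constant.\<close>

definition theta ::
  "('n::{finite, linorder} \<Rightarrow> nat) \<Rightarrow> nat \<Rightarrow> (('n, 'k::field) talg \<Rightarrow> ('n, 'k) talg)
     \<Rightarrow> 'n + nat \<Rightarrow> ('n, 'k) talg \<Rightarrow> ('n, 'k) talg" where
  "theta k m \<sigma> i u = (THE v. \<exists>L. \<forall>N\<ge>L. fold (theta_step k m \<sigma> i) [0..<N] u = v)"

definition phi_Z ::
  "('n::{finite, linorder} \<Rightarrow> nat) \<Rightarrow> nat \<Rightarrow> (('n, 'k::field) talg \<Rightarrow> ('n, 'k) talg)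
     \<Rightarrow> ('n, 'k) talg \<Rightarrow> ('n, 'k) talg" where
  "phi_Z k m \<sigma> = fold (theta k m \<sigma>) (idx_s m)"

definition has_finite_sum :: "('i \<Rightarrow> 'a::comm_monoid_add) \<Rightarrow> 'i set \<Rightarrow> 'a \<Rightarrow> bool" where
  "has_finite_sum f A v \<longleftrightarrow> finite {t\<in>A. f t \<noteq> 0} \<and> (\<Sum>t\<in>{t\<in>A. f t \<noteq> 0}. f t) = v"

end

theory Submission
  imports Defs "HOL-Computational_Algebra.Primes"
begin

text \<open>
  Let \<open>x\<^sub>i\<close> and \<open>d\<^sub>i j\<close> stand for the images under \<open>\<sigma>\<close> of the variables and of the higher derivations
  with \<open>i \<le> n\<close>, let \<open>q\<^sub>i = p\<^bsup>k i\<^esup>\<close>, and let \<open>X\<close> stand for monomials in the images of the central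
  elements \<open>X\<^sub>1, \<dots>, X\<^sub>s\<close>.  The \<open>x\<^sub>i\<close>, the \<open>d\<^sub>i j\<close> with \<open>j < q\<^sub>i\<close> and the \<open>X\<close> generate \<open>T\<close> and satisfy the
  defining relations, because \<open>\<sigma>\<close> is an automorphism.  Reordering words in the generators therefore gives
  \<open>a = \<Sum> d\<^bsup>[\<beta>]\<^esup> x\<^bsup>\<alpha>\<^esup> z\<^sub>\<alpha>\<^sub>\<beta>\<close> with exponents \<open>\<alpha>\<close>, \<open>\<beta>\<close> below \<open>q\<close> and coefficients \<open>z\<^sub>\<alpha>\<^sub>\<beta>\<close> in the span of the
  \<open>X\<close> (\<open>T_form_dx\<close>); this span is the centre (\<open>centre_eq\<close>).  Applying \<open>\<sigma>\<^sup>-\<^sup>1\<close> replaces the images by the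
  original generators and keeps the scalars, so the theorem says that the stated operators read off
  the scalar coefficients of all the \<open>z\<^sub>\<alpha>\<^sub>\<beta>\<close>.

  They do so in two stages.  First, \<open>\<phi>\<^sub>\<sigma> (\<delta>\<^bsup>\<beta>\<^esup> a \<cdot> d\<^bsup>[\<alpha>]\<^esup>) = (-1)\<^bsup>|\<alpha>|\<^esup> z\<^sub>\<alpha>\<^sub>\<beta>\<close>.  Every map involved acts on
  one index only, and passes by the factors that belong to the other indices (\<open>fold_local\<close>), so it
  suffices to treat one variable (\<open>phi_one_variable\<close>).  There \<open>\<delta> = - ad x\<close> lowers the order of a
  derivation by one; the map \<open>phi_d\<close> kills a term that begins with a derivation of positive order
  and keeps what commutes with \<open>x\<close>; moving \<open>d a\<close> to the left of \<open>x\<^bsup>a'\<^esup>\<close> leaves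
  \<open>(-1)\<^bsup>a\<^esup> (a' choose a) x\<^bsup>a' - a\<^esup>\<close> among the terms free of derivations; and \<open>phi_x\<close> kills
  \<open>x\<^bsup>e\<^esup>\<close> unless \<open>q\<close> divides \<open>e\<close>.  The second formula uses the opposite order of the factors, for which
  no sign appears.

  Secondly, on the polynomial ring formed by the centre, a higher derivation of order \<open>\<gamma>\<close> moves the
  coefficient of \<open>X\<^bsup>\<gamma>\<^esup>\<close> to the constant term and \<open>\<phi>\<^sub>Z\<close> extracts the constant term
  (\<open>phi_Z_Z_der_multi\<close>).  The higher derivations exist because the monomials \<open>X\<^bsup>\<gamma>\<^esup>\<close> are linearly
  independent, which is seen from the action of \<open>T\<close> on formal power series.

  The maps \<open>\<phi>\<^sub>Z\<close> and \<open>phi_x\<close> are both products of steps, the step of index \<open>l\<close> keeping the powers whose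
  exponent has vanishing base-\<open>p\<close> digit of index \<open>l\<close>.  This rests on the congruence
  \<open>e choose p\<^bsup>l\<^esup> \<equiv> e div p\<^bsup>l\<^esup>\<close> modulo \<open>p\<close> (\<open>choose_q\<close>).
\<close>

section \<open>Binomial coefficients modulo the characteristic\<close>

lemma prime_power_dvd_choose:
  assumes "prime (p::nat)" "0 < i" "i < p ^ l"
  shows "p dvd (p ^ l choose i)"
proof (rule ccontr)
  assume "\<not> p dvd (p ^ l choose i)"
  then have "coprime (p ^ l) (p ^ l choose i)"
    using assms(1) by (simp add: prime_imp_coprime)
  moreover have "p ^ l dvd i * (p ^ l choose i)"
    using times_binomial_minus1_eq[OF assms(2), of "p ^ l"] by simp
  ultimately have "p ^ l dvd i"
    by (simp add: coprime_dvd_mult_left_iff)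
  with assms(2,3) show False
    by (simp add: nat_dvd_not_less)
qed

context
  fixes p l q :: nat
  assumes p: "p = CHAR('k::field)" "p > 0" and q: "q = p ^ l"
begin

lemma prime_p: "prime p"
  using p prime_CHAR_semidom[where 'a='k] by simp

lemma q_pos: "q > 0"
  using p q by simp

text \<open>
  Vandermonde's identity, in which only the first and the last of the numbers \<open>q choose i\<close> survive
  modulo \<open>p\<close>: a Pascal rule with step \<open>q\<close> instead of \<open>1\<close>.  The three congruences below follow from it.
\<close>

lemma choose_add_q:
  "(of_nat ((e + q) choose n) :: 'k) = of_nat (e choose n) + (if q \<le> n then of_nat (e choose (n - q)) else 0)"
proof -
  have z: "(of_nat (q choose i) :: 'k) = (if i = 0 \<or> i = q then 1 else 0)" for i
  proof (cases "0 < i \<and> i < q")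
    case True
    then have "p dvd (q choose i)"
      using prime_power_dvd_choose[OF prime_p, of i l] q by simp
    then show ?thesis using True p by (simp add: of_nat_eq_0_iff_char_dvd)
  qed (auto simp: binomial_eq_0)
  have "(of_nat ((e + q) choose n) :: 'k) = of_nat (\<Sum>i\<le>n. (q choose i) * (e choose (n - i)))"
    by (simp add: vandermonde add.commute)
  also have "\<dots> = (\<Sum>i\<le>n. if i = 0 \<or> i = q then of_nat (e choose (n - i)) else 0)"
    by (simp add: z if_distrib[of "\<lambda>x. x * _"] cong: if_cong)
  also have "\<dots> = (\<Sum>i\<in>{..n} \<inter> {0, q}. of_nat (e choose (n - i)))"
    by (subst sum.inter_restrict) auto
  also have "{..n} \<inter> {0, q} = (if q \<le> n then {0, q} else {0})"
    by auto
  also have "(\<Sum>i\<in>\<dots>. of_nat (e choose (n - i)) :: 'k) =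
      of_nat (e choose n) + (if q \<le> n then of_nat (e choose (n - q)) else 0)"
    using q_pos by simp
  finally show ?thesis .
qed

lemma choose_q: "(of_nat (e choose q) :: 'k) = of_nat (e div q)"
proof (induction e rule: less_induct)
  case (less e)
  show ?case
  proof (cases "q \<le> e")
    case True
    then obtain e' where e: "e = e' + q" by (metis le_add_diff_inverse2)
    show ?thesis
      using less[of e'] q_pos by (simp add: e choose_add_q)
  qed (simp add: binomial_eq_0)
qed

lemma choose_eq_0_of_dvd:
  assumes "q dvd e" "0 < n" "n < q"
  shows "(of_nat (e choose n) :: 'k) = 0"
proof -
  obtain c where "e = q * c" using assms(1) by blast
  moreover have "(of_nat ((q * c) choose n) :: 'k) = 0"
  proof (induction c)
    case 0
    then show ?case using assms(2) by (cases n) auto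
  next
    case (Suc c)
    have "(of_nat ((q * c + q) choose n) :: 'k) = 0"
      using Suc assms(3) choose_add_q[of "q * c" n] by simp
    then show ?case by (simp add: add.commute)
  qed
  ultimately show ?thesis by simp
qed

text \<open>
  This is what makes \<open>d i a * d i b\<close> vanish as soon as \<open>a + b\<close> leaves the range of the derivations
  contained in \<open>T\<close>.
\<close>

lemma choose_eq_0_of_carry:
  assumes "i < q" "j < q" "q \<le> i + j"
  shows "(of_nat ((i + j) choose i) :: 'k) = 0"
proof -
  obtain r where r: "i + j = r + q" using assms(3) by (metis le_add_diff_inverse2)
  then have "r < i" using assms by linarith
  then show ?thesis using assms(1) choose_add_q[of r i] by (simp add: r binomial_eq_0)
qed

text \<open>
  The product is \<open>j!\<close> times a binomial coefficient, so this is the alternating sum of a row of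
  Pascal's triangle.  In characteristic \<open>p\<close> the number \<open>e\<close> may be replaced by \<open>e mod p\<close>, and then the
  range \<open>j < p\<close> covers the whole row.
\<close>

lemma alternating_sum_falling:
  "(\<Sum>j<p. (-1) ^ j / of_nat (fact j) * (\<Prod>r<j. of_nat e - of_nat r)) = (if p dvd e then 1 else 0 :: 'k)"
proof -
  define d where "d = e mod p"
  have d: "d < p" using p by (simp add: d_def)
  have e: "(of_nat e :: 'k) = of_nat d"
  proof -
    have "(of_nat e :: 'k) = of_nat p * of_nat (e div p) + of_nat d"
      unfolding d_def by (metis mult_div_mod_eq of_nat_add of_nat_mult)
    then show ?thesis using p by simp
  qed
  have ff: "(\<Prod>r<j. of_nat d - of_nat r) = (of_nat (fact j * (d choose j)) :: 'k)" for j
  proof (induction j)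
    case (Suc j)
    have *: "fact (Suc j) * (d choose Suc j) = fact j * (d choose j) * (d - j)"
      using binomial_absorb_comp[of d j] binomial_absorption[of j d]
      by (metis fact_Suc mult.assoc mult.commute of_nat_id)
    show ?case
    proof (cases "j \<le> d")
      case True
      then show ?thesis
        unfolding * by (simp add: Suc)
    next
      case False
      then show ?thesis
        unfolding * by (simp add: Suc binomial_eq_0)
    qed
  qed simp
  have "(\<Sum>j<p. (-1) ^ j / of_nat (fact j) * (\<Prod>r<j. of_nat e - of_nat r)) =
      (\<Sum>j<p. (-1) ^ j * (of_nat (d choose j) :: 'k))"
  proof (rule sum.cong)
    fix j assume "j \<in> {..<p}"
    then have "\<not> p dvd fact j"
      using prime_p by (simp add: prime_dvd_fact_iff)
    then have "(of_nat (fact j) :: 'k) \<noteq> 0"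
      using p by (simp only: of_nat_eq_0_iff_char_dvd not_False_eq_True)
    then show "(-1) ^ j / of_nat (fact j) * (\<Prod>r<j. of_nat e - of_nat r) =
        (-1) ^ j * (of_nat (d choose j) :: 'k)"
      by (simp add: e ff field_simps)
  qed simp
  also have "\<dots> = (\<Sum>j\<le>d. (-1) ^ j * of_nat (d choose j))"
    using d by (intro sum.mono_neutral_right) (auto simp: binomial_eq_0 not_le)
  also have "\<dots> = (if d = 0 then 1 else 0)"
    by (simp add: choose_alternating_sum)
  also have "\<dots> = (if p dvd e then 1 else 0)"
    by (simp add: d_def dvd_eq_mod_eq_0)
  finally show ?thesis .
qed

end

section \<open>Scalars, generators and relations of \<open>T\<close>\<close>

lemma scaleK_mult_left: "scaleK c a * b = scaleK c (a * b)"
  by (simp add: scaleK_def mult.assoc)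

lemma scaleK_mult_right: "a * scaleK c b = scaleK c (a * b)"
proof -
  have "a * Poly_Mapping.single 0 (diffop_const c) = Poly_Mapping.single 0 (diffop_const c) * a"
    by (subst (1 2) poly_mapping_sum_single[of a])
       (simp add: sum_distrib_left sum_distrib_right mult_single diffop_const_commute[of c])
  then show ?thesis by (simp add: scaleK_def flip: mult.assoc)
qed

interpretation K: vector_space "scaleK :: 'k::field \<Rightarrow> ('n, 'k) talg \<Rightarrow> ('n, 'k) talg"
  by standard (auto intro!: poly_mapping_eqI
      simp: lookup_scaleK lookup_add diffop_const_add diffop_const_mult distrib_left distrib_right mult.assoc)

lemma diffop_const_of_nat: "diffop_const (of_nat n) = of_nat n"
  by (induction n) (simp_all add: diffop_const_add)

lemma minus_one_power_eq_scaleK: "(-1) ^ n * a = scaleK ((-1) ^ n) a"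
  by (induction n) (simp_all add: mult.assoc)

lemma diffop_x_commute: "diffop_x i * diffop_x j = diffop_x j * diffop_x i"
  by transfer (intro two_sided_ideal.gen diffop_rels.intros)

lemma diffop_d_0 [simp]: "diffop_d i 0 = 1"
  by transfer (simp add: two_sided_ideal.zero)

lemma diffop_d_commute: "diffop_d i a * diffop_d j b = diffop_d j b * diffop_d i a"
proof -
  have "diffop_d i (Suc a) * diffop_d j (Suc b) = diffop_d j (Suc b) * diffop_d i (Suc a)" for a b
    by transfer (intro two_sided_ideal.gen diffop_rels.intros; simp)
  then show ?thesis by (cases a; cases b) auto
qed

lemma diffop_d_mult: "diffop_d i a * diffop_d i b = of_nat ((a + b) choose a) * diffop_d i (a + b)"
proof -
  have "diffop_d i (Suc a) * diffop_d i (Suc b) =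
      diffop_const (of_nat ((Suc a + Suc b) choose Suc a)) * diffop_d i (Suc a + Suc b)" for a b
    by transfer (rule two_sided_ideal.gen, simp only: single_of_nat, rule diffop_rels.intros; simp)
  then show ?thesis
    by (cases a; cases b) (simp_all add: diffop_const_of_nat del: binomial_Suc_Suc)
qed

lemma diffop_d_x:
  fixes i j :: 'n
  shows "(diffop_d i a * diffop_x j :: ('n, 'k::field) diffop) = diffop_x j * diffop_d i a + (if i = j \<and> a > 0 then diffop_d i (a - 1) else 0)"
proof -
  have "free_d i (Suc a) * free_x i - free_x i * free_d i (Suc a) - free_d i a
      \<in> two_sided_ideal (diffop_rels :: ('n, 'k) free_alg set)" for a and i :: 'n
    using two_sided_ideal.gen[OF diffop_rels.intros(4), of "Suc a" i i] by simp
  then have eq: "diffop_d i (Suc a) * diffop_x i - diffop_x i * diffop_d i (Suc a) = (diffop_d i a :: ('n, 'k) diffop)"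
    for a and i :: 'n
    by transfer simp
  have "i \<noteq> j \<Longrightarrow> free_d i (Suc a) * free_x j - free_x j * free_d i (Suc a)
        \<in> two_sided_ideal (diffop_rels :: ('n, 'k) free_alg set)" for a and i j :: 'n
    using two_sided_ideal.gen[OF diffop_rels.intros(4), of "Suc a" i j] by simp
  then have neq: "i \<noteq> j \<Longrightarrow> diffop_d i (Suc a) * diffop_x j = (diffop_x j * diffop_d i (Suc a) :: ('n, 'k) diffop)"
    for a and i j :: 'n
    by transfer simp
  show ?thesis
    using eq[of i] neq[of i j] by (cases a; cases "i = j") (auto simp: algebra_simps)
qed

lemma T_x_commute: "T_x i * T_x j = T_x j * T_x i"
  by (cases i; cases j) (simp_all add: mult_single diffop_x_commute add.commute)

lemma T_d_0 [simp]: "T_d i 0 = 1"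
  by (simp add: T_d_def)

lemma T_d_commute: "T_d i a * T_d j b = T_d j b * T_d i a"
  by (simp add: T_d_def mult_single diffop_d_commute[of i])

lemma T_d_mult: "T_d i a * T_d i b = scaleK (of_nat ((a + b) choose a)) (T_d i (a + b))"
  by (simp add: T_d_def mult_single diffop_d_mult scaleK_def diffop_const_of_nat del: single_of_nat)

lemma T_d_x: "T_d i a * T_x (Inl j) = T_x (Inl j) * T_d i a + (if i = j \<and> a > 0 then T_d i (a - 1) else 0)"
  by (simp add: T_d_def mult_single diffop_d_x single_add)

section \<open>\<open>T\<close> as a subalgebra\<close>

lemma T_sub_add: "a \<in> T_sub k \<Longrightarrow> b \<in> T_sub k \<Longrightarrow> a + b \<in> T_sub k"
  and T_sub_mult: "a \<in> T_sub k \<Longrightarrow> b \<in> T_sub k \<Longrightarrow> a * b \<in> T_sub k"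
  and T_sub_const: "diffop_const c \<in> T_sub k"
  by (simp_all add: T_sub_def subalgebra.intros)

lemma T_sub_1: "1 \<in> T_sub k"
  using T_sub_const[of 1] by simp

lemma T_sub_x: "diffop_x i \<in> T_sub k"
  by (auto simp: T_sub_def polys_n_def intro!: subalgebra.gen)

text \<open>
  Only the derivations of order \<open>p\<^bsup>l\<^esup>\<close> are generators.  With \<open>p\<^bsup>l\<^esup>\<close> the largest power below \<open>j\<close>, the product of
  the derivations of orders \<open>p\<^bsup>l\<^esup>\<close> and \<open>j - p\<^bsup>l\<^esup>\<close> is the one of order \<open>j\<close> times \<open>j choose p\<^bsup>l\<^esup>\<close>, which
  modulo \<open>p\<close> is the leading base-\<open>p\<close> digit of \<open>j\<close> and hence invertible.
\<close>

lemma T_sub_d: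
  fixes k :: "'n \<Rightarrow> nat"
  assumes "CHAR('k::field) > 0" "j < CHAR('k) ^ k i"
  shows "(diffop_d i j :: ('n, 'k) diffop) \<in> T_sub k"
  using assms(2)
proof (induction j rule: less_induct)
  case (less j)
  let ?p = "CHAR('k)"
  have p: "?p > 1" using assms(1) prime_CHAR_semidom[where 'a='k] prime_gt_1_nat by auto
  show ?case
  proof (cases "j = 0")
    case True
    then show ?thesis by (simp add: T_sub_1)
  next
    case False
    then obtain l where l: "?p ^ l \<le> j" "j < ?p ^ (l + 1)"
      using ex_power_ivl1[of ?p j] p by auto
    have "?p ^ l < ?p ^ k i" using l(1) less.prems by linarith
    then have lk: "l < k i" using p by simp
    have c: "(of_nat (j choose ?p ^ l) :: 'k) \<noteq> 0"
    proof -
      have "0 < j div ?p ^ l" using l(1) assms(1) by (simp add: div_greater_zero_iff)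
      moreover have "j div ?p ^ l < ?p" using l(2) assms(1) by (simp add: less_mult_imp_div_less)
      ultimately have "\<not> ?p dvd j div ?p ^ l" by (simp add: nat_dvd_not_less)
      then show ?thesis
        using assms(1) by (subst choose_q[OF refl _ refl]) (simp_all add: of_nat_eq_0_iff_char_dvd)
    qed
    have "diffop_d i (?p ^ l) * diffop_d i (j - ?p ^ l) \<in> (T_sub k :: ('n, 'k) diffop set)"
    proof (rule T_sub_mult)
      show "diffop_d i (?p ^ l) \<in> (T_sub k :: ('n, 'k) diffop set)"
        using lk by (auto simp: T_sub_def intro!: subalgebra.gen)
      show "diffop_d i (j - ?p ^ l) \<in> (T_sub k :: ('n, 'k) diffop set)"
        using False assms(1) less.prems by (intro less.IH) auto
    qed
    then have "diffop_const (of_nat (j choose ?p ^ l)) * diffop_d i j \<in> (T_sub k :: ('n, 'k) diffop set)"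
      using l(1) by (simp add: diffop_d_mult diffop_const_of_nat)
    then have "diffop_const (inverse (of_nat (j choose ?p ^ l))) *
        (diffop_const (of_nat (j choose ?p ^ l)) * diffop_d i j) \<in> (T_sub k :: ('n, 'k) diffop set)"
      by (rule T_sub_const_mult)
    then show ?thesis using c by (simp flip: mult.assoc diffop_const_mult)
  qed
qed

lemma T_alg_0 [simp]: "0 \<in> T_alg k m"
  by (simp add: T_alg_def)

lemma T_alg_add: "u \<in> T_alg k m \<Longrightarrow> v \<in> T_alg k m \<Longrightarrow> u + v \<in> T_alg k m"
  using keys_add[of u v] unfolding T_alg_iff lookup_add by (blast intro: T_sub_add)

lemma T_alg_sum: "(\<And>i. i \<in> A \<Longrightarrow> f i \<in> T_alg k m) \<Longrightarrow> sum f A \<in> T_alg k m"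
  by (induction A rule: infinite_finite_induct) (auto simp: T_alg_add)

lemma T_alg_single: "a \<in> T_sub k \<Longrightarrow> Poly_Mapping.keys \<mu> \<subseteq> {..<m} \<Longrightarrow> Poly_Mapping.single \<mu> a \<in> T_alg k m"
  by (auto simp: T_alg_def)

lemma T_alg_1 [simp]: "1 \<in> T_alg k m"
  using T_alg_single[OF T_sub_1, of 0 m] by simp

lemma T_alg_mult:
  assumes "u \<in> T_alg k m" "v \<in> T_alg k m"
  shows "u * v \<in> T_alg k m"
proof -
  have "u * v = (\<Sum>w\<in>Poly_Mapping.keys u. \<Sum>w'\<in>Poly_Mapping.keys v.
      Poly_Mapping.single (w + w') (Poly_Mapping.lookup u w * Poly_Mapping.lookup v w'))"
    by (subst poly_mapping_sum_single[of u], subst poly_mapping_sum_single[of v])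
       (simp add: sum_product mult_single)
  also have "\<dots> \<in> T_alg k m"
  proof (intro T_alg_sum T_alg_single T_sub_mult)
    fix w w' assume "w \<in> Poly_Mapping.keys u" "w' \<in> Poly_Mapping.keys v"
    then show "Poly_Mapping.keys (w + w') \<subseteq> {..<m}"
      using assms keys_add[of w w'] unfolding T_alg_def by blast
  qed (use assms in \<open>auto simp: T_alg_iff\<close>)
  finally show ?thesis .
qed

lemma T_alg_scaleK: "u \<in> T_alg k m \<Longrightarrow> scaleK c u \<in> T_alg k m"
  unfolding scaleK_def by (intro T_alg_mult T_alg_single T_sub_const) auto

lemma T_alg_power: "u \<in> T_alg k m \<Longrightarrow> u ^ n \<in> T_alg k m"
  by (induction n) (auto simp: T_alg_mult)

lemma T_alg_prod_list: "(\<And>u. u \<in> set us \<Longrightarrow> u \<in> T_alg k m) \<Longrightarrow> prod_list us \<in> T_alg k m"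
  by (induction us) (auto simp: T_alg_mult)

lemma T_alg_x: "i \<in> range Inl \<union> Inr ` {..<m} \<Longrightarrow> T_x i \<in> T_alg k m"
  by (cases i) (auto intro!: T_alg_single T_sub_x T_sub_1)

lemma T_alg_d:
  fixes k :: "'n \<Rightarrow> nat"
  shows "CHAR('k::field) > 0 \<Longrightarrow> j < CHAR('k) ^ k i \<Longrightarrow> (T_d i j :: ('n, 'k) talg) \<in> T_alg k m"
  unfolding T_d_def by (intro T_alg_single T_sub_d) auto


text \<open>
  From here on the generators are treated as opaque: only their relations matter, and rewriting them
  as coefficients of polynomials would hide these.
\<close>

declare T_x.simps [simp del] T_X.simps [simp del]

section \<open>Extracting the exponents with a vanishing base-\<open>p\<close> digit\<close>

text \<open>
  Here \<open>v e\<close> plays the role of a monomial with exponent \<open>e\<close> in a distinguished variable \<open>X\<close>, and \<open>G\<close>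
  that of the higher derivation of order \<open>p\<^bsup>l\<^esup>\<close> in \<open>X\<close>.  On exponents divisible by \<open>p\<^bsup>l\<^esup>\<close> it acts like an
  ordinary derivative in \<open>X ^ p ^ l\<close>, so that the \<open>j\<close>-fold iterate produces falling factorials.  The lemma
  serves both for the variables \<open>x\<^sub>i\<close>, with \<open>G\<close> a commutator, and for the variables of the centre.
\<close>

lemma digit_step:
  fixes v :: "nat \<Rightarrow> ('n, 'k::field) talg" and l :: nat
  defines "p \<equiv> CHAR('k)"
  assumes "p > 0"
    and G: "\<And>e c. p ^ l dvd e \<Longrightarrow> G (scaleK c (v e)) = scaleK (c * of_nat (e choose p ^ l)) (v (e - p ^ l))"
    and X: "\<And>e j. p ^ l dvd e \<Longrightarrow> p ^ l * j \<le> e \<Longrightarrow> X ^ (p ^ l * j) * v (e - p ^ l * j) = v e"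
    and e: "p ^ l dvd e"
  shows "(\<Sum>j<p. scaleK ((-1) ^ j / of_nat (fact j)) (X ^ (p ^ l * j) * (G ^^ j) (v e)))
    = (if p ^ Suc l dvd e then v e else 0)"
proof -
  obtain E where E: "e = p ^ l * E" using e by blast
  have pl: "p ^ l > 0" using \<open>p > 0\<close> by simp
  have pow: "(G ^^ j) (v e) = scaleK (\<Prod>r<j. of_nat E - of_nat r) (v (e - p ^ l * j))" for j
  proof (induction j)
    case (Suc j)
    have "p ^ l dvd e - p ^ l * j" by (simp add: E)
    moreover have "(of_nat ((e - p ^ l * j) choose p ^ l) :: 'k) = of_nat (E - j)"
    proof -
      have "e - p ^ l * j = p ^ l * (E - j)" by (simp add: E diff_mult_distrib2)
      then show ?thesis using pl
        using choose_q[where 'k='k and p=p and l=l, OF _ _ refl] \<open>p > 0\<close> by (simp add: p_def)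
    qed
    ultimately have "(G ^^ Suc j) (v e) =
        scaleK ((\<Prod>r<j. of_nat E - of_nat r) * of_nat (E - j)) (v (e - p ^ l * Suc j))"
      using G[of "e - p ^ l * j"] Suc by (simp add: algebra_simps)
    also have "(\<Prod>r<j. of_nat E - of_nat r) * of_nat (E - j) = (\<Prod>r<Suc j. of_nat E - of_nat r :: 'k)"
    proof (cases "j \<le> E")
      case False
      then have "(\<Prod>r<j. of_nat E - of_nat r :: 'k) = 0"
        by (intro prod_zero) auto
      then show ?thesis by simp
    qed simp
    finally show ?case .
  qed simp
  have "X ^ (p ^ l * j) * (G ^^ j) (v e) = scaleK (\<Prod>r<j. of_nat E - of_nat r) (v e)" for j
  proof (cases "j \<le> E")
    case True
    then show ?thesis using X[OF e, of j] E unfolding pow by (simp add: scaleK_mult_right)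
  next
    case False
    then have "(\<Prod>r<j. of_nat E - of_nat r :: 'k) = 0"
      by (intro prod_zero) auto
    then show ?thesis by (simp only: pow K.scale_zero_left mult_zero_right)
  qed
  then have "(\<Sum>j<p. scaleK ((-1) ^ j / of_nat (fact j)) (X ^ (p ^ l * j) * (G ^^ j) (v e)))
      = scaleK (\<Sum>j<p. (-1) ^ j / of_nat (fact j) * (\<Prod>r<j. of_nat E - of_nat r)) (v e)"
    by (simp add: K.scale_sum_left)
  also have "\<dots> = (if p dvd E then v e else 0)"
    using \<open>p > 0\<close> by (subst alternating_sum_falling[OF p_def[THEN meta_eq_to_obj_eq]]) simp_all
  also have "p dvd E \<longleftrightarrow> p ^ Suc l dvd e"
    using pl \<open>p > 0\<close> by (simp add: E mult.commute[of p])
  finally show ?thesis .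
qed

lemma fold_digit_steps:
  assumes "\<And>l. l < N \<Longrightarrow> S l 0 = 0"
    and "\<And>l e. l < N \<Longrightarrow> p ^ l dvd e \<Longrightarrow> S l (v e) = (if p ^ Suc l dvd e then v e else 0)"
  shows "fold S [0..<N] (v e) = (if (p::nat) ^ N dvd e then v e else (0::'a::zero))"
  using assms
proof (induction N)
  case (Suc N)
  have "fold S [0..<N] (v e) = (if p ^ N dvd e then v e else 0)"
    using Suc.prems by (intro Suc.IH) auto
  moreover have "p ^ N dvd e" if "p ^ Suc N dvd e"
    using that power_le_dvd by fastforce
  ultimately show ?case using Suc.prems(1)[of N] Suc.prems(2)[of N e] by auto
qed simp

section \<open>The images of the generators under an automorphism\<close>

lemma idx_n [simp]: "set idx_n = UNIV" "distinct idx_n"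
  by (simp_all add: idx_n_def)

text \<open>
  Naming \<open>p\<close> and \<open>q\<close> as parameters keeps the type of scalars out of the expressions for the exponents.
\<close>

locale T_aut =
  fixes k :: "'n::{finite, linorder} \<Rightarrow> nat" and m :: nat
    and \<sigma> :: "('n, 'k::field) talg \<Rightarrow> ('n, 'k) talg"
    and p :: nat and q :: "'n \<Rightarrow> nat"
  assumes p: "p = CHAR('k)" and q: "q i = p ^ k i"
    and char_pos: "p > 0" and aut: "\<sigma> \<in> Aut_T k m"
begin

abbreviation "T \<equiv> T_alg k m :: ('n, 'k) talg set"

definition "x i = \<sigma> (T_x (Inl i))"
definition "d i j = \<sigma> (T_d i j)"

lemma q_pos: "q i > 0"
  using char_pos by (simp add: q)

lemma p_gt_1: "p > 1"
  using prime_p[OF p char_pos] prime_gt_1_nat by blast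

lemma power_less_q: "l < k i \<Longrightarrow> p ^ l < q i"
  using p_gt_1 by (simp add: q)

lemma \<sigma>_in: "u \<in> T \<Longrightarrow> \<sigma> u \<in> T"
  and \<sigma>_add: "u \<in> T \<Longrightarrow> v \<in> T \<Longrightarrow> \<sigma> (u + v) = \<sigma> u + \<sigma> v"
  and \<sigma>_scaleK: "u \<in> T \<Longrightarrow> \<sigma> (scaleK c u) = scaleK c (\<sigma> u)"
  and \<sigma>_mult: "u \<in> T \<Longrightarrow> v \<in> T \<Longrightarrow> \<sigma> (u * v) = \<sigma> u * \<sigma> v"
  and \<sigma>_1 [simp]: "\<sigma> 1 = 1"
  and \<sigma>_inj: "inj_on \<sigma> T" and \<sigma>_surj: "\<sigma> ` T = T"
  using aut by (auto simp: Aut_T_def linear_on_def bij_betw_def)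

lemma \<sigma>_0 [simp]: "\<sigma> 0 = 0"
  using \<sigma>_scaleK[of 0 0] by simp

lemma \<sigma>_sum: "(\<And>i. i \<in> A \<Longrightarrow> f i \<in> T) \<Longrightarrow> \<sigma> (sum f A) = (\<Sum>i\<in>A. \<sigma> (f i))"
  by (induction A rule: infinite_finite_induct) (simp_all add: \<sigma>_add T_alg_sum)

lemma \<sigma>_power: "u \<in> T \<Longrightarrow> \<sigma> (u ^ n) = \<sigma> u ^ n"
  by (induction n) (simp_all add: \<sigma>_mult T_alg_power)

lemma \<sigma>_prod_list: "(\<And>u. u \<in> set us \<Longrightarrow> u \<in> T) \<Longrightarrow> \<sigma> (prod_list us) = prod_list (map \<sigma> us)"
  by (induction us) (simp_all add: \<sigma>_mult T_alg_prod_list)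

lemma T_d_in: "a < q i \<Longrightarrow> T_d i a \<in> T"
  using char_pos by (auto simp: p q intro: T_alg_d)

lemma x_in: "x i \<in> T" and d_in: "a < q i \<Longrightarrow> d i a \<in> T"
  unfolding x_def d_def by (auto intro!: \<sigma>_in T_alg_x T_d_in)

lemma x_commute: "x i * x j = x j * x i"
  unfolding x_def by (simp add: T_x_commute[of "Inl i"] T_alg_x flip: \<sigma>_mult)

lemma d_0 [simp]: "d i 0 = 1"
  by (simp add: d_def)

lemma d_commute: "a < q i \<Longrightarrow> b < q j \<Longrightarrow> d i a * d j b = d j b * d i a"
  unfolding d_def by (simp add: T_d_commute[of i a] T_d_in flip: \<sigma>_mult)

lemma d_mult:
  assumes "a < q i" "b < q i"
  shows "d i a * d i b = (if a + b < q i then scaleK (of_nat ((a + b) choose a)) (d i (a + b)) else 0)"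
proof -
  have "d i a * d i b = \<sigma> (scaleK (of_nat ((a + b) choose a)) (T_d i (a + b)))"
    unfolding d_def using assms by (simp add: T_d_in T_d_mult flip: \<sigma>_mult)
  then show ?thesis
    using choose_eq_0_of_carry[OF p char_pos q assms] by (simp add: d_def \<sigma>_scaleK T_d_in)
qed

lemma d_x:
  assumes "a < q i"
  shows "d i a * x j = x j * d i a + (if i = j \<and> a > 0 then d i (a - 1) else 0)"
proof -
  have "d i a * x j = \<sigma> (T_x (Inl j) * T_d i a + (if i = j \<and> a > 0 then T_d i (a - 1) else 0))"
    unfolding d_def x_def using assms by (simp add: T_d_in T_alg_x T_d_x flip: \<sigma>_mult)
  then show ?thesis using assms
    by (auto simp add: d_def x_def \<sigma>_add \<sigma>_mult T_d_in T_alg_x T_alg_mult less_imp_diff_less)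
qed

subsection \<open>Local elements and local operators\<close>

text \<open>
  The factors belonging to the index \<open>i\<close> form \<open>L i\<close>, the double commutant of the generators with that
  index.  A double commutant is closed under everything that is local, and different ones commute, so
  that no explicit description by polynomials in \<open>x i\<close> and \<open>d i\<close> is required.
\<close>

definition "commutant S = {u :: ('n, 'k) talg. \<forall>s\<in>S. u * s = s * u}"

definition "gens i = insert (x i) (d i ` {..<q i})"

definition "C i = commutant (gens i)"

definition "L i = commutant (C i)"

definition "is_local i F \<longleftrightarrow> (\<forall>u\<in>C i. \<forall>v\<in>C i. \<forall>w. F (u * w * v) = u * F w * v)"

lemma commutant_1 [simp]: "1 \<in> commutant S" and commutant_0 [simp]: "0 \<in> commutant S"
  by (simp_all add: commutant_def)

lemma commutant_mult: "u \<in> commutant S \<Longrightarrow> v \<in> commutant S \<Longrightarrow> u * v \<in> commutant S"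
  unfolding commutant_def by (clarsimp simp: mult.assoc) (simp flip: mult.assoc)

lemma commutant_add: "u \<in> commutant S \<Longrightarrow> v \<in> commutant S \<Longrightarrow> u + v \<in> commutant S"
  by (simp add: commutant_def distrib_left distrib_right)

lemma commutant_scaleK: "u \<in> commutant S \<Longrightarrow> scaleK c u \<in> commutant S"
  by (simp add: commutant_def scaleK_mult_left scaleK_mult_right)

lemma commutant_power: "u \<in> commutant S \<Longrightarrow> u ^ n \<in> commutant S"
  by (induction n) (auto simp: commutant_mult)

lemmas C_intros = commutant_1[of "gens _", folded C_def] commutant_mult[of _ "gens _", folded C_def]
  commutant_scaleK[of _ "gens _", folded C_def] commutant_power[of _ "gens _", folded C_def]

lemmas L_intros = commutant_1[of "C _", folded L_def] commutant_0[of "C _", folded L_def]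
  commutant_mult[of _ "C _", folded L_def]
  commutant_scaleK[of _ "C _", folded L_def] commutant_power[of _ "C _", folded L_def]

lemma C_x: "u \<in> C i \<Longrightarrow> u * x i = x i * u"
  by (simp add: C_def commutant_def gens_def)

lemma C_d: "u \<in> C i \<Longrightarrow> a < q i \<Longrightarrow> u * d i a = d i a * u"
  by (simp add: C_def commutant_def gens_def)

lemma L_x: "x i \<in> L i" and L_d: "a < q i \<Longrightarrow> d i a \<in> L i"
  by (auto simp: L_def commutant_def C_x C_d)

text \<open>
  The generators with index \<open>j\<close> commute with those with index \<open>i\<close>, so they lie in \<open>C i\<close>; what commutes
  with \<open>C i\<close> therefore commutes with them.
\<close>

lemma L_subset_C: "i \<noteq> j \<Longrightarrow> L i \<subseteq> C j"
proof -
  assume ij: "i \<noteq> j"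
  have "gens j \<subseteq> C i"
    using ij by (auto simp: C_def commutant_def gens_def x_commute d_commute d_x)
  then show ?thesis by (auto simp: L_def C_def[of j] commutant_def)
qed

text \<open>
  For \<open>v\<close> in \<open>C i\<close> locality gives \<open>v * F w = F (v * w) = F (w * v) = F w * v\<close>.
\<close>

lemma local_L:
  assumes "is_local i F" "w \<in> L i"
  shows "F w \<in> L i"
  unfolding L_def commutant_def
proof (intro CollectI ballI)
  fix v assume v: "v \<in> C i"
  have "F w * v = F (1 * w * v)"
    using assms(1) v C_intros(1)[of i] unfolding is_local_def by (metis mult_1)
  also have "1 * w * v = v * w * 1"
    using assms(2) v by (simp add: L_def commutant_def)
  also have "F (v * w * 1) = v * F w"
    using assms(1) v C_intros(1)[of i] unfolding is_local_def by (metis mult_1_right)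
  finally show "F w * v = v * F w" .
qed

lemma local_zero: "is_local i F \<Longrightarrow> F 0 = 0"
proof -
  assume "is_local i F"
  moreover have "0 \<in> C i" by (simp add: C_def)
  ultimately have "F (0 * 0 * 0) = 0 * F 0 * 0" unfolding is_local_def by blast
  then show ?thesis by simp
qed

lemma local_scale:
  assumes "is_local i F"
  shows "F (scaleK c a) = scaleK c (F a)"
proof -
  \<comment> \<open>Scalars are central, hence may be pulled out of a local operator.\<close>
  have "scaleK c 1 \<in> C i" by (simp add: C_intros)
  then have "F (scaleK c 1 * a * 1) = scaleK c 1 * F a * 1"
    using assms C_intros(1)[of i] unfolding is_local_def by blast
  then show ?thesis by (simp add: scaleK_mult_left)
qed

lemma local_funpow: "is_local i F \<Longrightarrow> is_local i (F ^^ n)"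
  by (induction n) (simp_all add: is_local_def)

lemma local_fold: "(\<And>l. l \<in> set ls \<Longrightarrow> is_local i (F l)) \<Longrightarrow> is_local i (fold F ls)"
  by (induction ls rule: rev_induct) (simp_all add: is_local_def)

lemma local_sum: "(\<And>l. l \<in> A \<Longrightarrow> is_local i (F l)) \<Longrightarrow> is_local i (\<lambda>a. \<Sum>l\<in>A. F l a)"
  by (simp add: is_local_def sum_distrib_left sum_distrib_right)

lemma local_mult_left: "c \<in> L i \<Longrightarrow> is_local i F \<Longrightarrow> is_local i (\<lambda>a. c * F a)"
  unfolding is_local_def L_def commutant_def by (clarsimp simp: mult.assoc) (simp flip: mult.assoc)

lemma local_mult_right: "c \<in> L i \<Longrightarrow> is_local i F \<Longrightarrow> is_local i (\<lambda>a. F a * c)"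
  unfolding is_local_def L_def commutant_def by (auto simp: mult.assoc)

lemma local_scaleK: "is_local i F \<Longrightarrow> is_local i (\<lambda>a. scaleK c (F a))"
  by (simp add: is_local_def scaleK_mult_left scaleK_mult_right)

lemma local_ad: "c \<in> L i \<Longrightarrow> is_local i (ad c)"
proof -
  assume "c \<in> L i"
  then have *: "c * u = u * c" if "u \<in> C i" for u
    using that by (simp add: L_def commutant_def)
  show ?thesis unfolding is_local_def
  proof (intro ballI allI)
    fix u v w assume uv: "u \<in> C i" "v \<in> C i"
    have "c * (u * w * v) = u * (c * w) * v"
      using *[OF uv(1)] by (metis mult.assoc)
    moreover have "u * w * v * c = u * (w * c) * v"
      using *[OF uv(2)] by (metis mult.assoc)
    ultimately show "ad c (u * w * v) = u * ad c w * v"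
      by (simp add: ad_def right_diff_distrib left_diff_distrib)
  qed
qed

lemma local_uminus: "is_local i F \<Longrightarrow> is_local i (\<lambda>a. - F a)"
  by (simp add: is_local_def)

abbreviation "P (w :: 'n \<Rightarrow> ('n, 'k) talg) \<equiv> prod_list (map w idx_n)"

lemma prod_list_in_C:
  assumes "i \<notin> set is" "\<And>j. w j \<in> L j"
  shows "prod_list (map w is) \<in> C i"
  using assms(1)
proof (induction "is")
  case (Cons j "is")
  then have "w j \<in> C i" using assms(2)[of j] L_subset_C[of j i] by auto
  with Cons show ?case by (simp add: C_intros)
qed (simp add: C_intros)

lemma prod_list_L_mult:
  assumes "distinct is" "\<And>i. u i \<in> L i" "\<And>i. v i \<in> L i"
  shows "prod_list (map u is) * prod_list (map v is) = prod_list (map (\<lambda>i. u i * v i) is)"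
  using assms(1)
proof (induction "is")
  case (Cons i "is")
  have "prod_list (map u is) \<in> C i"
    using Cons.prems assms(2) by (intro prod_list_in_C) auto
  then have *: "prod_list (map u is) * v i = v i * prod_list (map u is)"
    using assms(3) by (simp add: L_def commutant_def)
  have "prod_list (map u (i # is)) * prod_list (map v (i # is))
     = u i * (prod_list (map u is) * v i) * prod_list (map v is)"
    by (simp add: mult.assoc)
  also have "\<dots> = u i * v i * (prod_list (map u is) * prod_list (map v is))"
    unfolding * by (simp add: mult.assoc)
  finally show ?case using Cons by simp
qed simp

lemmas P_mult = prod_list_L_mult[OF idx_n(2)]

lemma P_split:
  assumes "\<And>j. w j \<in> L j"
  obtains u v where "u \<in> C i" "v \<in> C i" "\<And>y. P (w(i := y)) = u * y * v"
proof -
  obtain as bs where ab: "idx_n = as @ i # bs"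
    using split_list[of i idx_n] by auto
  have ni: "i \<notin> set as" "i \<notin> set bs"
    using arg_cong[OF ab, of distinct] by auto
  have C: "prod_list (map w js) \<in> C i" if "i \<notin> set js" for js
    using that assms by (intro prod_list_in_C)
  have "P (w(i := y)) = prod_list (map w as) * y * prod_list (map w bs)" for y
    using ni by (simp add: ab mult.assoc map_fun_upd)
  with C ni that show ?thesis by blast
qed

text \<open>
  This reduces the operators in \<open>n\<close> variables to one variable: each of them works on its own factor
  of an ordered product, whatever the order in which they are applied.
\<close>

lemma fold_local:
  assumes "distinct is" "\<And>i. i \<in> set is \<Longrightarrow> is_local i (F i)" "\<And>i. w i \<in> L i" "\<And>i. z \<in> C i"
  shows "fold F is (P w * z) = P (\<lambda>i. if i \<in> set is then F i (w i) else w i) * z"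
  using assms
proof (induction "is" arbitrary: w)
  case (Cons i "is")
  obtain u v where uv: "u \<in> C i" "v \<in> C i" "\<And>y. P (w(i := y)) = u * y * v"
    using P_split[of w i] Cons.prems by blast
  have "F i (P w * z) = F i (u * w i * (v * z))"
    using uv(3)[of "w i"] by (simp add: mult.assoc)
  also have "\<dots> = P (w(i := F i (w i))) * z"
    using Cons.prems(2)[of i] Cons.prems(4) uv by (simp add: is_local_def C_intros mult.assoc)
  finally have "fold F (i # is) (P w * z) = fold F is (P (w(i := F i (w i))) * z)"
    by simp
  also have "\<dots> = P (\<lambda>j. if j \<in> set is then F j ((w(i := F i (w i))) j) else (w(i := F i (w i))) j) * z"
    using Cons.prems local_L by (intro Cons.IH) auto
  also have "(\<lambda>j. if j \<in> set is then F j ((w(i := F i (w i))) j) else (w(i := F i (w i))) j)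
      = (\<lambda>j. if j \<in> set (i # is) then F j (w j) else w j)"
    using Cons.prems(1) by auto
  finally show ?case .
qed simp

lemma fold_local_idx_n:
  assumes "\<And>i. is_local i (F i)" "\<And>i. w i \<in> L i" "\<And>i. z \<in> C i"
  shows "fold F idx_n (P w * z) = P (\<lambda>i. F i (w i)) * z"
  using fold_local[of idx_n F w z] assms by simp

subsection \<open>The projections in one variable\<close>

definition "\<delta> i a = - ad (x i) a"

text \<open>
  \<open>\<delta> i\<close> differentiates formally by the derivation, since \<open>[d i c, x i] = d i (c - 1)\<close>.
\<close>

lemma delta_funpow:
  assumes "u * x i = x i * u" "v * x i = x i * v" "b' < q i"
  shows "(\<delta> i ^^ b) (u * d i b' * v) = (if b \<le> b' then u * d i (b' - b) * v else 0)"
proof -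
  have step: "\<delta> i (u * d i c * v) = (if c > 0 then u * d i (c - 1) * v else 0)" if "c < q i" for c
  proof -
    have "\<delta> i (u * d i c * v) = u * (d i c * x i) * v - u * (x i * d i c) * v"
      using assms(1,2) unfolding \<delta>_def ad_def by (metis (no_types, lifting) minus_diff_eq mult.assoc)
    then show ?thesis using d_x[OF that, of i]
      by (simp add: distrib_left distrib_right)
  qed
  have 0: "\<delta> i 0 = 0" by (simp add: \<delta>_def ad_def)
  show ?thesis
  proof (induction b)
    case (Suc b)
    show ?case
    proof (cases "b \<le> b'")
      case True
      then have "(\<delta> i ^^ Suc b) (u * d i b' * v) = \<delta> i (u * d i (b' - b) * v)"
        using Suc by (simp del: d_0)
      also have "\<dots> = (if b' - b > 0 then u * d i (b' - b - 1) * v else 0)"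
        using assms(3) by (intro step) auto
      finally show ?thesis by auto
    qed (use Suc in \<open>simp add: 0\<close>)
  qed simp
qed

lemma ad_funpow_eq: "(ad (x i) ^^ j) a = scaleK ((-1) ^ j) ((\<delta> i ^^ j) a)"
proof (induction j)
  case (Suc j)
  have "ad (x i) (scaleK c b) = scaleK (-c) (\<delta> i b)" for c b
    by (simp add: \<delta>_def ad_def scaleK_mult_left scaleK_mult_right K.scale_right_diff_distrib)
  then show ?case using Suc by simp
qed simp

text \<open>
  By \<open>d i j * d i (b - j) = (b choose j) d i b\<close> this is an alternating sum of binomial coefficients.  It
  is the reason why \<open>phi_d\<close> and \<open>psi_d\<close> kill positive orders.
\<close>

lemma sum_d_alternating:
  assumes "b < q i"
  shows "(\<Sum>j<q i. if j \<le> b then scaleK ((-1) ^ j) (d i j * d i (b - j)) else 0) = (if b = 0 then 1 else 0)"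
proof -
  have "(\<Sum>j<q i. if j \<le> b then scaleK ((-1) ^ j) (d i j * d i (b - j)) else 0)
      = (\<Sum>j\<le>b. scaleK ((-1) ^ j * of_nat (b choose j)) (d i b))"
    using assms by (intro sum.mono_neutral_cong_right) (auto simp: d_mult)
  also have "\<dots> = scaleK (if b = 0 then 1 else 0) (d i b)"
    by (simp add: choose_alternating_sum flip: K.scale_sum_left)
  finally show ?thesis by simp
qed

lemma phi_d_eq: "phi_d k \<sigma> i a = (\<Sum>j<q i. d i j * (ad (x i) ^^ j) a)"
  and psi_d_eq: "psi_d k \<sigma> i a = (\<Sum>j<q i. (ad (x i) ^^ j) a * d i j)"
  by (simp_all add: phi_d_def psi_d_def x_def d_def p q)

lemma local_phi_d: "is_local i (phi_d k \<sigma> i)"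
proof -
  have "is_local i (\<lambda>a. \<Sum>j<q i. d i j * (ad (x i) ^^ j) a)"
    by (intro local_sum local_mult_left local_funpow local_ad L_d L_x) auto
  then show ?thesis by (simp add: phi_d_eq[abs_def])
qed

lemma local_psi_d: "is_local i (psi_d k \<sigma> i)"
proof -
  have "is_local i (\<lambda>a. \<Sum>j<q i. (ad (x i) ^^ j) a * d i j)"
    by (intro local_sum local_mult_right local_funpow local_ad L_d L_x) auto
  then show ?thesis by (simp add: psi_d_eq[abs_def])
qed

lemma local_delta: "is_local i (\<delta> i)"
  unfolding \<delta>_def by (intro local_uminus local_ad L_x)

lemma phi_d_d:
  assumes "b < q i" "u * x i = x i * u"
  shows "phi_d k \<sigma> i (d i b * u) = (if b = 0 then u else 0)"
proof -
  have "phi_d k \<sigma> i (d i b * u) = (\<Sum>j<q i. if j \<le> b then scaleK ((-1) ^ j) (d i j * d i (b - j)) else 0) * u"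
    unfolding phi_d_eq using delta_funpow[of 1 i u b] assms
    by (auto simp: ad_funpow_eq sum_distrib_right scaleK_mult_left scaleK_mult_right mult.assoc intro!: sum.cong)
  then show ?thesis using sum_d_alternating[OF assms(1)] by simp
qed

lemma psi_d_d:
  assumes "b < q i" "u * x i = x i * u"
  shows "psi_d k \<sigma> i (u * d i b) = (if b = 0 then u else 0)"
proof -
  have "psi_d k \<sigma> i (u * d i b) = u * (\<Sum>j<q i. if j \<le> b then scaleK ((-1) ^ j) (d i j * d i (b - j)) else 0)"
    unfolding psi_d_eq using delta_funpow[of u i 1 b] assms
    by (auto simp: ad_funpow_eq sum_distrib_left scaleK_mult_left scaleK_mult_right mult.assoc d_commute
        intro!: sum.cong)
  then show ?thesis using sum_d_alternating[OF assms(1)] by simp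
qed

lemma phi_d_1: "phi_d k \<sigma> i 1 = 1"
  using phi_d_d[of 0 i 1] q_pos by simp

lemma phi_d_dd:
  assumes "b < q i" "c < q i"
  shows "phi_d k \<sigma> i (d i b * d i c) = (if b = 0 \<and> c = 0 then 1 else 0)"
  using assms phi_d_d[of _ i 1] local_zero[OF local_phi_d]
  by (auto simp: phi_d_1 d_mult local_scale[OF local_phi_d])

lemma psi_d_1: "psi_d k \<sigma> i 1 = 1"
  using psi_d_d[of 0 i 1] q_pos by simp

lemma psi_d_dd:
  assumes "b < q i" "c < q i"
  shows "psi_d k \<sigma> i (d i b * d i c) = (if b = 0 \<and> c = 0 then 1 else 0)"
  using assms psi_d_d[of _ i 1] local_zero[OF local_psi_d]
  by (auto simp: psi_d_1 d_mult local_scale[OF local_psi_d])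

lemma ad_funpow_diff: "(ad y ^^ j) (a - b) = (ad y ^^ j) a - (ad y ^^ j) (b :: ('n, 'k) talg)"
proof -
  have "ad y (a - b) = ad y a - ad y (b :: ('n, 'k) talg)" for a b
    by (simp add: ad_def algebra_simps)
  then show ?thesis by (induction j) simp_all
qed

lemma ad_funpow_add: "(ad y ^^ j) (a + b) = (ad y ^^ j) a + (ad y ^^ j) (b :: ('n, 'k) talg)"
  by (induction j) (simp_all add: ad_def algebra_simps)

lemma ad_funpow_mult_self: "(ad y ^^ j) (a * y) = (ad y ^^ j) a * (y :: ('n, 'k) talg)"
  "(ad y ^^ j) (y * a) = y * (ad y ^^ j) a"
  by (induction j) (simp_all add: ad_def algebra_simps)

text \<open>
  Induction on \<open>a\<close> through \<open>x i * d i c = d i c * x i - d i (c - 1)\<close>: the map \<open>phi_d\<close> commutes with right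
  multiplication by \<open>x i\<close>, and the two resulting binomial coefficients add up by Pascal's rule.
\<close>

lemma phi_d_dxd:
  assumes "b < q i" "c < q i"
  shows "phi_d k \<sigma> i (d i b * x i ^ a * d i c)
    = (if b = 0 then scaleK ((-1) ^ c * of_nat (a choose c)) (x i ^ (a - c)) else 0)"
  using assms(2)
proof (induction a arbitrary: c)
  case 0
  then show ?case using phi_d_dd[OF assms(1) 0] by (cases c) auto
next
  case (Suc a)
  have mult: "phi_d k \<sigma> i (w * x i) = phi_d k \<sigma> i w * x i" for w
    by (simp add: phi_d_eq ad_funpow_mult_self sum_distrib_right mult.assoc)
  have diff: "phi_d k \<sigma> i (u - v) = phi_d k \<sigma> i u - phi_d k \<sigma> i v" for u v
    by (simp add: phi_d_eq ad_funpow_diff right_diff_distrib sum_subtractf)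
  show ?case
  proof (cases c)
    case 0
    have "d i b * x i ^ Suc a * d i 0 = d i b * x i ^ a * d i 0 * x i"
      by (simp add: power_Suc2 mult.assoc del: power_Suc)
    then show ?thesis using Suc.IH[of 0] q_pos 0
      by (simp only: mult) (simp add: power_commutes)
  next
    case (Suc c')
    have "x i * d i c = d i c * x i - d i c'"
      using d_x[OF Suc.prems, of i] Suc by simp
    then have "d i b * x i ^ Suc a * d i c = d i b * x i ^ a * d i c * x i - d i b * x i ^ a * d i c'"
      by (simp add: power_Suc2 mult.assoc right_diff_distrib del: power_Suc)
    moreover have "c' < q i" using Suc Suc.prems by simp
    moreover have "x i ^ (a - c) * x i = x i ^ (a - c') \<or> of_nat (a choose c) = (0 :: 'k)"
    proof (cases "c \<le> a")
      case True
      then have "a - c' = Suc (a - c)" using Suc by simp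
      then show ?thesis by (simp add: power_Suc2 del: power_Suc)
    qed (simp add: binomial_eq_0)
    ultimately show ?thesis
      using Suc.IH[of c] Suc.IH[of c'] Suc.prems Suc
      by (simp add: diff mult scaleK_mult_left ring_distribs K.scale_left_distrib K.scale_left_diff_distrib)
  qed
qed

text \<open>
  The mirror image of \<open>phi_d_dxd\<close>.  Here \<open>d i c * x i = x i * d i c + d i (c - 1)\<close> is used, which has no sign.
\<close>

lemma psi_d_dxd:
  assumes "b < q i" "c < q i"
  shows "psi_d k \<sigma> i (d i c * x i ^ a * d i b)
    = (if b = 0 then scaleK (of_nat (a choose c)) (x i ^ (a - c)) else 0)"
  using assms(2)
proof (induction a arbitrary: c)
  case 0
  then show ?case using psi_d_dd[OF 0 assms(1)] by (cases c) auto
next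
  case (Suc a)
  have mult: "psi_d k \<sigma> i (x i * w) = x i * psi_d k \<sigma> i w" for w
    by (simp add: psi_d_eq ad_funpow_mult_self sum_distrib_left mult.assoc)
  have add: "psi_d k \<sigma> i (u + v) = psi_d k \<sigma> i u + psi_d k \<sigma> i v" for u v
    by (simp add: psi_d_eq ad_funpow_add distrib_right sum.distrib)
  show ?case
  proof (cases c)
    case 0
    then show ?thesis using Suc.IH[of 0] q_pos by (simp add: mult.assoc mult)
  next
    case (Suc c')
    have "d i c * x i = x i * d i c + d i c'"
      using d_x[OF Suc.prems, of i] Suc by simp
    then have "d i c * x i ^ Suc a * d i b = x i * (d i c * x i ^ a * d i b) + d i c' * x i ^ a * d i b"
      by (simp add: distrib_right flip: mult.assoc)
    moreover have "c' < q i" using Suc Suc.prems by simp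
    moreover have "scaleK (of_nat (a choose c)) (x i * x i ^ (a - c)) = scaleK (of_nat (a choose c)) (x i ^ (a - c'))"
    proof (cases "c \<le> a")
      case True
      then have "a - c' = Suc (a - c)" using Suc by simp
      then show ?thesis by simp
    qed (simp add: binomial_eq_0)
    ultimately show ?thesis
      using Suc.IH[of c] Suc.IH[of c'] Suc.prems Suc
      by (simp add: add mult scaleK_mult_right K.scale_left_distrib)
  qed
qed

text \<open>
  Leibniz' rule.
\<close>

lemma d_x_power:
  assumes "c < q i"
  shows "d i c * x i ^ a = (\<Sum>l\<le>c. scaleK (of_nat (a choose l)) (x i ^ (a - l) * d i (c - l)))"
proof (induction a)
  case 0
  have "(\<Sum>l\<le>c. scaleK (of_nat (0 choose l)) (x i ^ (0 - l) * d i (c - l)))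
      = (\<Sum>l\<in>{0}. scaleK (of_nat (0 choose l)) (x i ^ (0 - l) * d i (c - l)))"
    by (intro sum.mono_neutral_right) (auto simp: binomial_eq_0)
  then show ?case by simp
next
  case (Suc a)
  have mult: "scaleK (of_nat (a choose l)) (x i ^ (a - l) * x i * y) = scaleK (of_nat (a choose l)) (x i ^ (Suc a - l) * y)" for l y
    by (cases "l \<le> a") (simp_all add: Suc_diff_le power_Suc2 binomial_eq_0 del: power_Suc)
  have "d i c * x i ^ Suc a = d i c * x i ^ a * x i"
    by (simp add: power_Suc2 mult.assoc del: power_Suc)
  also have "\<dots> = (\<Sum>l\<le>c. scaleK (of_nat (a choose l)) (x i ^ (a - l) * (d i (c - l) * x i)))"
    by (simp add: Suc sum_distrib_right scaleK_mult_left mult.assoc)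
  also have "\<dots> = (\<Sum>l\<le>c. scaleK (of_nat (a choose l)) (x i ^ (Suc a - l) * d i (c - l))
      + (if l < c then scaleK (of_nat (a choose l)) (x i ^ (a - l) * d i (c - Suc l)) else 0))"
    using assms by (intro sum.cong) (auto simp: d_x distrib_left K.scale_right_distrib mult simp flip: mult.assoc)
  also have "\<dots> = (\<Sum>l\<le>c. scaleK (of_nat (a choose l)) (x i ^ (Suc a - l) * d i (c - l)))
      + (\<Sum>l<c. scaleK (of_nat (a choose l)) (x i ^ (a - l) * d i (c - Suc l)))"
    unfolding sum.distrib
    by (intro arg_cong2[of _ _ _ _ "(+)"] refl sum.mono_neutral_cong_right) auto
  also have "\<dots> = (\<Sum>l\<le>c. scaleK (of_nat (Suc a choose l)) (x i ^ (Suc a - l) * d i (c - l)))"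
  proof (cases c)
    case (Suc c')
    show ?thesis
      unfolding Suc sum.atMost_Suc_shift lessThan_Suc_atMost
      by (simp add: sum.distrib K.scale_left_distrib)
  qed simp
  finally show ?case .
qed

lemma x_power_q_in_C: "x i ^ q i \<in> C j"
proof (cases "j = i")
  case True
  have "d i c * x i ^ q i = x i ^ q i * d i c" if "c < q i" for c
  proof -
    have "d i c * x i ^ q i = (\<Sum>l\<in>{0}. scaleK (of_nat (q i choose l)) (x i ^ (q i - l) * d i (c - l)))"
      unfolding d_x_power[OF that] using that choose_eq_0_of_dvd[OF p char_pos q, of i "q i"]
      by (intro sum.mono_neutral_right) auto
    then show ?thesis by simp
  qed
  then show ?thesis unfolding C_def commutant_def gens_def
    by (auto simp: True power_commutes)
next
  case False
  then show ?thesis using L_subset_C[of i j] L_x L_intros by auto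
qed

lemma local_phi_x: "is_local i (phi_x k \<sigma> i)"
proof -
  have "is_local i (phi_x_step \<sigma> i l)" if "l < k i" for l
  proof -
    have "p ^ l < q i" using that by (rule power_less_q)
    then have "is_local i (\<lambda>a. \<Sum>j<p. scaleK ((-1) ^ j / of_nat (fact j)) (x i ^ (p ^ l * j) * (ad (d i (p ^ l)) ^^ j) a))"
      by (intro local_sum local_mult_left local_scaleK local_funpow local_ad L_d L_x L_intros) auto
    then show ?thesis by (simp add: phi_x_step_def[abs_def] x_def d_def p)
  qed
  then show ?thesis unfolding phi_x_def by (intro local_fold) auto
qed

text \<open>
  In \<open>d i (p ^ l) * x i ^ e\<close> with \<open>p ^ l dvd e\<close> all intermediate terms of Leibniz' rule vanish modulo \<open>p\<close>.
  Hence the commutator with \<open>d i (p ^ l)\<close> is a higher derivative, and the steps remove one digit after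
  the other.
\<close>

lemma phi_x_power: "phi_x k \<sigma> i (x i ^ e) = (if q i dvd e then x i ^ e else 0)"
  unfolding phi_x_def q
proof (rule fold_digit_steps)
  fix l assume "l < k i"
  then have pl: "p ^ l < q i" by (rule power_less_q)
  have "(ad y ^^ j) 0 = (0 :: ('n, 'k) talg)" for y and j
    by (induction j) (simp_all add: ad_def)
  then show "phi_x_step \<sigma> i l 0 = 0"
    by (simp add: phi_x_step_def)
  fix e assume e: "p ^ l dvd e"
  have G: "ad (d i (p ^ l)) (scaleK c (x i ^ e)) = scaleK (c * of_nat (e choose p ^ l)) (x i ^ (e - p ^ l))"
    if e: "p ^ l dvd e" for c e
  proof -
    have "d i (p ^ l) * x i ^ e
        = (\<Sum>j\<in>{0, p ^ l}. scaleK (of_nat (e choose j)) (x i ^ (e - j) * d i (p ^ l - j)))"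
      unfolding d_x_power[OF pl] using choose_eq_0_of_dvd[OF p char_pos refl e]
      by (intro sum.mono_neutral_right) auto
    also have "\<dots> = x i ^ e * d i (p ^ l) + scaleK (of_nat (e choose p ^ l)) (x i ^ (e - p ^ l))"
      using char_pos by simp
    finally show ?thesis
      by (simp add: ad_def scaleK_mult_left scaleK_mult_right flip: K.scale_right_diff_distrib)
  qed
  show "phi_x_step \<sigma> i l (x i ^ e) = (if p ^ Suc l dvd e then x i ^ e else 0)"
    unfolding phi_x_step_def x_def[symmetric] d_def[symmetric] p[symmetric]
    unfolding p
    by (rule digit_step) (use char_pos e G in \<open>auto simp: p simp flip: power_add\<close>)
qed

text \<open>
  An exponent below \<open>q i\<close> is divisible by \<open>q i\<close> only if it is \<open>0\<close>; for \<open>a > a'\<close> the binomial coefficient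
  vanishes.
\<close>

lemma phi_x_scaled_power:
  assumes "a < q i" "a' < q i"
  shows "phi_x k \<sigma> i (scaleK (c * of_nat (a' choose a)) (x i ^ (a' - a))) = (if a = a' then scaleK c 1 else 0)"
proof -
  consider "a < a'" | "a' < a" | "a = a'" by linarith
  then show ?thesis
  proof cases
    case 1
    then have "\<not> q i dvd a' - a" using assms by (simp add: nat_dvd_not_less)
    then show ?thesis using 1 by (simp add: phi_x_power local_scale[OF local_phi_x])
  next
    case 2
    then show ?thesis by (simp add: binomial_eq_0 local_zero[OF local_phi_x])
  next
    case 3
    then show ?thesis using phi_x_power[of i 0] by (simp add: local_scale[OF local_phi_x])
  qed
qed

lemma phi_one_variable:
  assumes "a < q i" "b < q i" "a' < q i" "b' < q i"
  shows "phi_x k \<sigma> i (phi_d k \<sigma> i ((\<delta> i ^^ b) (d i b' * x i ^ a') * d i a))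
    = (if a = a' \<and> b = b' then scaleK ((-1) ^ a) 1 else 0)"
proof -
  have "(\<delta> i ^^ b) (d i b' * x i ^ a') * d i a = (if b \<le> b' then d i (b' - b) * x i ^ a' * d i a else 0)"
    using delta_funpow[of 1 i "x i ^ a'" b' b] assms by (simp add: power_commutes)
  then have *: "phi_d k \<sigma> i ((\<delta> i ^^ b) (d i b' * x i ^ a') * d i a)
      = (if b = b' then scaleK ((-1) ^ a * of_nat (a' choose a)) (x i ^ (a' - a)) else 0)"
    using assms by (auto simp: phi_d_dxd local_zero[OF local_phi_d] less_imp_diff_less simp del: d_0)
  show ?thesis unfolding *
    by (cases "b = b'") (simp_all only: phi_x_scaled_power[OF assms(1,3)] local_zero[OF local_phi_x] if_True if_False simp_thms K.scale_one)
qed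

lemma psi_one_variable:
  assumes "a < q i" "b < q i" "a' < q i" "b' < q i"
  shows "phi_x k \<sigma> i (psi_d k \<sigma> i (d i a * (\<delta> i ^^ b) (x i ^ a' * d i b')))
    = (if a = a' \<and> b = b' then 1 else 0)"
proof -
  have "d i a * (\<delta> i ^^ b) (x i ^ a' * d i b') = (if b \<le> b' then d i a * x i ^ a' * d i (b' - b) else 0)"
    using delta_funpow[of "x i ^ a'" i 1 b' b] assms by (simp add: power_commutes mult.assoc)
  then have *: "psi_d k \<sigma> i (d i a * (\<delta> i ^^ b) (x i ^ a' * d i b'))
      = (if b = b' then scaleK (1 * of_nat (a' choose a)) (x i ^ (a' - a)) else 0)"
    using assms by (auto simp: psi_d_dxd local_zero[OF local_psi_d] less_imp_diff_less simp del: d_0)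
  show ?thesis unfolding *
    by (cases "b = b'") (simp_all only: phi_x_scaled_power[OF assms(1,3)] local_zero[OF local_phi_x] if_True if_False simp_thms K.scale_one)
qed

end


section \<open>Spanning sets of \<open>T\<close>\<close>

lemma T_alg_induct [consumes 1, case_names const x d y add mult]:
  fixes k :: "'n::finite \<Rightarrow> nat" and t :: "('n, 'k::field) talg"
  assumes "t \<in> T_alg k m"
    and const: "\<And>c. Q (scaleK c 1)"
    and x: "\<And>i. Q (T_x (Inl i))"
    and d: "\<And>i j. j < k i \<Longrightarrow> Q (T_d i (CHAR('k) ^ j))"
    and y: "\<And>\<mu>. Poly_Mapping.keys \<mu> \<subseteq> {..<m} \<Longrightarrow> Q (Poly_Mapping.single \<mu> 1)"
    and add: "\<And>u v. u \<in> T_alg k m \<Longrightarrow> v \<in> T_alg k m \<Longrightarrow> Q u \<Longrightarrow> Q v \<Longrightarrow> Q (u + v)"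
    and mult: "\<And>u v. u \<in> T_alg k m \<Longrightarrow> v \<in> T_alg k m \<Longrightarrow> Q u \<Longrightarrow> Q v \<Longrightarrow> Q (u * v)"
  shows "Q t"
proof -
  let ?s = "Poly_Mapping.single (0 :: nat \<Rightarrow>\<^sub>0 nat) :: ('n, 'k) diffop \<Rightarrow> _"
  have s: "?s a \<in> T_alg k m" if "a \<in> T_sub k" for a
    using that by (intro T_alg_single) auto
  have c: "Q (?s (diffop_const c))" for c
    using const[of c] by (simp add: scaleK_def)
  have polys: "Q (?s a)" "a \<in> T_sub k" if "a \<in> polys_n" for a
  proof -
    have "Q (?s a) \<and> a \<in> T_sub k" using that unfolding polys_n_def
    proof induction
      case (gen a)
      then obtain i where "a = diffop_x i" by auto
      then show ?case using x[of i] by (simp add: T_x.simps T_sub_x)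
    next
      case (add a b)
      then show ?case using assms(6)[OF s s] by (simp add: single_add T_sub_add)
    next
      case (mult a b)
      then show ?case using assms(7)[OF s s, of a b] by (simp add: mult_single T_sub_mult)
    qed (simp add: c T_sub_const)
    then show "Q (?s a)" "a \<in> T_sub k" by auto
  qed
  have sub: "Q (?s a)" if "a \<in> T_sub k" for a
    using that unfolding T_sub_def
  proof induction
    case (gen a)
    then show ?case using polys d by (auto simp: T_d_def)
  next
    case (add a b)
    then show ?case using assms(6)[OF s s] by (simp add: single_add T_sub_def)
  next
    case (mult a b)
    then show ?case using assms(7)[OF s s, of a b] by (simp add: mult_single T_sub_def)
  qed (simp add: c)
  have "Q (\<Sum>\<mu>\<in>A. Poly_Mapping.single \<mu> (Poly_Mapping.lookup t \<mu>))
      \<and> (\<Sum>\<mu>\<in>A. Poly_Mapping.single \<mu> (Poly_Mapping.lookup t \<mu>)) \<in> T_alg k m"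
    if "finite A" "A \<subseteq> Poly_Mapping.keys t" for A
    using that
  proof (induction A)
    case empty
    then show ?case using const[of 0] by simp
  next
    case (insert \<mu> A)
    then have \<mu>: "Poly_Mapping.keys \<mu> \<subseteq> {..<m}" "Poly_Mapping.lookup t \<mu> \<in> T_sub k"
      using assms(1) by (auto simp: T_alg_def)
    have "Q (?s (Poly_Mapping.lookup t \<mu>) * Poly_Mapping.single \<mu> 1)"
      using \<mu> by (intro mult s sub y T_alg_single T_sub_1)
    then have "Q (Poly_Mapping.single \<mu> (Poly_Mapping.lookup t \<mu>))"
      by (simp add: mult_single)
    with insert \<mu> show ?case by (auto intro!: add T_alg_add T_alg_single)
  qed
  from this[of "Poly_Mapping.keys t"] show ?thesis
    using poly_mapping_sum_single[of t] by simp
qed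

lemma T_x_Inr_power: "T_x (Inr j) ^ n = Poly_Mapping.single (Poly_Mapping.single j n) 1"
  by (induction n) (simp_all add: T_x.simps mult_single flip: single_add)

lemma prod_T_x_Inr:
  "prod_list (map (\<lambda>j. T_x (Inr j) ^ f j) [0..<m]) =
    (Poly_Mapping.single (\<Sum>j<m. Poly_Mapping.single j (f j)) 1 :: ('n, 'k::field) talg)"
  by (induction m) (simp_all add: T_x_Inr_power mult_single)

lemma lookup_sum_single:
  "Poly_Mapping.lookup (\<Sum>j<m. Poly_Mapping.single j (f j)) i = (if i < m then f i else (0::nat))"
  for m :: nat
  by (simp add: lookup_sum lookup_single when_def)

lemma prod_list_fixed_commute:
  "(\<And>i. i \<in> set is \<Longrightarrow> z * w i = w i * z) \<Longrightarrow> z * prod_list (map w is) = prod_list (map w is) * (z :: 'a::monoid_mult)"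
proof (induction "is")
  case (Cons i "is")
  have "z * prod_list (map w (i # is)) = z * w i * prod_list (map w is)"
    by (simp add: mult.assoc)
  also have "\<dots> = w i * (z * prod_list (map w is))"
    using Cons.prems[of i] by (simp add: mult.assoc)
  also have "\<dots> = prod_list (map w (i # is)) * z"
    using Cons by (simp add: mult.assoc)
  finally show ?case .
qed simp

lemma fold_additive:
  fixes F :: "'i \<Rightarrow> 'a::ab_group_add \<Rightarrow> 'a"
  assumes "\<And>i u v. F i (u + v) = F i u + F i v"
  shows "fold F is (u + v) = fold F is u + fold F is v"
  by (induction "is" arbitrary: u v) (simp_all add: assms)

lemma additive_sum:
  fixes F :: "'a::ab_group_add \<Rightarrow> 'b::ab_group_add"
  assumes "\<And>u v. F (u + v) = F u + F v"
  shows "F (sum f A) = (\<Sum>i\<in>A. F (f i))"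
proof -
  have "F 0 = 0" using assms[of 0 0] by simp
  then show ?thesis by (induction A rule: infinite_finite_induct) (simp_all add: assms)
qed

context T_aut
begin

definition "N = {\<alpha> :: 'n \<Rightarrow> nat. \<forall>i. \<alpha> i < q i}"
abbreviation "y \<mu> \<equiv> \<sigma> (Poly_Mapping.single \<mu> 1)"
abbreviation "X \<equiv> X_mon' k m \<sigma>"
abbreviation "ys \<equiv> {\<mu> :: nat \<Rightarrow>\<^sub>0 nat. Poly_Mapping.keys \<mu> \<subseteq> {..<m}}"

lemma N_iff: "\<alpha> \<in> N \<longleftrightarrow> (\<forall>i. \<alpha> i < q i)"
  by (simp add: N_def)

lemma exps_N_eq: "exps_N TYPE('k) k = N"
  by (simp add: exps_N_def N_def p q)

lemma finite_N: "finite N"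
proof -
  have "N \<subseteq> Pi\<^sub>E UNIV (\<lambda>i. {..<q i})"
    by (auto simp: N_iff PiE_def extensional_def)
  then show ?thesis by (rule finite_subset) (intro finite_PiE; simp)
qed

lemma y_T: "\<mu> \<in> ys \<Longrightarrow> Poly_Mapping.single \<mu> 1 \<in> T"
  by (simp add: T_alg_single T_sub_1)

lemma y_commute:
  assumes "\<mu> \<in> ys" "t \<in> T"
  shows "y \<mu> * t = t * y \<mu>"
proof -
  obtain u where u: "u \<in> T" "t = \<sigma> u" using \<sigma>_surj assms(2) by auto
  have "Poly_Mapping.single \<mu> 1 * u = u * Poly_Mapping.single \<mu> 1"
    by (subst (1 2) poly_mapping_sum_single[of u])
      (simp add: sum_distrib_left sum_distrib_right mult_single add.commute)
  then have "\<sigma> (Poly_Mapping.single \<mu> 1 * u) = \<sigma> (u * Poly_Mapping.single \<mu> 1)"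
    by simp
  then show ?thesis using u y_T[OF assms(1)] by (simp only: \<sigma>_mult)
qed

lemma central_C: "(\<And>t. t \<in> T \<Longrightarrow> z * t = t * z) \<Longrightarrow> z \<in> C i"
  unfolding C_def commutant_def gens_def using x_in d_in by auto

lemma y_C: "\<mu> \<in> ys \<Longrightarrow> y \<mu> \<in> C i"
  by (intro central_C y_commute)

lemma C_P_commute: "(\<And>i. z \<in> C i) \<Longrightarrow> (\<And>i. w i \<in> L i) \<Longrightarrow> z * P w = P w * z"
  by (intro prod_list_fixed_commute) (auto simp: L_def commutant_def)

lemma P_upd_scaleK: "(\<And>j. w j \<in> L j) \<Longrightarrow> P (w(i := scaleK c u)) = scaleK c (P (w(i := u)))"
  by (rule P_split[of w i]) (auto simp: scaleK_mult_left scaleK_mult_right)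

lemma P_upd_add: "(\<And>j. w j \<in> L j) \<Longrightarrow> P (w(i := u + v)) = P (w(i := u)) + P (w(i := v))"
  by (rule P_split[of w i]) (auto simp: algebra_simps)

lemma P_upd_0: "(\<And>j. w j \<in> L j) \<Longrightarrow> P (w(i := 0)) = 0"
  using P_upd_scaleK[of w i 0 0] by simp

lemma P_mult_left:
  assumes "\<And>j. w j \<in> L j" "u \<in> L i"
  shows "u * P w = P (w(i := u * w i))"
proof -
  obtain a b where ab: "a \<in> C i" "b \<in> C i" "\<And>y. P (w(i := y)) = a * y * b"
    using P_split[of w i] assms(1) by blast
  have "u * P w = u * a * w i * b" using ab(3)[of "w i"] by (simp add: mult.assoc)
  also have "u * a = a * u" using assms(2) ab(1) by (simp add: L_def commutant_def)
  finally show ?thesis using ab(3) by (simp add: mult.assoc)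
qed

lemma P_mult_right:
  assumes "\<And>j. w j \<in> L j" "u \<in> L i"
  shows "P w * u = P (w(i := w i * u))"
proof -
  obtain a b where ab: "a \<in> C i" "b \<in> C i" "\<And>y. P (w(i := y)) = a * y * b"
    using P_split[of w i] assms(1) by blast
  have "P w * u = a * w i * (b * u)" using ab(3)[of "w i"] by (simp add: mult.assoc)
  also have "b * u = u * b" using assms(2) ab(2) by (simp add: L_def commutant_def)
  finally show ?thesis using ab(3) by (simp add: mult.assoc)
qed

lemma dx_L: "\<beta> \<in> N \<Longrightarrow> d i (\<beta> i) * x i ^ e i \<in> L i"
  and xd_L: "\<beta> \<in> N \<Longrightarrow> x i ^ e i * d i (\<beta> i) \<in> L i"
  by (auto simp: N_iff intro!: L_intros L_x L_d)

text \<open>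
  The exponents of the \<open>x i\<close> are unrestricted here, so that multiplication by \<open>x j\<close> needs no reduction; the powers of \<open>x i ^ q i\<close> are split off afterwards, in \<open>gens_form\<close>.
\<close>

definition "dx_gens = {P (\<lambda>i. d i (\<beta> i) * x i ^ e i) * y \<mu> |\<beta> e \<mu>. \<beta> \<in> N \<and> \<mu> \<in> ys}"
definition "xd_gens = {P (\<lambda>i. x i ^ e i * d i (\<beta> i)) * y \<mu> |\<beta> e \<mu>. \<beta> \<in> N \<and> \<mu> \<in> ys}"

lemma one_in_gens: "1 \<in> dx_gens" "1 \<in> xd_gens"
proof -
  have "prod_list (map (\<lambda>i. 1) is) = (1 :: ('n, 'k) talg)" for "is" :: "'n list"
    by (induction "is") simp_all
  then have P1: "P (\<lambda>i. 1) = 1" .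
  have "(\<lambda>i. 0) \<in> N" by (simp add: N_iff q_pos)
  then show "1 \<in> dx_gens" "1 \<in> xd_gens"
    unfolding dx_gens_def xd_gens_def
    using P1 by (auto intro!: exI[of _ "\<lambda>i. 0 :: nat"] exI[of _ "0 :: nat \<Rightarrow>\<^sub>0 nat"])
qed

lemma y_add: "\<mu> \<in> ys \<Longrightarrow> \<nu> \<in> ys \<Longrightarrow> y \<mu> * y \<nu> = y (\<mu> + \<nu>) \<and> \<mu> + \<nu> \<in> ys"
  using keys_add[of \<mu> \<nu>] y_T by (auto simp: mult_single simp flip: \<sigma>_mult)

lemma span_mult_left:
  assumes "\<And>s. s \<in> G \<Longrightarrow> u * s \<in> K.span G" "s \<in> K.span G"
  shows "u * s \<in> K.span G"
  using assms(2)
proof (induction rule: K.span_induct_alt)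
  case (step c a b)
  then show ?case
    using assms(1) by (simp add: distrib_left scaleK_mult_right K.span_add K.span_scale)
qed (simp add: K.span_zero)

lemma span_mult_right:
  assumes "\<And>s. s \<in> G \<Longrightarrow> s * u \<in> K.span G" "s \<in> K.span G"
  shows "s * u \<in> K.span G"
  using assms(2)
proof (induction rule: K.span_induct_alt)
  case (step c a b)
  then show ?case
    using assms(1) by (simp add: distrib_right scaleK_mult_left K.span_add K.span_scale)
qed (simp add: K.span_zero)

text \<open>
  The span is stable under left multiplication by every generator of \<open>T\<close>: derivations multiply
  directly onto the leading factor, and \<open>x j\<close> is moved across \<open>d j b\<close> at the cost of a term with \<open>d j (b - 1)\<close>.
  As it contains \<open>1\<close>, it is everything.
\<close>

lemma T_span_dx: "t \<in> T \<Longrightarrow> t \<in> K.span dx_gens"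
proof -
  have gen: "P (\<lambda>i. d i (\<beta> i) * x i ^ e i) * y \<mu> \<in> K.span dx_gens" if "\<beta> \<in> N" "\<mu> \<in> ys" for \<beta> e \<mu>
    using that by (intro K.span_base) (auto simp: dx_gens_def)
  have upd: "P ((\<lambda>i. d i (\<beta> i) * x i ^ e i)(j := d j b * x j ^ a)) * y \<mu> \<in> K.span dx_gens"
    if "\<beta> \<in> N" "\<mu> \<in> ys" "b < q j" for \<beta> e \<mu> j a b
  proof -
    have "(\<lambda>i. d i (\<beta> i) * x i ^ e i)(j := d j b * x j ^ a)
        = (\<lambda>i. d i ((\<beta>(j := b)) i) * x i ^ (e(j := a)) i)" by auto
    moreover have "\<beta>(j := b) \<in> N" using that by (simp add: N_iff)
    ultimately show ?thesis using gen[OF _ that(2), of "\<beta>(j := b)" "e(j := a)"] by (simp only:)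
  qed
  have d: "d j c * s \<in> K.span dx_gens" if c: "c < q j" and s: "s \<in> K.span dx_gens" for j c s
  proof (rule span_mult_left[OF _ s])
    fix s assume "s \<in> dx_gens"
    then obtain \<beta> e \<mu> where s: "s = P (\<lambda>i. d i (\<beta> i) * x i ^ e i) * y \<mu>" "\<beta> \<in> N" "\<mu> \<in> ys"
      unfolding dx_gens_def by blast
    let ?w = "\<lambda>i. d i (\<beta> i) * x i ^ e i"
    have wL: "?w i \<in> L i" for i using s(2) by (rule dx_L)
    have "d j c * s = d j c * P ?w * y \<mu>"
      by (simp add: s(1) mult.assoc)
    also have "\<dots> = P (?w(j := d j c * ?w j)) * y \<mu>"
      using P_mult_left[of ?w, OF wL L_d[OF c]] by (simp only:)
    also have "d j c * ?w j = (if c + \<beta> j < q j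
        then scaleK (of_nat ((c + \<beta> j) choose c)) (d j (c + \<beta> j) * x j ^ e j) else 0)"
      using c s(2) by (simp add: d_mult N_iff scaleK_mult_left flip: mult.assoc)
    finally show "d j c * s \<in> K.span dx_gens"
      using upd[OF s(2,3), of "c + \<beta> j" j e "e j"]
      by (cases "c + \<beta> j < q j") (simp_all only: if_True if_False P_upd_scaleK[of ?w, OF wL] P_upd_0[of ?w, OF wL]
          scaleK_mult_left mult_zero_left K.span_scale K.span_zero)
  qed
  have x: "x j * s \<in> K.span dx_gens" if s: "s \<in> K.span dx_gens" for j s
  proof (rule span_mult_left[OF _ s])
    fix s assume "s \<in> dx_gens"
    then obtain \<beta> e \<mu> where s: "s = P (\<lambda>i. d i (\<beta> i) * x i ^ e i) * y \<mu>" "\<beta> \<in> N" "\<mu> \<in> ys"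
      unfolding dx_gens_def by blast
    let ?w = "\<lambda>i. d i (\<beta> i) * x i ^ e i"
    have wL: "?w i \<in> L i" for i using s(2) by (rule dx_L)
    have b: "\<beta> j < q j" "\<beta> j - 1 < q j" using s(2) by (auto simp: N_iff less_imp_diff_less)
    have "x j * s = x j * P ?w * y \<mu>"
      by (simp add: s(1) mult.assoc)
    also have "\<dots> = P (?w(j := x j * ?w j)) * y \<mu>"
      using P_mult_left[of ?w, OF wL L_x] by (simp only:)
    also have "x j * ?w j
        = d j (\<beta> j) * x j ^ Suc (e j) + scaleK (if \<beta> j > 0 then -1 else 0) (d j (\<beta> j - 1) * x j ^ e j)"
    proof -
      have "x j * d j (\<beta> j) = d j (\<beta> j) * x j - (if \<beta> j > 0 then d j (\<beta> j - 1) else 0)"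
        using d_x[OF b(1), of j] by simp
      then show ?thesis by (simp add: left_diff_distrib flip: mult.assoc)
    qed
    finally show "x j * s \<in> K.span dx_gens"
      using upd[OF s(2,3) b(1), of e "Suc (e j)"] upd[OF s(2,3) b(2), of e "e j"]
      by (simp only: P_upd_add[of ?w, OF wL] P_upd_scaleK[of ?w, OF wL] scaleK_mult_left distrib_right
          K.span_add K.span_scale)
  qed
  have y: "y \<nu> * s \<in> K.span dx_gens" if \<nu>: "\<nu> \<in> ys" and s: "s \<in> K.span dx_gens" for \<nu> s
  proof (rule span_mult_left[OF _ s])
    fix s assume "s \<in> dx_gens"
    then obtain \<beta> e \<mu> where s: "s = P (\<lambda>i. d i (\<beta> i) * x i ^ e i) * y \<mu>" "\<beta> \<in> N" "\<mu> \<in> ys"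
      by (auto simp: dx_gens_def)
    let ?w = "\<lambda>i. d i (\<beta> i) * x i ^ e i"
    have wL: "?w i \<in> L i" for i using s(2) by (rule dx_L)
    have "y \<nu> * s = P ?w * (y \<nu> * y \<mu>)"
      using C_P_commute[of "y \<nu>" ?w, OF y_C[OF \<nu>] wL] by (simp only: s(1) mult.assoc[symmetric])
    then show "y \<nu> * s \<in> K.span dx_gens"
      using y_add[OF \<nu> s(3)] gen[OF s(2), of "\<nu> + \<mu>"] by simp
  qed
  have "\<forall>s\<in>K.span dx_gens. \<sigma> t * s \<in> K.span dx_gens" if "t \<in> T" for t
    using that
  proof (induction rule: T_alg_induct)
    case (const c)
    then show ?case by (simp add: \<sigma>_scaleK scaleK_mult_left K.span_scale)
  next
    case (x i)
    then show ?case using \<open>\<And>s j. s \<in> K.span dx_gens \<Longrightarrow> x j * s \<in> K.span dx_gens\<close> by (simp add: x_def)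
  next
    case (d i j)
    then have "p ^ j < q i" by (rule power_less_q)
    then show ?case using \<open>\<And>c j s. c < q j \<Longrightarrow> s \<in> K.span dx_gens \<Longrightarrow> d j c * s \<in> K.span dx_gens\<close>
      by (simp add: d_def p)
  next
    case (y \<mu>)
    then show ?case using \<open>\<And>\<nu> s. \<nu> \<in> ys \<Longrightarrow> s \<in> K.span dx_gens \<Longrightarrow> y \<nu> * s \<in> K.span dx_gens\<close> by simp
  next
    case (add u v)
    then show ?case by (simp add: \<sigma>_add distrib_right K.span_add)
  next
    case (mult u v)
    then show ?case by (simp add: \<sigma>_mult mult.assoc)
  qed
  from this[THEN bspec, OF _ K.span_base[OF one_in_gens(1)]]
  have "\<sigma> t \<in> K.span dx_gens" if "t \<in> T" for t using that by simp
  then show "t \<in> T \<Longrightarrow> t \<in> K.span dx_gens" using \<sigma>_surj by (metis imageE)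
qed

text \<open>
  The same argument with right multiplication.
\<close>

lemma T_span_xd: "t \<in> T \<Longrightarrow> t \<in> K.span xd_gens"
proof -
  have gen: "P (\<lambda>i. x i ^ e i * d i (\<beta> i)) * y \<mu> \<in> K.span xd_gens" if "\<beta> \<in> N" "\<mu> \<in> ys" for \<beta> e \<mu>
    using that by (intro K.span_base) (auto simp: xd_gens_def)
  have upd: "P ((\<lambda>i. x i ^ e i * d i (\<beta> i))(j := x j ^ a * d j b)) * y \<mu> \<in> K.span xd_gens"
    if "\<beta> \<in> N" "\<mu> \<in> ys" "b < q j" for \<beta> e \<mu> j a b
  proof -
    have "(\<lambda>i. x i ^ e i * d i (\<beta> i))(j := x j ^ a * d j b)
        = (\<lambda>i. x i ^ (e(j := a)) i * d i ((\<beta>(j := b)) i))" by auto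
    moreover have "\<beta>(j := b) \<in> N" using that by (simp add: N_iff)
    ultimately show ?thesis using gen[OF _ that(2), of "\<beta>(j := b)" "e(j := a)"] by (simp only:)
  qed
  have swap: "P w * y \<mu> * u = P w * u * y \<mu>" if "\<mu> \<in> ys" "u \<in> T" for w \<mu> u
    using y_commute[OF that] by (simp add: mult.assoc)
  have d: "s * d j c \<in> K.span xd_gens" if c: "c < q j" and s: "s \<in> K.span xd_gens" for j c s
  proof (rule span_mult_right[OF _ s])
    fix s assume "s \<in> xd_gens"
    then obtain \<beta> e \<mu> where s: "s = P (\<lambda>i. x i ^ e i * d i (\<beta> i)) * y \<mu>" "\<beta> \<in> N" "\<mu> \<in> ys"
      unfolding xd_gens_def by blast
    let ?w = "\<lambda>i. x i ^ e i * d i (\<beta> i)"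
    have wL: "?w i \<in> L i" for i using s(2) by (rule xd_L)
    have "s * d j c = P ?w * d j c * y \<mu>"
      by (simp only: s(1) swap[OF s(3) d_in[OF c]])
    also have "\<dots> = P (?w(j := ?w j * d j c)) * y \<mu>"
      using P_mult_right[of ?w, OF wL L_d[OF c]] by (simp only:)
    also have "?w j * d j c = (if \<beta> j + c < q j
        then scaleK (of_nat ((\<beta> j + c) choose \<beta> j)) (x j ^ e j * d j (\<beta> j + c)) else 0)"
      using c s(2) by (simp add: d_mult N_iff scaleK_mult_right mult.assoc)
    finally show "s * d j c \<in> K.span xd_gens"
      using upd[OF s(2,3), of "\<beta> j + c" j e "e j"]
      by (cases "\<beta> j + c < q j") (simp_all only: if_True if_False P_upd_scaleK[of ?w, OF wL] P_upd_0[of ?w, OF wL]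
          scaleK_mult_left mult_zero_left K.span_scale K.span_zero)
  qed
  have x: "s * x j \<in> K.span xd_gens" if s: "s \<in> K.span xd_gens" for j s
  proof (rule span_mult_right[OF _ s])
    fix s assume "s \<in> xd_gens"
    then obtain \<beta> e \<mu> where s: "s = P (\<lambda>i. x i ^ e i * d i (\<beta> i)) * y \<mu>" "\<beta> \<in> N" "\<mu> \<in> ys"
      unfolding xd_gens_def by blast
    let ?w = "\<lambda>i. x i ^ e i * d i (\<beta> i)"
    have wL: "?w i \<in> L i" for i using s(2) by (rule xd_L)
    have b: "\<beta> j < q j" "\<beta> j - 1 < q j" using s(2) by (auto simp: N_iff less_imp_diff_less)
    have "s * x j = P ?w * x j * y \<mu>"
      by (simp only: s(1) swap[OF s(3) x_in])
    also have "\<dots> = P (?w(j := ?w j * x j)) * y \<mu>"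
      using P_mult_right[of ?w, OF wL L_x] by (simp only:)
    also have "?w j * x j
        = x j ^ Suc (e j) * d j (\<beta> j) + scaleK (if \<beta> j > 0 then 1 else 0) (x j ^ e j * d j (\<beta> j - 1))"
      by (simp add: d_x[OF b(1)] mult.assoc distrib_left power_Suc2 del: power_Suc)
    finally show "s * x j \<in> K.span xd_gens"
      using upd[OF s(2,3) b(1), of e "Suc (e j)"] upd[OF s(2,3) b(2), of e "e j"]
      by (simp only: P_upd_add[of ?w, OF wL] P_upd_scaleK[of ?w, OF wL] scaleK_mult_left distrib_right
          K.span_add K.span_scale)
  qed
  have y: "s * y \<nu> \<in> K.span xd_gens" if \<nu>: "\<nu> \<in> ys" and s: "s \<in> K.span xd_gens" for \<nu> s
  proof (rule span_mult_right[OF _ s])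
    fix s assume "s \<in> xd_gens"
    then obtain \<beta> e \<mu> where s: "s = P (\<lambda>i. x i ^ e i * d i (\<beta> i)) * y \<mu>" "\<beta> \<in> N" "\<mu> \<in> ys"
      by (auto simp: xd_gens_def)
    then show "s * y \<nu> \<in> K.span xd_gens"
      using y_add[OF s(3) \<nu>] gen[OF s(2), of "\<mu> + \<nu>" e] by (simp add: mult.assoc)
  qed
  have "\<forall>s\<in>K.span xd_gens. s * \<sigma> t \<in> K.span xd_gens" if "t \<in> T" for t
    using that
  proof (induction rule: T_alg_induct)
    case (const c)
    then show ?case by (simp add: \<sigma>_scaleK scaleK_mult_right K.span_scale)
  next
    case (x i)
    then show ?case using \<open>\<And>s j. s \<in> K.span xd_gens \<Longrightarrow> s * x j \<in> K.span xd_gens\<close> by (simp add: x_def)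
  next
    case (d i j)
    then have "p ^ j < q i" by (rule power_less_q)
    then show ?case using \<open>\<And>c j s. c < q j \<Longrightarrow> s \<in> K.span xd_gens \<Longrightarrow> s * d j c \<in> K.span xd_gens\<close>
      by (simp add: d_def p)
  next
    case (y \<mu>)
    then show ?case using \<open>\<And>\<nu> s. \<nu> \<in> ys \<Longrightarrow> s \<in> K.span xd_gens \<Longrightarrow> s * y \<nu> \<in> K.span xd_gens\<close> by simp
  next
    case (add u v)
    then show ?case by (simp add: \<sigma>_add distrib_left K.span_add)
  next
    case (mult u v)
    then show ?case by (simp flip: mult.assoc add: \<sigma>_mult)
  qed
  from this[THEN bspec, OF _ K.span_base[OF one_in_gens(2)]]
  have "\<sigma> t \<in> K.span xd_gens" if "t \<in> T" for t using that by simp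
  then show "t \<in> T \<Longrightarrow> t \<in> K.span xd_gens" using \<sigma>_surj by (metis imageE)
qed


section \<open>Coefficients over the centre\<close>

definition "y_exp g = (\<Sum>j<m. Poly_Mapping.single j (g (Inr j) :: nat))"

lemma lookup_y_exp: "Poly_Mapping.lookup (y_exp g) j = (if j < m then g (Inr j) else 0)"
  by (simp add: y_exp_def lookup_sum_single)

lemma y_exp_ys: "y_exp g \<in> ys"
  by (auto simp: in_keys_iff lookup_y_exp split: if_splits)

lemma X_sigma: "X g = \<sigma> (X_mon k m g)"
  and X_mon_in: "X_mon k m g \<in> T"
  and X_eq: "X g = P (\<lambda>i. x i ^ (q i * g (Inl i))) * y (y_exp g)"
proof -
  have T_X: "T_X k i \<in> T" if "i \<in> set (idx_s m)" for i
    using that by (cases i rule: sum.exhaust) (auto simp: idx_s_def T_X.simps intro!: T_alg_power T_alg_x)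
  show "X_mon k m g \<in> T"
    unfolding X_mon_def by (intro T_alg_prod_list) (auto intro!: T_alg_power T_X)
  show "X g = \<sigma> (X_mon k m g)"
    unfolding X_mon_def X_mon'_def
    by (subst \<sigma>_prod_list) (auto simp: \<sigma>_power T_X comp_def intro!: T_alg_power T_X arg_cong[of _ _ prod_list])
  have 1: "\<sigma> (T_X k (Inl i)) ^ n = x i ^ (q i * n)" for i n
    by (simp add: T_X.simps \<sigma>_power T_alg_x x_def power_mult p q)
  have 2: "prod_list (map (\<lambda>j. \<sigma> (T_X k (Inr j)) ^ g (Inr j)) [0..<m]) = y (y_exp g)"
    unfolding y_exp_def prod_T_x_Inr[symmetric]
    by (subst \<sigma>_prod_list) (auto simp: \<sigma>_power T_alg_x T_X.simps comp_def
        intro!: T_alg_power T_alg_x arg_cong[of _ _ prod_list])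
  show "X g = P (\<lambda>i. x i ^ (q i * g (Inl i))) * y (y_exp g)"
    using 2 by (simp add: X_mon'_def idx_s_def comp_def 1)
qed

lemma X_in: "X g \<in> T"
  using X_mon_in X_sigma \<sigma>_in by simp

lemma x_power_q_mult_in_C: "x i ^ (q i * n) \<in> C j"
  unfolding power_mult by (intro C_intros x_power_q_in_C)

lemma X_C: "X g \<in> C j"
proof -
  have "prod_list (map (\<lambda>i. x i ^ (q i * g (Inl i))) is) \<in> C j" for "is"
    by (induction "is") (auto intro!: C_intros x_power_q_mult_in_C)
  then show ?thesis unfolding X_eq by (intro C_intros y_C y_exp_ys)
qed

definition "Z = K.span (X ` exps_s m)"

definition "dx n = P (\<lambda>i. d i (snd n i) * x i ^ fst n i)"
definition "xd n = P (\<lambda>i. x i ^ fst n i * d i (snd n i))"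

lemma x_power_y_in_Z:
  assumes "\<mu> \<in> ys"
  shows "P (\<lambda>i. x i ^ (q i * e i)) * y \<mu> \<in> Z"
proof -
  define g where "g = case_sum e (Poly_Mapping.lookup \<mu>)"
  have "y_exp g = \<mu>"
    using assms by (intro poly_mapping_eqI) (auto simp: lookup_y_exp g_def in_keys_iff)
  then have "X g = P (\<lambda>i. x i ^ (q i * e i)) * y \<mu>"
    by (simp add: X_eq g_def)
  moreover have "g \<in> exps_s m"
    using assms by (auto simp: exps_s_def g_def in_keys_iff)
  ultimately show ?thesis unfolding Z_def by (metis K.span_base imageI)
qed

lemma gens_form:
  shows "s \<in> dx_gens \<Longrightarrow> \<exists>n\<in>N \<times> N. \<exists>z\<in>Z. s = dx n * z"
    and "s \<in> xd_gens \<Longrightarrow> \<exists>n\<in>N \<times> N. \<exists>z\<in>Z. s = xd n * z"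
proof -
  have e: "x i ^ n = x i ^ (n mod q i) * x i ^ (q i * (n div q i))" for i n
    by (simp flip: power_add)
  have L: "x i ^ (q i * (e i div q i)) \<in> L i" for i e
    by (intro L_intros L_x)
  have mod: "(\<lambda>i. e i mod q i) \<in> N" for e
    by (simp add: N_iff q_pos)
  show "\<exists>n\<in>N \<times> N. \<exists>z\<in>Z. s = dx n * z" if s: "s \<in> dx_gens"
  proof -
    obtain \<beta> e \<mu> where s: "s = P (\<lambda>i. d i (\<beta> i) * x i ^ e i) * y \<mu>" "\<beta> \<in> N" "\<mu> \<in> ys"
      using s unfolding dx_gens_def by blast
    note z = x_power_y_in_Z[OF s(3), of "\<lambda>i. e i div q i"]
    have wL: "d i (\<beta> i) * x i ^ (e i mod q i) \<in> L i" for i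
      using s(2) by (rule dx_L)
    have "(\<lambda>i. d i (\<beta> i) * x i ^ e i) = (\<lambda>i. d i (\<beta> i) * x i ^ (e i mod q i) * x i ^ (q i * (e i div q i)))"
      by (subst e) (simp add: mult.assoc)
    then have "s = P (\<lambda>i. d i (\<beta> i) * x i ^ (e i mod q i)) * P (\<lambda>i. x i ^ (q i * (e i div q i))) * y \<mu>"
      using P_mult[of "\<lambda>i. d i (\<beta> i) * x i ^ (e i mod q i)" "\<lambda>i. x i ^ (q i * (e i div q i))", OF wL L[of _ e]] s(1)
      by (simp only:)
    then show ?thesis
      using z mod[of e] s(2) by (intro bexI[of _ "(\<lambda>i. e i mod q i, \<beta>)"] bexI[of _ "P (\<lambda>i. x i ^ (q i * (e i div q i))) * y \<mu>"]) (auto simp: dx_def mult.assoc)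
  qed
  show "\<exists>n\<in>N \<times> N. \<exists>z\<in>Z. s = xd n * z" if s: "s \<in> xd_gens"
  proof -
    obtain \<beta> e \<mu> where s: "s = P (\<lambda>i. x i ^ e i * d i (\<beta> i)) * y \<mu>" "\<beta> \<in> N" "\<mu> \<in> ys"
      using s unfolding xd_gens_def by blast
    note z = x_power_y_in_Z[OF s(3), of "\<lambda>i. e i div q i"]
    have wL: "x i ^ (e i mod q i) * d i (\<beta> i) \<in> L i" for i
      using s(2) by (rule xd_L)
    have "x i ^ (q i * (e i div q i)) * d i (\<beta> i) = d i (\<beta> i) * x i ^ (q i * (e i div q i))" for i
      using s(2) by (intro C_d x_power_q_mult_in_C) (simp add: N_iff)
    then have "(\<lambda>i. x i ^ e i * d i (\<beta> i)) = (\<lambda>i. x i ^ (e i mod q i) * d i (\<beta> i) * x i ^ (q i * (e i div q i)))"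
      by (subst e) (simp add: mult.assoc)
    then have "s = P (\<lambda>i. x i ^ (e i mod q i) * d i (\<beta> i)) * P (\<lambda>i. x i ^ (q i * (e i div q i))) * y \<mu>"
      using P_mult[of "\<lambda>i. x i ^ (e i mod q i) * d i (\<beta> i)" "\<lambda>i. x i ^ (q i * (e i div q i))", OF wL L[of _ e]] s(1)
      by (simp only:)
    then show ?thesis
      using z mod[of e] s(2) by (intro bexI[of _ "(\<lambda>i. e i mod q i, \<beta>)"] bexI[of _ "P (\<lambda>i. x i ^ (q i * (e i div q i))) * y \<mu>"]) (auto simp: xd_def mult.assoc)
  qed
qed

lemma span_form:
  assumes "finite I" "\<And>s. s \<in> G \<Longrightarrow> \<exists>n\<in>I. \<exists>z\<in>Z. s = B n * z" "t \<in> K.span G"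
  shows "\<exists>z. (\<forall>n. z n \<in> Z) \<and> t = (\<Sum>n\<in>I. B n * z n)"
  using assms(3)
proof (induction rule: K.span_induct_alt)
  case base
  then show ?case by (intro exI[of _ "\<lambda>n. 0"]) (simp add: Z_def K.span_zero)
next
  case (step c s t)
  obtain z where z: "\<And>n. z n \<in> Z" "t = (\<Sum>n\<in>I. B n * z n)" using step by blast
  obtain n0 z0 where n0: "n0 \<in> I" "z0 \<in> Z" "s = B n0 * z0" using assms(2) step by blast
  have "scaleK c s + t = (\<Sum>n\<in>I. (if n = n0 then B n * scaleK c z0 else 0) + B n * z n)"
    using n0 assms(1) by (simp add: sum.distrib z scaleK_mult_right)
  also have "\<dots> = (\<Sum>n\<in>I. B n * ((if n = n0 then scaleK c z0 else 0) + z n))"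
    by (intro sum.cong) (auto simp: distrib_left)
  finally show ?case
    using z n0(2) by (intro exI[of _ "\<lambda>n. (if n = n0 then scaleK c z0 else 0) + z n"])
      (auto simp: Z_def K.span_zero K.span_add K.span_scale)
qed

lemma T_form_dx: "t \<in> T \<Longrightarrow> \<exists>z. (\<forall>n. z n \<in> Z) \<and> t = (\<Sum>n\<in>N \<times> N. dx n * z n)"
  and T_form_xd: "t \<in> T \<Longrightarrow> \<exists>z. (\<forall>n. z n \<in> Z) \<and> t = (\<Sum>n\<in>N \<times> N. xd n * z n)"
  using span_form[OF _ gens_form(1) T_span_dx] span_form[OF _ gens_form(2) T_span_xd] finite_N
  by simp_all

lemma Z_C: "z \<in> Z \<Longrightarrow> z \<in> C i"
  unfolding Z_def
proof (induction rule: K.span_induct_alt)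
  case base
  then show ?case by (simp add: C_def)
next
  case (step c a b)
  then show ?case unfolding C_def using X_C by (auto intro!: commutant_add commutant_scaleK simp: C_def)
qed

lemma delta'_eq: "delta' \<sigma> \<beta> = fold (\<lambda>j. \<delta> j ^^ \<beta> j) idx_n"
  by (simp add: delta'_def \<delta>_def[abs_def] x_def)

lemma d_mon'_eq: "d_mon' \<sigma> \<alpha> = P (\<lambda>i. d i (\<alpha> i))"
  by (simp add: d_mon'_def d_def)

lemma ad_add: "ad c (u + v) = ad c u + ad c v"
  by (simp add: ad_def algebra_simps)

lemma delta'_add: "delta' \<sigma> \<beta> (u + v) = delta' \<sigma> \<beta> u + delta' \<sigma> \<beta> v"
  unfolding delta'_eq
proof (rule fold_additive)
  show "(\<delta> i ^^ n) (u + v) = (\<delta> i ^^ n) u + (\<delta> i ^^ n) v" for i n u v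
    by (induction n) (simp_all add: \<delta>_def ad_add)
qed

lemma phi_x_add: "phi_x k \<sigma> i (u + v) = phi_x k \<sigma> i u + phi_x k \<sigma> i v"
  unfolding phi_x_def
  by (rule fold_additive)
    (simp add: phi_x_step_def ad_funpow_add distrib_left K.scale_right_distrib sum.distrib)

lemma phi_add: "phi k \<sigma> (u + v) = phi k \<sigma> u + phi k \<sigma> v"
  and psi_add: "psi k \<sigma> (u + v) = psi k \<sigma> u + psi k \<sigma> v"
proof -
  have x: "fold (phi_x k \<sigma>) is (u + v) = fold (phi_x k \<sigma>) is u + fold (phi_x k \<sigma>) is v" for "is" u v
    by (rule fold_additive) (rule phi_x_add)
  have "fold (phi_d k \<sigma>) is (u + v) = fold (phi_d k \<sigma>) is u + fold (phi_d k \<sigma>) is v" for "is" u v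
    by (rule fold_additive) (simp add: phi_d_eq ad_funpow_add distrib_left sum.distrib)
  then show "phi k \<sigma> (u + v) = phi k \<sigma> u + phi k \<sigma> v"
    by (simp add: phi_def x)
  have "fold (psi_d k \<sigma>) is (u + v) = fold (psi_d k \<sigma>) is u + fold (psi_d k \<sigma>) is v" for "is" u v
    by (rule fold_additive) (simp add: psi_d_eq ad_funpow_add distrib_right sum.distrib)
  then show "psi k \<sigma> (u + v) = psi k \<sigma> u + psi k \<sigma> v"
    by (simp add: psi_def x)
qed

lemma phi_P:
  assumes "\<And>i. w i \<in> L i" "\<And>i. z \<in> C i"
  shows "phi k \<sigma> (P w * z) = P (\<lambda>i. phi_x k \<sigma> i (phi_d k \<sigma> i (w i))) * z"
    and "psi k \<sigma> (P w * z) = P (\<lambda>i. phi_x k \<sigma> i (psi_d k \<sigma> i (w i))) * z"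
  using assms by (simp_all add: phi_def psi_def fold_local_idx_n local_phi_x local_phi_d local_psi_d local_L)

lemma P_indicator:
  "P (\<lambda>i. if Q i then scaleK (c i) 1 else 0) = (if \<forall>i. Q i then scaleK (\<Prod>i\<in>UNIV. c i) 1 else 0)"
proof (cases "\<forall>i. Q i")
  case True
  have "distinct is \<Longrightarrow> prod_list (map (\<lambda>i. scaleK (c i) 1) is) = (scaleK (\<Prod>i\<in>set is. c i) 1 :: ('n, 'k) talg)" for "is"
    by (induction "is") (simp_all add: scaleK_mult_left)
  from this[OF idx_n(2)] show ?thesis using True by simp
next
  case False
  then obtain i where i: "\<not> Q i" by blast
  let ?w = "\<lambda>i. if Q i then scaleK (c i) 1 else 0 :: ('n, 'k) talg"
  have "?w i \<in> L i" for i
    by (auto intro!: L_intros)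
  then have "P (?w(i := 0)) = 0" by (rule P_upd_0)
  moreover have "?w(i := 0) = ?w" using i by auto
  ultimately have "P ?w = 0" by (simp only:)
  then show ?thesis using False by (simp only: if_False)
qed

text \<open>
  The factors with index \<open>i\<close> are collected into one local factor, to which \<open>phi_one_variable\<close> applies;
  the central \<open>z\<close> stays aside.
\<close>

lemma phi_monomial:
  assumes "\<alpha> \<in> N" "\<beta> \<in> N" "n \<in> N \<times> N" "z \<in> Z"
  shows "phi k \<sigma> (delta' \<sigma> \<beta> (dx n * z) * d_mon' \<sigma> \<alpha>)
    = (if n = (\<alpha>, \<beta>) then scaleK ((-1) ^ (\<Sum>i\<in>UNIV. \<alpha> i)) z else 0)"
proof -
  obtain \<alpha>' \<beta>' where n: "n = (\<alpha>', \<beta>')" "\<alpha>' \<in> N" "\<beta>' \<in> N" using assms(3) by auto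
  let ?w = "\<lambda>i. (\<delta> i ^^ \<beta> i) (d i (\<beta>' i) * x i ^ \<alpha>' i)"
  have loc: "is_local i (\<delta> i ^^ \<beta> i)" for i by (intro local_funpow local_delta)
  have wL: "?w i \<in> L i" for i using local_L[OF loc dx_L[OF n(3)]] .
  have dL: "d i (\<alpha> i) \<in> L i" for i using assms(1) by (simp add: N_iff L_d)
  have "delta' \<sigma> \<beta> (dx n * z) = P ?w * z"
    unfolding delta'_eq dx_def n fst_conv snd_conv
    by (intro fold_local_idx_n loc dx_L n Z_C assms)
  moreover have "P ?w * z * d_mon' \<sigma> \<alpha> = P (\<lambda>i. ?w i * d i (\<alpha> i)) * z"
  proof -
    have "P ?w * z * d_mon' \<sigma> \<alpha> = P ?w * (P (\<lambda>i. d i (\<alpha> i)) * z)"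
      using C_P_commute[of z "\<lambda>i. d i (\<alpha> i)", OF Z_C[OF assms(4)] dL] by (simp only: d_mon'_eq mult.assoc)
    then show ?thesis
      using P_mult[of ?w "\<lambda>i. d i (\<alpha> i)", OF wL dL] by (simp only: mult.assoc[symmetric])
  qed
  ultimately have "phi k \<sigma> (delta' \<sigma> \<beta> (dx n * z) * d_mon' \<sigma> \<alpha>)
      = P (\<lambda>i. phi_x k \<sigma> i (phi_d k \<sigma> i (?w i * d i (\<alpha> i)))) * z"
    using phi_P(1)[of "\<lambda>i. ?w i * d i (\<alpha> i)" z, OF L_intros(3)[OF wL dL] Z_C[OF assms(4)]] by (simp only:)
  also have "\<dots> = P (\<lambda>i. if \<alpha> i = \<alpha>' i \<and> \<beta> i = \<beta>' i then scaleK ((-1) ^ \<alpha> i) 1 else 0) * z"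
    using assms n by (simp add: phi_one_variable N_iff)
  also have "\<dots> = (if n = (\<alpha>, \<beta>) then scaleK ((-1) ^ (\<Sum>i\<in>UNIV. \<alpha> i)) z else 0)"
    unfolding P_indicator n by (auto simp: scaleK_mult_left power_sum)
  finally show ?thesis .
qed

lemma psi_monomial:
  assumes "\<alpha> \<in> N" "\<beta> \<in> N" "n \<in> N \<times> N" "z \<in> Z"
  shows "psi k \<sigma> (d_mon' \<sigma> \<alpha> * delta' \<sigma> \<beta> (xd n * z)) = (if n = (\<alpha>, \<beta>) then z else 0)"
proof -
  obtain \<alpha>' \<beta>' where n: "n = (\<alpha>', \<beta>')" "\<alpha>' \<in> N" "\<beta>' \<in> N" using assms(3) by auto
  let ?w = "\<lambda>i. (\<delta> i ^^ \<beta> i) (x i ^ \<alpha>' i * d i (\<beta>' i))"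
  have loc: "is_local i (\<delta> i ^^ \<beta> i)" for i by (intro local_funpow local_delta)
  have wL: "?w i \<in> L i" for i using local_L[OF loc xd_L[OF n(3)]] .
  have dL: "d i (\<alpha> i) \<in> L i" for i using assms(1) by (simp add: N_iff L_d)
  have "delta' \<sigma> \<beta> (xd n * z) = P ?w * z"
    unfolding delta'_eq xd_def n fst_conv snd_conv
    by (intro fold_local_idx_n loc xd_L n Z_C assms)
  moreover have "d_mon' \<sigma> \<alpha> * (P ?w * z) = P (\<lambda>i. d i (\<alpha> i) * ?w i) * z"
    using P_mult[of "\<lambda>i. d i (\<alpha> i)" ?w, OF dL wL] by (simp only: d_mon'_eq mult.assoc[symmetric])
  ultimately have "psi k \<sigma> (d_mon' \<sigma> \<alpha> * delta' \<sigma> \<beta> (xd n * z))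
      = P (\<lambda>i. phi_x k \<sigma> i (psi_d k \<sigma> i (d i (\<alpha> i) * ?w i))) * z"
    using phi_P(2)[of "\<lambda>i. d i (\<alpha> i) * ?w i" z, OF L_intros(3)[OF dL wL] Z_C[OF assms(4)]] by (simp only:)
  also have "\<dots> = P (\<lambda>i. if \<alpha> i = \<alpha>' i \<and> \<beta> i = \<beta>' i then scaleK 1 1 else 0) * z"
    using assms n by (simp add: psi_one_variable N_iff cong: if_cong)
  also have "\<dots> = (if n = (\<alpha>, \<beta>) then z else 0)"
    unfolding P_indicator n by auto
  finally show ?thesis .
qed

lemma phi_coefficient:
  assumes "\<And>n. z n \<in> Z" "\<alpha> \<in> N" "\<beta> \<in> N"
  shows "phi k \<sigma> (delta' \<sigma> \<beta> (\<Sum>n\<in>N \<times> N. dx n * z n) * d_mon' \<sigma> \<alpha>)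
    = scaleK ((-1) ^ (\<Sum>i\<in>UNIV. \<alpha> i)) (z (\<alpha>, \<beta>))"
proof -
  have "phi k \<sigma> (delta' \<sigma> \<beta> (\<Sum>n\<in>N \<times> N. dx n * z n) * d_mon' \<sigma> \<alpha>)
      = (\<Sum>n\<in>N \<times> N. phi k \<sigma> (delta' \<sigma> \<beta> (dx n * z n) * d_mon' \<sigma> \<alpha>))"
    by (rule additive_sum) (simp add: delta'_add phi_add distrib_right)
  also have "\<dots> = (\<Sum>n\<in>N \<times> N. if n = (\<alpha>, \<beta>) then scaleK ((-1) ^ (\<Sum>i\<in>UNIV. \<alpha> i)) (z n) else 0)"
    using assms by (intro sum.cong) (auto simp: phi_monomial)
  also have "\<dots> = scaleK ((-1) ^ (\<Sum>i\<in>UNIV. \<alpha> i)) (z (\<alpha>, \<beta>))"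
    using finite_N assms by simp
  finally show ?thesis .
qed

lemma psi_coefficient:
  assumes "\<And>n. z n \<in> Z" "\<alpha> \<in> N" "\<beta> \<in> N"
  shows "psi k \<sigma> (d_mon' \<sigma> \<alpha> * delta' \<sigma> \<beta> (\<Sum>n\<in>N \<times> N. xd n * z n)) = z (\<alpha>, \<beta>)"
proof -
  have "psi k \<sigma> (d_mon' \<sigma> \<alpha> * delta' \<sigma> \<beta> (\<Sum>n\<in>N \<times> N. xd n * z n))
      = (\<Sum>n\<in>N \<times> N. psi k \<sigma> (d_mon' \<sigma> \<alpha> * delta' \<sigma> \<beta> (xd n * z n)))"
    by (rule additive_sum) (simp add: delta'_add psi_add distrib_left)
  also have "\<dots> = (\<Sum>n\<in>N \<times> N. if n = (\<alpha>, \<beta>) then z n else 0)"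
    using assms by (intro sum.cong) (auto simp: psi_monomial)
  also have "\<dots> = z (\<alpha>, \<beta>)"
    using finite_N assms by simp
  finally show ?thesis .
qed

text \<open>
  A central element is fixed by \<open>phi\<close>, because all commutators in \<open>phi\<close> vanish on it.  On the other
  hand \<open>phi\<close> with \<open>\<alpha> = \<beta> = 0\<close> yields a coefficient, which lies in \<open>Z\<close>.
\<close>

lemma centre_eq: "T_centre k m = (Z :: ('n, 'k) talg set)"
proof
  show "T_centre k m \<subseteq> Z"
  proof
    fix c :: "('n, 'k) talg" assume c: "c \<in> T_centre k m"
    then have "c \<in> T" and cC: "c \<in> C i" for i
      by (auto simp: T_centre_def intro: central_C)
    obtain z where z: "\<And>n. z n \<in> Z" "c = (\<Sum>n\<in>N \<times> N. dx n * z n)"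
      using T_form_dx[OF \<open>c \<in> T\<close>] by blast
    have 0: "(\<lambda>i. 0) \<in> N" by (simp add: N_iff q_pos)
    have P1: "P (\<lambda>i. 1) = 1" using P_indicator[of "\<lambda>i. True" "\<lambda>i. 1"] by simp
    have "(f :: 'n \<Rightarrow> ('n, 'k) talg \<Rightarrow> ('n, 'k) talg) i ^^ 0 = id" for f i by simp
    then have "fold (\<lambda>j. \<delta> j ^^ 0) is a = a" for "is" and a
      by (induction "is") simp_all
    then have "phi k \<sigma> (delta' \<sigma> (\<lambda>i. 0) c * d_mon' \<sigma> (\<lambda>i. 0)) = phi k \<sigma> (P (\<lambda>i. 1) * c)"
      by (simp add: delta'_eq d_mon'_eq P1)
    also have "\<dots> = P (\<lambda>i. 1) * c"
      using phi_x_power[of _ 0] by (subst phi_P(1)) (auto simp: phi_d_1 cC intro: L_intros)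
    finally show "c \<in> Z"
      using phi_coefficient[of z, OF z(1) 0 0] z(1)[of "(\<lambda>i. 0, \<lambda>i. 0)"] unfolding z(2)[symmetric] by (simp add: P1)
  qed
  show "Z \<subseteq> T_centre k m"
  proof
    fix z :: "('n, 'k) talg" assume z: "z \<in> Z"
    have ZT: "z \<in> T" if "z \<in> Z" for z
      using that unfolding Z_def
      by (induction rule: K.span_induct_alt) (auto simp: X_in T_alg_add T_alg_scaleK)
    have "z * t = t * z" if "t \<in> K.span dx_gens" for t
      using that
    proof (induction rule: K.span_induct_alt)
      case (step c a b)
      obtain \<beta> e \<mu> where a: "a = P (\<lambda>i. d i (\<beta> i) * x i ^ e i) * y \<mu>" "\<beta> \<in> N" "\<mu> \<in> ys"
        using step unfolding dx_gens_def by blast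
      let ?w = "\<lambda>i. d i (\<beta> i) * x i ^ e i"
      have wL: "?w i \<in> L i" for i using a(2) by (rule dx_L)
      have "z * a = P ?w * (z * y \<mu>)"
        using C_P_commute[of z ?w, OF Z_C[OF z] wL] by (simp only: a(1) mult.assoc[symmetric])
      also have "\<dots> = a * z"
        using y_commute[OF a(3) ZT[OF z]] by (simp add: a(1) mult.assoc)
      finally show ?case
        using step by (simp add: distrib_left distrib_right scaleK_mult_left scaleK_mult_right)
    qed simp
    then show "z \<in> T_centre k m"
      using ZT[OF z] T_span_dx by (simp add: T_centre_def)
  qed
qed

end


section \<open>Independence of the monomials in the centre\<close>

lift_definition diffop_act :: "('n, 'k::field) diffop \<Rightarrow> (('n \<Rightarrow> nat) \<Rightarrow> 'k) \<Rightarrow> (('n \<Rightarrow> nat) \<Rightarrow> 'k)" is alg_act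
proof -
  fix f g :: "('n, 'k) free_alg" assume "f - g \<in> two_sided_ideal diffop_rels"
  then have "alg_act (f - g) v a = 0" for v a by (simp add: alg_act_ideal)
  then show "alg_act f = alg_act g" by (simp add: fun_eq_iff alg_act_diff)
qed

lemma diffop_act_add: "diffop_act (f + g) v a = diffop_act f v a + diffop_act g v a"
  by transfer (rule alg_act_add)

lemma diffop_act_mult: "diffop_act (f * g) v = diffop_act f (diffop_act g v)"
  by transfer (rule alg_act_mult)

lemma diffop_act_1: "diffop_act 1 v = v"
  by transfer (rule alg_act_one)

lemma diffop_act_const: "diffop_act (diffop_const c) v a = c * v a"
  by transfer (simp add: alg_act_single word_act_def zero_free_monoid_def)

lemma diffop_act_x: "diffop_act (diffop_x i) v a = (if a i = 0 then 0 else v (a(i := a i - 1)))"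
  by transfer (rule alg_act_x)

lemma diffop_act_x_power:
  "diffop_act (diffop_x i ^ n) v a = (if n \<le> a i then v (a(i := a i - n)) else 0)"
  by (induction n arbitrary: a) (auto simp: diffop_act_1 diffop_act_mult diffop_act_x)

text \<open>
  A monomial in the \<open>x\<^sub>i\<close> shifts exponents.  In particular it turns the power series \<open>1\<close> into itself, so
  that its exponent can be recovered from its action.
\<close>

lemma diffop_act_x_monomial:
  assumes "distinct is"
  shows "diffop_act (prod_list (map (\<lambda>i. diffop_x i ^ f i) is)) v a
    = (if \<forall>i\<in>set is. f i \<le> a i then v (\<lambda>i. if i \<in> set is then a i - f i else a i) else 0)"
  using assms
proof (induction "is" arbitrary: a)
  case (Cons i "is")
  have "(\<lambda>j. if j \<in> set is then (a(i := a i - f i)) j - f j else (a(i := a i - f i)) j)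
      = (\<lambda>j. if j \<in> set (i # is) then a j - f j else a j)"
    using Cons.prems by auto
  moreover have "(\<forall>j\<in>set is. f j \<le> (a(i := a i - f i)) j) \<longleftrightarrow> (\<forall>j\<in>set is. f j \<le> a j)"
    using Cons.prems by auto
  ultimately show ?case
    using Cons by (simp add: diffop_act_mult diffop_act_x_power del: fun_upd_apply)
qed (simp add: diffop_act_1)

lemma idx_s: "set (idx_s m) = range Inl \<union> Inr ` {..<m}" "distinct (idx_s m)"
  by (auto simp: idx_s_def distinct_map)

lemma exps_s_eqI:
  "\<gamma> \<in> exps_s m \<Longrightarrow> \<epsilon> \<in> exps_s m \<Longrightarrow> (\<And>i. i \<in> set (idx_s m) \<Longrightarrow> \<gamma> i = \<epsilon> i) \<Longrightarrow> \<gamma> = \<epsilon>"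
proof (rule ext)
  fix i assume *: "\<gamma> \<in> exps_s m" "\<epsilon> \<in> exps_s m" "\<And>i. i \<in> set (idx_s m) \<Longrightarrow> \<gamma> i = \<epsilon> i"
  show "\<gamma> i = \<epsilon> i"
  proof (cases i)
    case (Inl j)
    then show ?thesis using *(3)[of i] by (simp add: idx_s)
  next
    case (Inr j)
    then show ?thesis
      using *(1,2) *(3)[of i] by (cases "j < m") (auto simp: idx_s exps_s_def)
  qed
qed

context T_aut
begin

lemma X_mon_single:
  "(X_mon k m g :: ('n, 'k) talg) = Poly_Mapping.single (y_exp g) (prod_list (map (\<lambda>i. diffop_x i ^ (q i * g (Inl i))) idx_n))"
proof -
  have power: "(Poly_Mapping.single (0 :: nat \<Rightarrow>\<^sub>0 nat) a) ^ n = Poly_Mapping.single 0 (a ^ n :: ('n, 'k) diffop)" for a n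
    by (induction n) (simp_all add: mult_single)
  have 1: "(T_X k (Inl i) ^ n :: ('n, 'k) talg) = Poly_Mapping.single 0 (diffop_x i ^ (q i * n))" for i n
    by (simp add: T_X.simps T_x.simps power power_mult p q)
  have 2: "prod_list (map (\<lambda>i. Poly_Mapping.single (0 :: nat \<Rightarrow>\<^sub>0 nat) (f i)) is) = Poly_Mapping.single 0 (prod_list (map f is))"
    for f :: "'n \<Rightarrow> ('n, 'k) diffop" and "is"
    by (induction "is") (simp_all add: mult_single)
  have 3: "prod_list (map (\<lambda>j. T_X k (Inr j) ^ g (Inr j)) [0..<m]) = (Poly_Mapping.single (y_exp g) 1 :: ('n, 'k) talg)"
    unfolding y_exp_def prod_T_x_Inr[symmetric] by (simp add: T_X.simps)
  show ?thesis
    using 3 by (simp add: X_mon_def idx_s_def comp_def 1 2 mult_single)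
qed

text \<open>
  The coefficient of the monomial with exponent \<open>g\<close>: the variables \<open>x\<^bsub>n+1\<^esub>, \<dots>, x\<^bsub>n+m\<^esub>\<close> are read off from
  the polynomial structure, the others from the effect on the power series \<open>1\<close>, whose coefficient
  function is the indicator of the exponent \<open>0\<close>.
\<close>

definition "X_coeff g (u :: ('n, 'k) talg) = diffop_act (Poly_Mapping.lookup u (y_exp g))
  (\<lambda>a. if a = (\<lambda>i. 0) then 1 else 0) (\<lambda>i. q i * g (Inl i))"

lemma X_coeff_add: "X_coeff g (u + v) = X_coeff g u + X_coeff g v"
  and X_coeff_scaleK: "X_coeff g (scaleK c u) = c * X_coeff g u"
  by (simp_all add: X_coeff_def lookup_add lookup_scaleK diffop_act_add diffop_act_mult diffop_act_const)

lemma X_coeff_X_mon: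
  assumes "g \<in> exps_s m" "h \<in> exps_s m"
  shows "X_coeff g (X_mon k m h) = (if g = h then 1 else 0)"
proof -
  have "g = h" if "y_exp h = y_exp g" "\<forall>i. q i * h (Inl i) = q i * g (Inl i)"
  proof (rule exps_s_eqI[OF assms])
    fix i :: "'n + nat" assume "i \<in> set (idx_s m)"
    moreover have "h (Inl j) = g (Inl j)" for j
      using that(2)[rule_format, of j] q_pos[of j] by simp
    moreover have "h (Inr j) = g (Inr j)" if "j < m" for j
      using arg_cong[OF \<open>y_exp h = y_exp g\<close>, of "\<lambda>f. Poly_Mapping.lookup f j"] that
      by (simp add: lookup_y_exp)
    ultimately show "g i = h i" by (auto simp: idx_s)
  qed
  moreover have "g = h" if "y_exp h = y_exp g" "\<forall>i. q i * h (Inl i) \<le> q i * g (Inl i)"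
    "(\<lambda>i. q i * g (Inl i) - q i * h (Inl i)) = (\<lambda>i. 0)"
    using that by (intro calculation) (auto simp: fun_eq_iff intro: le_antisym)
  ultimately show ?thesis
    by (auto simp: X_coeff_def X_mon_single lookup_single when_def diffop_act_x_monomial
        diffop_act_const[of 0, simplified])
qed

lemma X_inj: "inj_on X (exps_s m)"
proof
  fix g h assume gh: "g \<in> exps_s m" "h \<in> exps_s m" "X g = X h"
  then have "X_mon k m g = (X_mon k m h :: ('n, 'k) talg)"
    using \<sigma>_inj X_mon_in by (auto simp: X_sigma inj_on_def)
  then show "g = h"
    using X_coeff_X_mon[OF gh(1) gh(1)] X_coeff_X_mon[OF gh(1) gh(2)] by (auto split: if_splits)
qed

lemma X_independent: "\<not> K.dependent (X ` exps_s m)"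
proof
  assume "K.dependent (X ` exps_s m)"
  then obtain g where g: "g \<in> exps_s m" "X g \<in> K.span (X ` exps_s m - {X g})"
    unfolding K.dependent_def by blast
  have "\<exists>u\<in>T. v = \<sigma> u \<and> X_coeff g u = 0" if "v \<in> K.span (X ` exps_s m - {X g})" for v
    using that
  proof (induction rule: K.span_induct_alt)
    case base
    then show ?case using X_coeff_scaleK[of g 0 0] by (intro bexI[of _ 0]) auto
  next
    case (step c a b)
    then obtain h u where h: "h \<in> exps_s m" "a = X h" "h \<noteq> g" "u \<in> T" "b = \<sigma> u" "X_coeff g u = 0"
      by blast
    then show ?case using g(1)
      by (intro bexI[of _ "scaleK c (X_mon k m h) + u"])
        (auto simp: X_sigma \<sigma>_add \<sigma>_scaleK X_mon_in T_alg_scaleK T_alg_add X_coeff_add X_coeff_scaleK X_coeff_X_mon)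
  qed
  then obtain u where "u \<in> T" "X g = \<sigma> u" "X_coeff g u = 0" using g(2) by blast
  moreover from this have "u = X_mon k m g"
    using \<sigma>_inj X_mon_in by (auto simp: X_sigma inj_on_def)
  ultimately show False using X_coeff_X_mon[OF g(1) g(1)] by simp
qed

section \<open>Higher derivations and the constant term on the centre\<close>

text \<open>
  Linear operators on the centre; outside the centre nothing is asked, since \<open>Z_der\<close> is undefined
  there.
\<close>

definition "lin f \<longleftrightarrow> (\<forall>z\<in>Z. f z \<in> Z) \<and> linear_on Z f"

lemma lin_funpow: "lin f \<Longrightarrow> lin (f ^^ n)"
  by (induction n) (simp_all add: lin_def linear_on_def)

lemma lin_fold: "(\<And>i. i \<in> set is \<Longrightarrow> lin (F i)) \<Longrightarrow> lin (fold F is)"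
  by (induction "is" rule: rev_induct) (simp_all add: lin_def linear_on_def)

lemma X_Z: "g \<in> exps_s m \<Longrightarrow> X g \<in> Z"
  by (simp add: Z_def K.span_base)

lemma Z_scaleK: "z \<in> Z \<Longrightarrow> scaleK c z \<in> Z" and Z_add: "z \<in> Z \<Longrightarrow> z' \<in> Z \<Longrightarrow> z + z' \<in> Z"
  and Z_0: "0 \<in> Z"
  by (simp_all add: Z_def K.span_scale K.span_add K.span_zero)

lemma Z_sum: "(\<And>t. t \<in> A \<Longrightarrow> f t \<in> Z) \<Longrightarrow> sum f A \<in> Z"
  by (simp add: Z_def K.span_sum)

lemma Z_mult:
  assumes "z \<in> Z" "z' \<in> Z"
  shows "z * z' \<in> Z"
proof -
  have z: "z \<in> T" "z' \<in> T" "\<And>t. t \<in> T \<Longrightarrow> z * t = t * z" "\<And>t. t \<in> T \<Longrightarrow> z' * t = t * z'"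
    using assms unfolding centre_eq[symmetric] T_centre_def by auto
  have "z * z' * t = t * (z * z')" if "t \<in> T" for t
  proof -
    have "z * z' * t = z * t * z'" using z(4)[OF that] by (simp add: mult.assoc)
    then show ?thesis using z(3)[OF that] by (simp add: mult.assoc)
  qed
  then show ?thesis
    using z(1,2) by (simp add: T_alg_mult T_centre_def flip: centre_eq)
qed

lemma lin_0: "lin f \<Longrightarrow> f 0 = 0"
  unfolding lin_def linear_on_def using Z_0 by (metis K.scale_zero_left)

lemma lin_sum:
  assumes "lin f" "finite A" "\<And>t. t \<in> A \<Longrightarrow> v t \<in> Z"
  shows "f (\<Sum>t\<in>A. scaleK (c t) (v t)) = (\<Sum>t\<in>A. scaleK (c t) (f (v t)))"
  using assms(2,3)
proof (induction A)
  case empty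
  then show ?case using assms(1) by (simp add: lin_0)
next
  case (insert t A)
  moreover have "(\<Sum>t\<in>A. scaleK (c t) (v t)) \<in> Z"
    using insert by (intro Z_sum Z_scaleK) auto
  ultimately show ?case using assms(1) by (simp add: lin_def linear_on_def Z_scaleK)
qed

lemma Z_form:
  assumes "z \<in> Z"
  shows "\<exists>F c. finite F \<and> F \<subseteq> exps_s m \<and> (\<forall>g. g \<notin> F \<longrightarrow> c g = 0) \<and> z = (\<Sum>g\<in>F. scaleK (c g) (X g))"
  using assms unfolding Z_def
proof (induction rule: K.span_induct_alt)
  case base
  then show ?case by (intro exI[of _ "{}"] exI[of _ "\<lambda>_. 0"]) simp
next
  case (step r s z)
  then obtain F c h where F: "finite F" "F \<subseteq> exps_s m" "\<And>g. g \<notin> F \<Longrightarrow> c g = 0" "z = (\<Sum>g\<in>F. scaleK (c g) (X g))"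
    and h: "h \<in> exps_s m" "s = X h" by blast
  have "z = (\<Sum>g\<in>insert h F. scaleK (c g) (X g))"
    using F by (intro trans[OF F(4)] sum.mono_neutral_left) auto
  moreover have "scaleK r s = (\<Sum>g\<in>insert h F. scaleK (if g = h then r else 0) (X g))"
    using F(1) h(2) by (simp add: if_distrib[of "\<lambda>a. scaleK a _"] cong: if_cong)
  ultimately have "scaleK r s + z = (\<Sum>g\<in>insert h F. scaleK ((if g = h then r else 0) + c g) (X g))"
    by (simp only: K.scale_left_distrib sum.distrib)
  then show ?case using F h
    by (intro exI[of _ "insert h F"] exI[of _ "\<lambda>g. (if g = h then r else 0) + c g"]) auto
qed

lemma exps_s_upd: "g \<in> exps_s m \<Longrightarrow> i \<in> set (idx_s m) \<Longrightarrow> g(i := e) \<in> exps_s m"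
  by (auto simp: exps_s_def idx_s)

lemma exps_s_diff: "g \<in> exps_s m \<Longrightarrow> g(i := g i - j) \<in> exps_s m"
  by (auto simp: exps_s_def)

text \<open>
  By linear independence some linear map has the prescribed values on the monomials; its restriction
  to the centre is the only candidate, as the monomials span.  Hence the definite description denotes.
\<close>

lemma Z_der: "lin (Z_der k m \<sigma> i j)"
  and Z_der_X: "g \<in> exps_s m \<Longrightarrow> Z_der k m \<sigma> i j (X g) = scaleK (of_nat (g i choose j)) (X (g(i := g i - j)))"
proof -
  define Q where "Q f \<longleftrightarrow> f \<in> Z \<rightarrow>\<^sub>E Z \<and> linear_on Z f \<and>
      (\<forall>\<epsilon>\<in>exps_s m. f (X \<epsilon>) = scaleK (of_nat (\<epsilon> i choose j)) (X (\<epsilon>(i := \<epsilon> i - j))))" for f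
  interpret KK: vector_space_pair "scaleK :: 'k \<Rightarrow> ('n, 'k) talg \<Rightarrow> _" "scaleK :: 'k \<Rightarrow> ('n, 'k) talg \<Rightarrow> _" ..
  define D where "D \<epsilon> = scaleK (of_nat (\<epsilon> i choose j)) (X (\<epsilon>(i := \<epsilon> i - j)))" for \<epsilon>
  obtain f where f: "Vector_Spaces.linear scaleK scaleK f"
    "\<And>v. v \<in> X ` exps_s m \<Longrightarrow> f v = D (inv_into (exps_s m) X v)"
    using KK.linear_independent_extend[OF X_independent, of "\<lambda>v. D (inv_into (exps_s m) X v)"] by blast
  interpret f: Vector_Spaces.linear scaleK scaleK f by fact
  have fX: "f (X \<epsilon>) = D \<epsilon>" if "\<epsilon> \<in> exps_s m" for \<epsilon>
    using that by (simp add: f(2) inv_into_f_f[OF X_inj])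
  have DZ: "D \<epsilon> \<in> Z" if "\<epsilon> \<in> exps_s m" for \<epsilon>
    using that by (simp add: D_def Z_scaleK X_Z exps_s_diff)
  have fZ: "f z \<in> Z" if z: "z \<in> Z" for z
    using z unfolding Z_def
  proof (induction rule: K.span_induct_alt)
    case (step c a b)
    then show ?case using DZ by (auto simp: f.add f.scale fX Z_def[symmetric] intro!: Z_add Z_scaleK)
  qed (simp add: f.zero K.span_zero)
  have ex: "Q (restrict f Z)"
    unfolding Q_def using fZ fX by (auto simp: linear_on_def f.add f.scale Z_add Z_scaleK X_Z D_def)
  have uniq: "g = g'" if "Q g" "Q g'" for g g'
  proof
    fix z
    have lin: "lin g" "lin g'" using that by (auto simp: Q_def lin_def)
    show "g z = g' z"
    proof (cases "z \<in> Z")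
      case True
      then obtain F c where F: "finite F" "F \<subseteq> exps_s m" "z = (\<Sum>g\<in>F. scaleK (c g) (X g))"
        using Z_form by blast
      then have FZ: "\<And>t. t \<in> F \<Longrightarrow> X t \<in> Z" using X_Z by auto
      have "g (X t) = g' (X t)" if "t \<in> F" for t
        using that F(2) \<open>Q g\<close> \<open>Q g'\<close> by (auto simp: Q_def)
      moreover have "g z = (\<Sum>t\<in>F. scaleK (c t) (g (X t)))"
        unfolding F(3) by (rule lin_sum[OF lin(1) F(1) FZ])
      moreover have "g' z = (\<Sum>t\<in>F. scaleK (c t) (g' (X t)))"
        unfolding F(3) by (rule lin_sum[OF lin(2) F(1) FZ])
      ultimately show ?thesis by simp
    next
      case False
      then show ?thesis using that by (auto simp: Q_def PiE_def extensional_def)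
    qed
  qed
  have "Q (THE f. Q f)"
    by (rule theI[of Q, OF ex]) (rule uniq[OF _ ex])
  moreover have "(THE f. Q f) = Z_der k m \<sigma> i j"
    unfolding Z_der_def Q_def centre_eq ..
  ultimately have "Q (Z_der k m \<sigma> i j)" by simp
  then show "lin (Z_der k m \<sigma> i j)"
    and "g \<in> exps_s m \<Longrightarrow> Z_der k m \<sigma> i j (X g) = scaleK (of_nat (g i choose j)) (X (g(i := g i - j)))"
    by (auto simp: Q_def lin_def)
qed

lemma Z_der_multi_sum:
  assumes "finite A" "\<And>t. t \<in> A \<Longrightarrow> e t \<in> exps_s m"
  shows "Z_der_multi k m \<sigma> \<gamma> (\<Sum>t\<in>A. scaleK (c t) (X (e t)))
    = (\<Sum>t\<in>A. scaleK (c t * (\<Prod>i\<in>set (idx_s m). of_nat (e t i choose \<gamma> i)))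
        (X (\<lambda>i. if i \<in> set (idx_s m) then e t i - \<gamma> i else e t i)))"
proof -
  have "fold (\<lambda>i. Z_der k m \<sigma> i (\<gamma> i)) is (\<Sum>t\<in>A. scaleK (c t) (X (e t)))
    = (\<Sum>t\<in>A. scaleK (c t * (\<Prod>i\<in>set is. of_nat (e t i choose \<gamma> i)))
        (X (\<lambda>i. if i \<in> set is then e t i - \<gamma> i else e t i)))"
    if "distinct is" "\<And>t. t \<in> A \<Longrightarrow> e t \<in> exps_s m" for "is" c e
    using that
  proof (induction "is" arbitrary: c e)
    case (Cons i "is")
    have i: "i \<notin> set is" using Cons.prems by simp
    have "fold (\<lambda>i. Z_der k m \<sigma> i (\<gamma> i)) (i # is) (\<Sum>t\<in>A. scaleK (c t) (X (e t)))
      = fold (\<lambda>i. Z_der k m \<sigma> i (\<gamma> i)) is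
          (\<Sum>t\<in>A. scaleK (c t * of_nat (e t i choose \<gamma> i)) (X ((e t)(i := e t i - \<gamma> i))))"
      using Cons.prems assms(1) by (simp add: lin_sum[OF Z_der] X_Z Z_der_X)
    also have "\<dots> = (\<Sum>t\<in>A. scaleK (c t * of_nat (e t i choose \<gamma> i)
          * (\<Prod>j\<in>set is. of_nat (((e t)(i := e t i - \<gamma> i)) j choose \<gamma> j)))
        (X (\<lambda>j. if j \<in> set is then ((e t)(i := e t i - \<gamma> i)) j - \<gamma> j else ((e t)(i := e t i - \<gamma> i)) j)))"
      using Cons.prems by (intro Cons.IH exps_s_diff) auto
    also have "\<dots> = (\<Sum>t\<in>A. scaleK (c t * (\<Prod>j\<in>set (i # is). of_nat (e t j choose \<gamma> j)))
        (X (\<lambda>j. if j \<in> set (i # is) then e t j - \<gamma> j else e t j)))"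
    proof (intro sum.cong refl arg_cong2[of _ _ _ _ scaleK] arg_cong[of _ _ X])
      fix t
      have "(\<Prod>j\<in>set is. of_nat (((e t)(i := e t i - \<gamma> i)) j choose \<gamma> j))
          = (\<Prod>j\<in>set is. of_nat (e t j choose \<gamma> j) :: 'k)"
        using i by (intro prod.cong) auto
      then show "c t * of_nat (e t i choose \<gamma> i) * (\<Prod>j\<in>set is. of_nat (((e t)(i := e t i - \<gamma> i)) j choose \<gamma> j))
          = c t * (\<Prod>j\<in>set (i # is). of_nat (e t j choose \<gamma> j))"
        using i by (simp add: mult.assoc)
    qed (use i in auto)
    finally show ?case .
  qed simp
  from this[OF idx_s(2)] assms(2) show ?thesis unfolding Z_der_multi_def by blast
qed

lemma T_X_commute:
  assumes "i \<in> set (idx_s m)" "j \<in> set (idx_s m)"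
  shows "\<sigma> (T_X k i) * \<sigma> (T_X k j) = \<sigma> (T_X k j) * \<sigma> (T_X k i)"
proof -
  have T: "T_X k i \<in> T" if "i \<in> set (idx_s m)" for i
    using that by (cases i rule: sum.exhaust) (auto simp: idx_s T_X.simps intro!: T_alg_power T_alg_x)
  have "\<exists>n. T_X k i = (T_x i ^ n :: ('n, 'k) talg)" for i
    by (cases i) (auto simp: T_X.simps intro: exI[of _ 1])
  then obtain a b where ab: "T_X k i = (T_x i ^ a :: ('n, 'k) talg)" "T_X k j = (T_x j ^ b :: ('n, 'k) talg)" by blast
  have "T_X k i * T_X k j = (T_X k j * T_X k i :: ('n, 'k) talg)"
    unfolding ab by (intro power_commuting_commutes power_commuting_commutes[symmetric] T_x_commute)
  then show ?thesis using T assms by (simp flip: \<sigma>_mult)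
qed

lemma X_mult:
  assumes "i \<in> set (idx_s m)" "n \<le> g i"
  shows "\<sigma> (T_X k i) ^ n * X (g(i := g i - n)) = X g"
proof -
  obtain as bs where ab: "idx_s m = as @ i # bs" using split_list[OF assms(1)] by blast
  have "distinct (as @ i # bs)" unfolding ab[symmetric] by (rule idx_s(2))
  then have ni: "i \<notin> set as" "i \<notin> set bs" by auto
  have *: "\<sigma> (T_X k i) ^ n * prod_list (map (\<lambda>i. \<sigma> (T_X k i) ^ g i) as)
      = prod_list (map (\<lambda>i. \<sigma> (T_X k i) ^ g i) as) * \<sigma> (T_X k i) ^ n"
  proof (rule prod_list_fixed_commute)
    fix j assume "j \<in> set as"
    then have "\<sigma> (T_X k i) * \<sigma> (T_X k j) = \<sigma> (T_X k j) * \<sigma> (T_X k i)"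
      using assms(1) by (intro T_X_commute) (auto simp: ab)
    then show "\<sigma> (T_X k i) ^ n * \<sigma> (T_X k j) ^ g j = \<sigma> (T_X k j) ^ g j * \<sigma> (T_X k i) ^ n"
      by (intro power_commuting_commutes power_commuting_commutes[symmetric])
  qed
  have eq: "map (\<lambda>j. \<sigma> (T_X k j) ^ (g(i := g i - n)) j) js = map (\<lambda>j. \<sigma> (T_X k j) ^ g j) js" if "i \<notin> set js" for js
    using that by auto
  have "X (g(i := g i - n)) = prod_list (map (\<lambda>i. \<sigma> (T_X k i) ^ g i) as) *
      (\<sigma> (T_X k i) ^ (g i - n) * prod_list (map (\<lambda>i. \<sigma> (T_X k i) ^ g i) bs))"
    by (simp only: X_mon'_def ab map_append list.map eq[OF ni(1)] eq[OF ni(2)] prod_list.append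
        prod_list.Cons fun_upd_same)
  then have "\<sigma> (T_X k i) ^ n * X (g(i := g i - n)) = prod_list (map (\<lambda>i. \<sigma> (T_X k i) ^ g i) as) *
      (\<sigma> (T_X k i) ^ n * \<sigma> (T_X k i) ^ (g i - n) * prod_list (map (\<lambda>i. \<sigma> (T_X k i) ^ g i) bs))"
    using * by (simp only: mult.assoc[symmetric])
  also have "\<sigma> (T_X k i) ^ n * \<sigma> (T_X k i) ^ (g i - n) = \<sigma> (T_X k i) ^ g i"
    using assms(2) by (simp flip: power_add)
  finally show ?thesis by (simp add: X_mon'_def ab)
qed

lemma X_0: "X (\<lambda>i. 0) = 1"
proof -
  have "prod_list (map (\<lambda>i. 1) is) = (1 :: ('n, 'k) talg)" for "is" :: "('n + nat) list"
    by (induction "is") simp_all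
  then show ?thesis by (simp add: X_mon'_def)
qed

lemma T_X_Z: "i \<in> set (idx_s m) \<Longrightarrow> \<sigma> (T_X k i) ^ n \<in> Z"
proof -
  assume i: "i \<in> set (idx_s m)"
  have 0: "(\<lambda>j. 0) \<in> exps_s m" by (simp add: exps_s_def)
  have "((\<lambda>j. 0)(i := n))(i := ((\<lambda>j. 0)(i := n)) i - n) = (\<lambda>j. 0)" by auto
  then have "\<sigma> (T_X k i) ^ n = X ((\<lambda>j. 0)(i := n))"
    using X_mult[OF i, of n "(\<lambda>j. 0)(i := n)"] X_0 by simp
  then show ?thesis using X_Z[OF exps_s_upd[OF 0 i]] by simp
qed

lemma lin_theta_step:
  assumes "i \<in> set (idx_s m)"
  shows "lin (theta_step k m \<sigma> i l)"
proof -
  have D: "lin (Z_der k m \<sigma> i (CHAR('k) ^ l) ^^ j)" for j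
    by (intro lin_funpow Z_der)
  show ?thesis
    unfolding lin_def
  proof (intro conjI ballI)
    fix z assume "z \<in> Z"
    then show "theta_step k m \<sigma> i l z \<in> Z"
      unfolding theta_step_def using D
      by (intro Z_sum Z_scaleK Z_mult T_X_Z assms) (auto simp: lin_def)
  next
    show "linear_on Z (theta_step k m \<sigma> i l)"
      using D by (auto simp: linear_on_def theta_step_def lin_def distrib_left K.scale_right_distrib sum.distrib
          scaleK_mult_right K.scale_sum_right mult.commute)
  qed
qed

lemma fold_theta_step_X:
  assumes "i \<in> set (idx_s m)" "g \<in> exps_s m"
  shows "fold (theta_step k m \<sigma> i) [0..<n] (X g) = (if p ^ n dvd g i then X g else 0)"
proof -
  let ?v = "\<lambda>e. X (g(i := e))"
  have "fold (theta_step k m \<sigma> i) [0..<n] (?v (g i)) = (if p ^ n dvd g i then ?v (g i) else 0)"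
  proof (rule fold_digit_steps)
    fix l
    show "theta_step k m \<sigma> i l 0 = 0" using lin_0[OF lin_theta_step[OF assms(1)]] .
    fix e assume e: "p ^ l dvd e"
    show "theta_step k m \<sigma> i l (?v e) = (if p ^ Suc l dvd e then ?v e else 0)"
      unfolding theta_step_def unfolding p
    proof (rule digit_step[where v = ?v])
      fix e c
      have ge: "g(i := e) \<in> exps_s m" using assms by (intro exps_s_upd)
      then show "Z_der k m \<sigma> i (CHAR('k) ^ l) (scaleK c (?v e))
          = scaleK (c * of_nat (e choose CHAR('k) ^ l)) (?v (e - CHAR('k) ^ l))"
        using Z_der[of i "CHAR('k) ^ l"] Z_der_X[OF ge, of i "CHAR('k) ^ l"]
        by (simp add: lin_def linear_on_def X_Z)
    next
      fix e j assume "CHAR('k) ^ l * j \<le> e"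
      then show "\<sigma> (T_X k i) ^ (CHAR('k) ^ l * j) * ?v (e - CHAR('k) ^ l * j) = ?v e"
        using X_mult[OF assms(1), of "CHAR('k) ^ l * j" "g(i := e)"] by simp
    qed (use char_pos e p in auto)
  qed
  then show ?thesis by simp
qed

text \<open>
  Once \<open>p ^ n\<close> exceeds all the exponents that occur, \<open>p ^ n dvd e t i\<close> means \<open>e t i = 0\<close>, so the partial
  products are constant from then on.
\<close>

lemma theta_sum:
  assumes i: "i \<in> set (idx_s m)" and A: "finite A" "\<And>t. t \<in> A \<Longrightarrow> e t \<in> exps_s m"
  shows "theta k m \<sigma> i (\<Sum>t\<in>A. scaleK (c t) (X (e t))) = (\<Sum>t\<in>A. scaleK (if e t i = 0 then c t else 0) (X (e t)))"
    (is "theta k m \<sigma> i ?u = ?v")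
proof -
  \<comment> \<open>A bound for the exponents; it works because e < p ^ e.\<close>
  define n0 where "n0 = (\<Sum>t\<in>A. e t i)"
  have *: "fold (theta_step k m \<sigma> i) [0..<n] ?u = ?v" if n: "n \<ge> n0" for n
  proof -
    have lin: "lin (fold (theta_step k m \<sigma> i) [0..<n])"
      by (intro lin_fold lin_theta_step i)
    have "p ^ n dvd e t i \<longleftrightarrow> e t i = 0" if t: "t \<in> A" for t
    proof -
      have "e t i \<le> n0" unfolding n0_def using A(1) t by (intro member_le_sum) auto
      also have "n0 < p ^ n" using n less_exp[of n] power_mono[of 2 p n] p_gt_1 by linarith
      finally show ?thesis using dvd_imp_le[of "p ^ n" "e t i"] by (cases "e t i = 0") auto
    qed
    then show ?thesis
      using A by (subst lin_sum[OF lin A(1)]) (auto simp: X_Z fold_theta_step_X[OF i] intro!: sum.cong)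
  qed
  show ?thesis unfolding theta_def
  proof (rule the_equality)
    show "\<exists>L. \<forall>n\<ge>L. fold (theta_step k m \<sigma> i) [0..<n] ?u = ?v" using * by blast
    fix v assume "\<exists>L. \<forall>n\<ge>L. fold (theta_step k m \<sigma> i) [0..<n] ?u = v"
    then obtain L where "\<And>n. n \<ge> L \<Longrightarrow> fold (theta_step k m \<sigma> i) [0..<n] ?u = v" by blast
    from this[of "max L n0"] *[of "max L n0"] show "v = ?v" by simp
  qed
qed

lemma phi_Z_sum:
  assumes "finite A" "\<And>t. t \<in> A \<Longrightarrow> e t \<in> exps_s m"
  shows "phi_Z k m \<sigma> (\<Sum>t\<in>A. scaleK (c t) (X (e t)))
    = scaleK (\<Sum>t\<in>A. if e t = (\<lambda>i. 0) then c t else 0) 1"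
proof -
  have "fold (theta k m \<sigma>) is (\<Sum>t\<in>A. scaleK (c t) (X (e t)))
      = (\<Sum>t\<in>A. scaleK (if \<forall>i\<in>set is. e t i = 0 then c t else 0) (X (e t)))"
    if "set is \<subseteq> set (idx_s m)" for "is" c
    using that
  proof (induction "is" arbitrary: c)
    case (Cons i "is")
    then have "fold (theta k m \<sigma>) (i # is) (\<Sum>t\<in>A. scaleK (c t) (X (e t)))
        = fold (theta k m \<sigma>) is (\<Sum>t\<in>A. scaleK (if e t i = 0 then c t else 0) (X (e t)))"
      using theta_sum[OF _ assms, where i=i] by simp
    also have "\<dots> = (\<Sum>t\<in>A. scaleK (if \<forall>i\<in>set is. e t i = 0 then if e t i = 0 then c t else 0 else 0) (X (e t)))"
      using Cons by simp
    also have "\<dots> = (\<Sum>t\<in>A. scaleK (if \<forall>i\<in>set (i # is). e t i = 0 then c t else 0) (X (e t)))"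
      by (intro sum.cong) auto
    finally show ?case .
  qed simp
  from this[OF subset_refl]
  have "phi_Z k m \<sigma> (\<Sum>t\<in>A. scaleK (c t) (X (e t)))
      = (\<Sum>t\<in>A. scaleK (if \<forall>i\<in>set (idx_s m). e t i = 0 then c t else 0) (X (e t)))"
    by (simp add: phi_Z_def)
  also have "\<dots> = (\<Sum>t\<in>A. scaleK (if e t = (\<lambda>i. 0) then c t else 0) 1)"
  proof (intro sum.cong refl)
    fix t assume "t \<in> A"
    then have "(\<forall>i\<in>set (idx_s m). e t i = 0) \<longleftrightarrow> e t = (\<lambda>i. 0)"
      using exps_s_eqI[OF assms(2)[of t], of "\<lambda>i. 0"] by (auto simp: exps_s_def)
    then show "scaleK (if \<forall>i\<in>set (idx_s m). e t i = 0 then c t else 0) (X (e t))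
        = scaleK (if e t = (\<lambda>i. 0) then c t else 0) 1"
      by (auto simp: X_0)
  qed
  finally show ?thesis by (simp add: K.scale_sum_left)
qed

text \<open>
  If \<open>g i < \<gamma> i\<close> for some \<open>i\<close>, then a binomial coefficient vanishes; if \<open>g i > \<gamma> i\<close> for some \<open>i\<close>, then the
  derivative is a monomial of positive degree, which \<open>phi_Z\<close> kills.
\<close>

lemma phi_Z_Z_der_multi:
  assumes "finite F" "F \<subseteq> exps_s m" "\<gamma> \<in> exps_s m"
  shows "phi_Z k m \<sigma> (Z_der_multi k m \<sigma> \<gamma> (\<Sum>g\<in>F. scaleK (c g) (X g)))
    = scaleK (if \<gamma> \<in> F then c \<gamma> else 0) 1"
proof -
  let ?e = "\<lambda>g i. if i \<in> set (idx_s m) then g i - \<gamma> i else g i"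
  let ?c = "\<lambda>g. c g * (\<Prod>i\<in>set (idx_s m). of_nat (g i choose \<gamma> i))"
  have "?e g \<in> exps_s m" if "g \<in> F" for g
    using that assms(2) by (auto simp: exps_s_def)
  then have "phi_Z k m \<sigma> (Z_der_multi k m \<sigma> \<gamma> (\<Sum>g\<in>F. scaleK (c g) (X g)))
      = scaleK (\<Sum>g\<in>F. if ?e g = (\<lambda>i. 0) then ?c g else 0) 1"
    using assms by (subst Z_der_multi_sum) (auto intro!: phi_Z_sum)
  also have "(\<Sum>g\<in>F. if ?e g = (\<lambda>i. 0) then ?c g else 0) = (\<Sum>g\<in>F. if g = \<gamma> then c g else 0)"
  proof (intro sum.cong refl)
    fix g assume "g \<in> F"
    then have g: "g \<in> exps_s m" using assms(2) by blast
    show "(if ?e g = (\<lambda>i. 0) then ?c g else 0) = (if g = \<gamma> then c g else 0)"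
    proof (cases "g = \<gamma>")
      case True
      have "?e \<gamma> i = 0" for i
      proof (cases i)
        case (Inr j)
        then show ?thesis using assms(3) by (cases "j < m") (auto simp: idx_s exps_s_def)
      qed (simp add: idx_s)
      then have "?e \<gamma> = (\<lambda>i. 0)" by (rule ext)
      then show ?thesis by (simp only: True simp_thms if_True) simp
    next
      case False
      then obtain i where i: "i \<in> set (idx_s m)" "g i \<noteq> \<gamma> i"
        using exps_s_eqI[OF g assms(3)] by blast
      show ?thesis
      proof (cases "g i < \<gamma> i")
        case True
        then have "(\<Prod>i\<in>set (idx_s m). of_nat (g i choose \<gamma> i) :: 'k) = 0"
          using i by (intro prod_zero) (auto intro!: bexI[of _ i] simp: binomial_eq_0)
        then show ?thesis using False by simp
      next
        case 2: False
        have "?e g \<noteq> (\<lambda>i. 0)"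
        proof
          assume "?e g = (\<lambda>i. 0)"
          from fun_cong[OF this, of i] show False using i 2 by simp
        qed
        then show ?thesis using False by (simp only: if_False)
      qed
    qed
  qed
  also have "\<dots> = (if \<gamma> \<in> F then c \<gamma> else 0)"
    using assms(1) by simp
  finally show ?thesis .
qed

section \<open>The inversion formula\<close>

text \<open>
  Both formulas at once: \<open>B\<close> is the family of monomials in the original generators, in one of the two
  orders.  Expanding each \<open>z n\<close> in the monomials \<open>X\<close> expresses \<open>a\<close> as the image of the claimed sum.
\<close>

lemma has_finite_sum_inverse:
  assumes z: "\<And>n. z n \<in> Z" and B: "\<And>n. n \<in> N \<times> N \<Longrightarrow> B n \<in> T"
    and a: "a = (\<Sum>n\<in>N \<times> N. \<sigma> (B n) * z n)"
    and f: "\<And>\<alpha> \<beta> \<gamma>. \<alpha> \<in> N \<Longrightarrow> \<beta> \<in> N \<Longrightarrow> \<gamma> \<in> exps_s m \<Longrightarrow>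
      f (\<alpha>, \<beta>, \<gamma>) = phi_Z k m \<sigma> (Z_der_multi k m \<sigma> \<gamma> (z (\<alpha>, \<beta>))) * (B (\<alpha>, \<beta>) * X_mon k m \<gamma>)"
  shows "has_finite_sum f (N \<times> N \<times> exps_s m) (inv_into T \<sigma> a)"
proof -
  define rep where "rep n F c \<longleftrightarrow> finite F \<and> F \<subseteq> exps_s m \<and> (\<forall>g. g \<notin> F \<longrightarrow> c g = 0)
    \<and> z n = (\<Sum>g\<in>F. scaleK (c g) (X g))" for n F c
  have "\<forall>n. \<exists>F c. rep n F c"
    using Z_form[OF z] unfolding rep_def by blast
  from choice[OF this] obtain F where "\<forall>n. \<exists>c. rep n (F n) c" by blast
  from choice[OF this] obtain c where "\<forall>n. rep n (F n) (c n)" by blast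
  then have Fc: "\<And>n. finite (F n)" "\<And>n. F n \<subseteq> exps_s m" "\<And>n g. g \<notin> F n \<Longrightarrow> c n g = 0"
    "\<And>n. z n = (\<Sum>g\<in>F n. scaleK (c n g) (X g))"
    unfolding rep_def by blast+
  \<comment> \<open>One finite set of exponents that serves for all the finitely many coefficients.\<close>
  define G where "G = (\<Union>n\<in>N \<times> N. F n)"
  have G: "finite G" "G \<subseteq> exps_s m"
    unfolding G_def by (intro finite_UN_I finite_cartesian_product finite_N Fc(1)) (intro UN_least Fc(2))
  have zG: "z n = (\<Sum>g\<in>G. scaleK (c n g) (X g))" if "n \<in> N \<times> N" for n
    unfolding Fc(4) using that G(1) Fc(3) by (intro sum.mono_neutral_left) (auto simp: G_def)
  have f': "f (\<alpha>, \<beta>, \<gamma>) = scaleK (c (\<alpha>, \<beta>) \<gamma>) (B (\<alpha>, \<beta>) * X_mon k m \<gamma>)"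
    if "\<alpha> \<in> N" "\<beta> \<in> N" "\<gamma> \<in> exps_s m" for \<alpha> \<beta> \<gamma>
  proof -
    have "phi_Z k m \<sigma> (Z_der_multi k m \<sigma> \<gamma> (z (\<alpha>, \<beta>))) = scaleK (c (\<alpha>, \<beta>) \<gamma>) 1"
      using Fc(3)[of \<gamma> "(\<alpha>, \<beta>)"] phi_Z_Z_der_multi[OF Fc(1,2) that(3)] by (subst Fc(4)) auto
    then show ?thesis by (simp add: f[OF that] scaleK_mult_left)
  qed
  define b where "b = (\<Sum>t\<in>N \<times> N \<times> G. f t)"
  have b: "b = (\<Sum>n\<in>N \<times> N. \<Sum>\<gamma>\<in>G. scaleK (c n \<gamma>) (B n * X_mon k m \<gamma>))"
  proof -
    have "b = (\<Sum>\<alpha>\<in>N. \<Sum>\<beta>\<in>N. \<Sum>\<gamma>\<in>G. f (\<alpha>, \<beta>, \<gamma>))"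
      by (simp add: b_def sum.cartesian_product)
    also have "\<dots> = (\<Sum>\<alpha>\<in>N. \<Sum>\<beta>\<in>N. \<Sum>\<gamma>\<in>G. scaleK (c (\<alpha>, \<beta>) \<gamma>) (B (\<alpha>, \<beta>) * X_mon k m \<gamma>))"
      using G(2) by (intro sum.cong refl f') auto
    also have "\<dots> = (\<Sum>n\<in>N \<times> N. \<Sum>\<gamma>\<in>G. scaleK (c n \<gamma>) (B n * X_mon k m \<gamma>))"
      using sum.cartesian_product[of "\<lambda>\<alpha> \<beta>. \<Sum>\<gamma>\<in>G. scaleK (c (\<alpha>, \<beta>) \<gamma>) (B (\<alpha>, \<beta>) * X_mon k m \<gamma>)" N N]
      by (simp only: case_prod_unfold prod.collapse)
    finally show ?thesis .
  qed
  have bT: "b \<in> T"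
    unfolding b using B X_mon_in by (intro T_alg_sum T_alg_scaleK T_alg_mult) auto
  have "\<sigma> b = (\<Sum>n\<in>N \<times> N. \<Sum>\<gamma>\<in>G. scaleK (c n \<gamma>) (\<sigma> (B n) * X \<gamma>))"
  proof -
    have "\<sigma> b = (\<Sum>n\<in>N \<times> N. \<sigma> (\<Sum>\<gamma>\<in>G. scaleK (c n \<gamma>) (B n * X_mon k m \<gamma>)))"
      unfolding b using B X_mon_in by (intro \<sigma>_sum T_alg_sum T_alg_scaleK T_alg_mult) auto
    also have "\<dots> = (\<Sum>n\<in>N \<times> N. \<Sum>\<gamma>\<in>G. scaleK (c n \<gamma>) (\<sigma> (B n) * X \<gamma>))"
    proof (intro sum.cong refl)
      fix n assume n: "n \<in> N \<times> N"
      have "\<sigma> (\<Sum>\<gamma>\<in>G. scaleK (c n \<gamma>) (B n * X_mon k m \<gamma>)) = (\<Sum>\<gamma>\<in>G. \<sigma> (scaleK (c n \<gamma>) (B n * X_mon k m \<gamma>)))"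
        using B[OF n] X_mon_in by (intro \<sigma>_sum T_alg_scaleK T_alg_mult)
      also have "\<dots> = (\<Sum>\<gamma>\<in>G. scaleK (c n \<gamma>) (\<sigma> (B n) * X \<gamma>))"
        using B[OF n] X_mon_in by (simp add: \<sigma>_scaleK \<sigma>_mult T_alg_mult X_sigma)
      finally show "\<sigma> (\<Sum>\<gamma>\<in>G. scaleK (c n \<gamma>) (B n * X_mon k m \<gamma>)) = (\<Sum>\<gamma>\<in>G. scaleK (c n \<gamma>) (\<sigma> (B n) * X \<gamma>))" .
    qed
    finally show ?thesis .
  qed
  also have "\<dots> = a"
    unfolding a by (intro sum.cong refl) (simp add: zG sum_distrib_left scaleK_mult_right)
  finally have inv: "inv_into T \<sigma> a = b"
    using inv_into_f_f[OF \<sigma>_inj bT] by simp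
  have sub: "{t \<in> N \<times> N \<times> exps_s m. f t \<noteq> 0} \<subseteq> N \<times> N \<times> G"
    using f' Fc(3) by (auto simp: G_def) force
  have fin: "finite (N \<times> N \<times> G)" using finite_N G(1) by simp
  have "(\<Sum>t\<in>{t \<in> N \<times> N \<times> exps_s m. f t \<noteq> 0}. f t) = b"
    unfolding b_def using sub fin G(2) by (intro sum.mono_neutral_left) auto
  then show ?thesis
    unfolding has_finite_sum_def inv using finite_subset[OF sub fin] by simp
qed

lemma d_mon_in: "\<beta> \<in> N \<Longrightarrow> d_mon \<beta> \<in> T" and x_mon_in: "x_mon \<alpha> \<in> T"
  and \<sigma>_d_mon: "\<beta> \<in> N \<Longrightarrow> \<sigma> (d_mon \<beta>) = P (\<lambda>i. d i (\<beta> i))"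
  and \<sigma>_x_mon: "\<sigma> (x_mon \<alpha>) = P (\<lambda>i. x i ^ \<alpha> i)"
proof -
  have d: "u \<in> T" if "\<beta> \<in> N" "u \<in> set (map (\<lambda>i. T_d i (\<beta> i)) idx_n)" for u
    using that by (auto simp: N_iff T_d_in)
  have x: "u \<in> T" if "u \<in> set (map (\<lambda>i. T_x (Inl i) ^ \<alpha> i) idx_n)" for u
    using that by (auto simp: T_alg_x T_alg_power)
  show "\<beta> \<in> N \<Longrightarrow> d_mon \<beta> \<in> T" "x_mon \<alpha> \<in> T"
    unfolding d_mon_def x_mon_def by (rule T_alg_prod_list, erule (1) d) (rule T_alg_prod_list, erule x)
  show "\<beta> \<in> N \<Longrightarrow> \<sigma> (d_mon \<beta>) = P (\<lambda>i. d i (\<beta> i))"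
    unfolding d_mon_def by (subst \<sigma>_prod_list, erule (1) d) (simp add: d_def comp_def)
  show "\<sigma> (x_mon \<alpha>) = P (\<lambda>i. x i ^ \<alpha> i)"
    unfolding x_mon_def by (subst \<sigma>_prod_list, erule x) (simp add: x_def comp_def \<sigma>_power T_alg_x)
qed

lemma \<sigma>_dx: "n \<in> N \<times> N \<Longrightarrow> \<sigma> (d_mon (snd n) * x_mon (fst n)) = dx n"
  and \<sigma>_xd: "n \<in> N \<times> N \<Longrightarrow> \<sigma> (x_mon (fst n) * d_mon (snd n)) = xd n"
proof -
  assume n: "n \<in> N \<times> N"
  then have d: "d i (snd n i) \<in> L i" for i by (auto simp: N_iff intro: L_d)
  have x: "x i ^ fst n i \<in> L i" for i by (intro L_intros L_x)
  show "\<sigma> (d_mon (snd n) * x_mon (fst n)) = dx n"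
    using n P_mult[of "\<lambda>i. d i (snd n i)" "\<lambda>i. x i ^ fst n i", OF d x]
    by (auto simp: \<sigma>_mult d_mon_in x_mon_in \<sigma>_d_mon \<sigma>_x_mon dx_def)
  show "\<sigma> (x_mon (fst n) * d_mon (snd n)) = xd n"
    using n P_mult[of "\<lambda>i. x i ^ fst n i" "\<lambda>i. d i (snd n i)", OF x d]
    by (auto simp: \<sigma>_mult d_mon_in x_mon_in \<sigma>_d_mon \<sigma>_x_mon xd_def)
qed

lemma phi_Z_Z_der_multi_scaleK:
  assumes "z \<in> Z" "\<gamma> \<in> exps_s m"
  shows "phi_Z k m \<sigma> (Z_der_multi k m \<sigma> \<gamma> (scaleK r z)) = scaleK r (phi_Z k m \<sigma> (Z_der_multi k m \<sigma> \<gamma> z))"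
proof -
  obtain F c where F: "finite F" "F \<subseteq> exps_s m" "z = (\<Sum>g\<in>F. scaleK (c g) (X g))"
    using Z_form[OF assms(1)] by blast
  have "scaleK r z = (\<Sum>g\<in>F. scaleK (r * c g) (X g))"
    by (simp add: F(3) K.scale_sum_right)
  then show ?thesis
    unfolding F(3) using F assms(2) by (simp add: phi_Z_Z_der_multi)
qed

lemma inverse_phi:
  assumes "a \<in> T"
  shows "has_finite_sum
      (\<lambda>(\<alpha>, \<beta>, \<gamma>).
         (-1) ^ (\<Sum>i\<in>UNIV. \<alpha> i) *
         phi_Z k m \<sigma> (Z_der_multi k m \<sigma> \<gamma> (phi k \<sigma> (delta' \<sigma> \<beta> a * d_mon' \<sigma> \<alpha>))) *
         d_mon \<beta> * x_mon \<alpha> * X_mon k m \<gamma>)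
      (N \<times> N \<times> exps_s m) (inv_into T \<sigma> a)"
proof -
  obtain z where z: "\<And>n. z n \<in> Z" "a = (\<Sum>n\<in>N \<times> N. dx n * z n)"
    using T_form_dx[OF assms] by blast
  show ?thesis
  proof (rule has_finite_sum_inverse[of z "\<lambda>n. d_mon (snd n) * x_mon (fst n)", OF z(1)])
    show "a = (\<Sum>n\<in>N \<times> N. \<sigma> (d_mon (snd n) * x_mon (fst n)) * z n)"
      unfolding z(2) by (intro sum.cong refl) (simp add: \<sigma>_dx)
    fix \<alpha> \<beta> :: "'n \<Rightarrow> nat" and \<gamma> :: "'n + nat \<Rightarrow> nat" assume *: "\<alpha> \<in> N" "\<beta> \<in> N" "\<gamma> \<in> exps_s m"
    let ?s = "(-1) ^ (\<Sum>i\<in>UNIV. \<alpha> i) :: 'k"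
    \<comment> \<open>The sign in the formula cancels the sign produced by the projection.\<close>
    have "?s * ?s = 1" by (simp flip: power_mult_distrib)
    then have eq: "(-1) ^ (\<Sum>i\<in>UNIV. \<alpha> i) * phi_Z k m \<sigma> (Z_der_multi k m \<sigma> \<gamma> (phi k \<sigma> (delta' \<sigma> \<beta> a * d_mon' \<sigma> \<alpha>)))
        = phi_Z k m \<sigma> (Z_der_multi k m \<sigma> \<gamma> (z (\<alpha>, \<beta>)))"
      unfolding z(2) using z(1) * by (simp add: phi_coefficient phi_Z_Z_der_multi_scaleK minus_one_power_eq_scaleK)
    show "(case (\<alpha>, \<beta>, \<gamma>) of (\<alpha>, \<beta>, \<gamma>) \<Rightarrow>
         (-1) ^ (\<Sum>i\<in>UNIV. \<alpha> i) *
         phi_Z k m \<sigma> (Z_der_multi k m \<sigma> \<gamma> (phi k \<sigma> (delta' \<sigma> \<beta> a * d_mon' \<sigma> \<alpha>))) *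
         d_mon \<beta> * x_mon \<alpha> * X_mon k m \<gamma>)
      = phi_Z k m \<sigma> (Z_der_multi k m \<sigma> \<gamma> (z (\<alpha>, \<beta>))) *
        (d_mon (snd (\<alpha>, \<beta>)) * x_mon (fst (\<alpha>, \<beta>)) * X_mon k m \<gamma>)"
      by (simp only: prod.case fst_conv snd_conv eq[symmetric] mult.assoc)
  qed (auto intro!: T_alg_mult d_mon_in x_mon_in)
qed

lemma inverse_psi:
  assumes "a \<in> T"
  shows "has_finite_sum
      (\<lambda>(\<alpha>, \<beta>, \<gamma>).
         phi_Z k m \<sigma> (Z_der_multi k m \<sigma> \<gamma> (psi k \<sigma> (d_mon' \<sigma> \<alpha> * delta' \<sigma> \<beta> a))) *
         x_mon \<alpha> * d_mon \<beta> * X_mon k m \<gamma>)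
      (N \<times> N \<times> exps_s m) (inv_into T \<sigma> a)"
proof -
  obtain z where z: "\<And>n. z n \<in> Z" "a = (\<Sum>n\<in>N \<times> N. xd n * z n)"
    using T_form_xd[OF assms] by blast
  show ?thesis
  proof (rule has_finite_sum_inverse[of z "\<lambda>n. x_mon (fst n) * d_mon (snd n)", OF z(1)])
    show "a = (\<Sum>n\<in>N \<times> N. \<sigma> (x_mon (fst n) * d_mon (snd n)) * z n)"
      unfolding z(2) by (intro sum.cong refl) (simp add: \<sigma>_xd)
    fix \<alpha> \<beta> :: "'n \<Rightarrow> nat" and \<gamma> :: "'n + nat \<Rightarrow> nat" assume *: "\<alpha> \<in> N" "\<beta> \<in> N" "\<gamma> \<in> exps_s m"
    then have "psi k \<sigma> (d_mon' \<sigma> \<alpha> * delta' \<sigma> \<beta> a) = z (\<alpha>, \<beta>)"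
      unfolding z(2) using z(1) by (simp add: psi_coefficient)
    then show "(case (\<alpha>, \<beta>, \<gamma>) of (\<alpha>, \<beta>, \<gamma>) \<Rightarrow>
         phi_Z k m \<sigma> (Z_der_multi k m \<sigma> \<gamma> (psi k \<sigma> (d_mon' \<sigma> \<alpha> * delta' \<sigma> \<beta> a))) *
         x_mon \<alpha> * d_mon \<beta> * X_mon k m \<gamma>)
      = phi_Z k m \<sigma> (Z_der_multi k m \<sigma> \<gamma> (z (\<alpha>, \<beta>))) *
        (x_mon (fst (\<alpha>, \<beta>)) * d_mon (snd (\<alpha>, \<beta>)) * X_mon k m \<gamma>)"
      by (simp add: mult.assoc)
  qed (auto intro!: T_alg_mult d_mon_in x_mon_in)
qed

end

theorem theorem11p2:
  fixes k :: "'n::{finite, linorder} \<Rightarrow> nat" and m :: nat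
    and \<sigma> :: "('n, 'k::field) talg \<Rightarrow> ('n, 'k) talg" and a :: "('n, 'k) talg"
  assumes "CHAR('k) > 0"
    and "\<And>i. k i \<ge> 1"
    and "\<sigma> \<in> Aut_T k m"
    and "a \<in> T_alg k m"
  shows "(has_finite_sum
      (\<lambda>(\<alpha>, \<beta>, \<gamma>).
         (-1) ^ (\<Sum>i\<in>UNIV. \<alpha> i) *
         phi_Z k m \<sigma> (Z_der_multi k m \<sigma> \<gamma> (phi k \<sigma> (delta' \<sigma> \<beta> a * d_mon' \<sigma> \<alpha>))) *
         d_mon \<beta> * x_mon \<alpha> * X_mon k m \<gamma>)
      (exps_N TYPE('k) k \<times> exps_N TYPE('k) k \<times> exps_s m)
      (inv_into (T_alg k m) \<sigma> a)) \<and>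
    (has_finite_sum
      (\<lambda>(\<alpha>, \<beta>, \<gamma>).
         phi_Z k m \<sigma> (Z_der_multi k m \<sigma> \<gamma> (psi k \<sigma> (d_mon' \<sigma> \<alpha> * delta' \<sigma> \<beta> a))) *
         x_mon \<alpha> * d_mon \<beta> * X_mon k m \<gamma>)
      (exps_N TYPE('k) k \<times> exps_N TYPE('k) k \<times> exps_s m)
      (inv_into (T_alg k m) \<sigma> a))"
proof -
  interpret T_aut k m \<sigma> "CHAR('k)" "\<lambda>i. CHAR('k) ^ k i"
    using assms(1,3) by unfold_locales auto
  show ?thesis
    unfolding exps_N_eq using inverse_phi[OF assms(4)] inverse_psi[OF assms(4)] by blast
qed


end
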